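(* Suppose $\mathcal{L}\subset\mathbb{R}^m$ is a lattice of rank $m$ given by a generator matrix $G\in\mathbb{Z}^{m\times m}$, i.e. $\mathcal{L}=G(\mathbb{Z}^m)$. Then one can, in polynomial time, compute an integer $n\ge m$, a scaling factor $s\in\mathbb{Z}_{>0}$, and an orthonormal basis $v_1,\dots,v_n\in\mathbb{Q}^n$ of $\mathbb{R}^n$ such that $\mathcal{L}=s\,P(\mathcal{L}')$, where $\mathcal{L}'=\mathbb{Z}v_1+\dots+\mathbb{Z}v_n$ and $P:\mathbb{R}^n\to\mathbb{R}^m$ is the orthogonal projection onto the first $m$ coordinates. Moreover, one may take $n=O(m\log m+m\log\langle G\rangle)$, where $\langle G\rangle$ is the bit-length of $G$. *)

theory Defs
  imports
    Complex_Main
    "HOL-Library.Log_Nat"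
    "HOL-Computational_Algebra.Polynomial"
    "Jordan_Normal_Form.DL_Rank"
begin

section \<open>Bit-lengths\<close>

text \<open>One bit for the sign, plus the binary digits of the absolute value.\<close>

definition int_size :: "int \<Rightarrow> nat" where
  "int_size a = 1 + floorlog 2 (nat \<bar>a\<bar>)"

definition mat_size :: "int mat \<Rightarrow> nat" where
  "mat_size G = (\<Sum>i<dim_row G. \<Sum>j<dim_col G. int_size (G $$ (i, j)))"


section \<open>Polynomial-time computability\<close>

text \<open>
  The machine model is the random access machine of Aho, Hopcroft and Ullman under the
  logarithmic cost criterion, which is polynomially equivalent to Turing machines: every
  operation is charged the bit-lengths of its operands and every memory access the bit-lengths
  of the address and of the word transferred. Programs are given in structured form (while loops
  instead of jumps). The memory consists of integer registers with integer addresses, all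
  initially 0; input and output are sequences of integers, read and written one at a time.
  As usual in HOL, \<open>div\<close> rounds down and division by 0 gives 0.
\<close>

datatype aexp =
    Const int
  | Load aexp
  | Add aexp aexp
  | Sub aexp aexp
  | Mul aexp aexp
  | Div aexp aexp

datatype com =
    Store aexp aexp
  | Read aexp
  | Write aexp
  | Seq com com
  | Cond aexp com com
  | While aexp com

type_synonym memory = "int \<Rightarrow> int"

fun val :: "memory \<Rightarrow> aexp \<Rightarrow> int" where
  "val M (Const c) = c"
| "val M (Load e) = M (val M e)"
| "val M (Add e1 e2) = val M e1 + val M e2"
| "val M (Sub e1 e2) = val M e1 - val M e2"
| "val M (Mul e1 e2) = val M e1 * val M e2"
| "val M (Div e1 e2) = val M e1 div val M e2"

fun cost :: "memory \<Rightarrow> aexp \<Rightarrow> nat" where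
  "cost M (Const c) = int_size c"
| "cost M (Load e) = cost M e + int_size (val M e) + int_size (M (val M e))"
| "cost M (Add e1 e2) = cost M e1 + cost M e2 + int_size (val M e1) + int_size (val M e2)"
| "cost M (Sub e1 e2) = cost M e1 + cost M e2 + int_size (val M e1) + int_size (val M e2)"
| "cost M (Mul e1 e2) = cost M e1 + cost M e2 + int_size (val M e1) + int_size (val M e2)"
| "cost M (Div e1 e2) = cost M e1 + cost M e2 + int_size (val M e1) + int_size (val M e2)"

text \<open>
  A configuration consists of the memory, the unread input and the output written so far.
  \<open>exec c s t s'\<close> means that \<open>c\<close>, started in \<open>s\<close>, halts in \<open>s'\<close> at total cost \<open>t\<close>.
  Conditions are tested for being positive. Reading from an empty input is an error: there is
  no halting run.
\<close>

type_synonym config = "memory \<times> int list \<times> int list"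

inductive exec :: "com \<Rightarrow> config \<Rightarrow> nat \<Rightarrow> config \<Rightarrow> bool" where
  Store: "exec (Store e1 e2) (M, xs, ys)
            (cost M e1 + cost M e2 + int_size (val M e1) + int_size (val M e2))
            (M(val M e1 := val M e2), xs, ys)"
| Read: "exec (Read e) (M, x # xs, ys)
            (cost M e + int_size (val M e) + int_size x)
            (M(val M e := x), xs, ys)"
| Write: "exec (Write e) (M, xs, ys)
            (cost M e + int_size (val M e))
            (M, xs, ys @ [val M e])"
| Seq: "exec c1 s t1 s' \<Longrightarrow> exec c2 s' t2 s'' \<Longrightarrow> exec (Seq c1 c2) s (t1 + t2) s''"
| CondTrue: "val M b > 0 \<Longrightarrow> exec c1 (M, xs, ys) t s' \<Longrightarrow>
    exec (Cond b c1 c2) (M, xs, ys) (cost M b + int_size (val M b) + t) s'"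
| CondFalse: "\<not> val M b > 0 \<Longrightarrow> exec c2 (M, xs, ys) t s' \<Longrightarrow>
    exec (Cond b c1 c2) (M, xs, ys) (cost M b + int_size (val M b) + t) s'"
| WhileTrue: "val M b > 0 \<Longrightarrow> exec c (M, xs, ys) t1 s' \<Longrightarrow> exec (While b c) s' t2 s'' \<Longrightarrow>
    exec (While b c) (M, xs, ys) (cost M b + int_size (val M b) + t1 + t2) s''"
| WhileFalse: "\<not> val M b > 0 \<Longrightarrow>
    exec (While b c) (M, xs, ys) (cost M b + int_size (val M b)) (M, xs, ys)"

definition computes_in_time :: "com \<Rightarrow> int list \<Rightarrow> int list \<Rightarrow> nat \<Rightarrow> bool" where
  "computes_in_time c xs ys t \<longleftrightarrow> (\<exists>M xs'. exec c (\<lambda>_. 0, xs, []) t (M, xs', ys))"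

text \<open>
  \<open>f\<close> is computable in polynomial time on the instances \<open>A\<close>, where \<open>enc x\<close> is the input
  presented for the instance \<open>x\<close> and \<open>is_code y ys\<close> says that the output \<open>ys\<close> represents the
  result \<open>y\<close>.
\<close>

definition polytime_computable_on ::
  "'a set \<Rightarrow> ('a \<Rightarrow> int list) \<Rightarrow> ('b \<Rightarrow> int list \<Rightarrow> bool) \<Rightarrow> ('a \<Rightarrow> 'b) \<Rightarrow> bool" where
  "polytime_computable_on A enc is_code f \<longleftrightarrow>
     (\<exists>(c :: com) (p :: nat poly). \<forall>x\<in>A. \<exists>ys t.
        computes_in_time c (enc x) ys t \<and> is_code (f x) ys \<and>
        t \<le> poly p (\<Sum>a\<leftarrow>enc x. int_size a))"

text \<open>A square matrix is presented as its dimension followed by its entries, row by row.\<close>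

definition enc_mat :: "int mat \<Rightarrow> int list" where
  "enc_mat G = int (dim_row G) # concat (map list_of_vec (rows G))"

text \<open>
  The output is \<open>n\<close>, \<open>s\<close>, and then the coordinates of the vectors, one vector after the other.
  Each coordinate is written as a numerator and a positive denominator, not necessarily coprime.
\<close>

definition is_fraction :: "rat \<Rightarrow> int \<times> int \<Rightarrow> bool" where
  "is_fraction r pq \<longleftrightarrow> snd pq > 0 \<and> r = of_int (fst pq) / of_int (snd pq)"

definition is_code :: "nat \<times> int \<times> rat vec list \<Rightarrow> int list \<Rightarrow> bool" where
  "is_code = (\<lambda>(n, s, vs) ys. \<exists>fs.
     list_all2 is_fraction (concat (map list_of_vec vs)) fs \<and>
     ys = int n # s # concat (map (\<lambda>(p, q). [p, q]) fs))"


section \<open>Lattices\<close>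

definition real_rank :: "int mat \<Rightarrow> nat" where
  "real_rank G = vec_space.rank (dim_row G) (map_mat real_of_int G)"

definition int_lattice :: "int mat \<Rightarrow> real vec set" where
  "int_lattice G = {map_mat real_of_int G *\<^sub>v map_vec real_of_int x | x. x \<in> carrier_vec (dim_col G)}"

definition int_span :: "nat \<Rightarrow> real vec list \<Rightarrow> real vec set" where
  "int_span n vs =
     {finsum_vec TYPE(real) n (\<lambda>i. real_of_int (a i) \<cdot>\<^sub>v vs ! i) {..<length vs} | a. True}"

definition orthonormal_basis :: "nat \<Rightarrow> real vec list \<Rightarrow> bool" where
  "orthonormal_basis n vs \<longleftrightarrow>
     distinct vs \<and> vectorspace.basis class_ring (module_vec TYPE(real) n) (set vs) \<and>
     (\<forall>i<length vs. \<forall>j<length vs. scalar_prod (vs ! i) (vs ! j) = (if i = j then 1 else 0))"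

end

theory Submission
  imports Defs "Jordan_Normal_Form.Char_Poly"
begin

text \<open>
  Let \<open>Z = [G\<^sup>T | U]\<close> be an integer \<open>m \<times> n\<close> matrix with \<open>Z Z\<^sup>T = 2 s I\<close>. Then
  \<open>V = I - Z\<^sup>T Z / s\<close> is symmetric with \<open>V\<^sup>2 = I\<close>, so its rows form a rational orthonormal basis, and
  the first \<open>m\<close> rows of \<open>s V\<close> are \<open>[s I - G G\<^sup>T | - G U]\<close>. If the columns of \<open>U\<close> generate
  \<open>\<int>\<^sup>m\<close> and \<open>s\<close> is a multiple of a number \<open>d \<noteq> 0\<close> with \<open>d \<int>\<^sup>m \<subseteq> G \<int>\<^sup>m\<close>, the columns of this
  \<open>m \<times> n\<close> matrix generate exactly \<open>G \<int>\<^sup>m\<close>.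

  Such a \<open>d\<close> comes from the Faddeev--LeVerrier recursion in a division-free form, for which the bounds on
  the intermediate numbers are immediate. The columns of \<open>U\<close> must satisfy \<open>U U\<^sup>T = 2 s I - G\<^sup>T G\<close>; they
  are found by eliminating one row after the other. A column with entry \<open>x\<close> in the current row leaves the
  remainders modulo \<open>x\<close> in that row of the residual matrix; \<open>x\<close> runs through iterated integer square roots
  down to 1, so the row is cleared after doubly logarithmically many columns while the other entries hardly
  change. The diagonal entry that remains is nonnegative since \<open>s\<close> is large, and is then written greedily
  as a sum of squares, again with doubly logarithmically many terms.
\<close>


text \<open>The matrix \<open>Z\<^sup>T Z / (2 s)\<close> is an orthogonal projection of rank m, so
  V is the reflection that negates the row space of Z. The obstacle is the number of columns: one
  column for every bit would make n of order m times the bit-length of s, and that bit-length is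
  only bounded by a polynomial in the input size. Taking square roots makes the number of columns
  per row logarithmic in the bit-length, hence O(log <G>). By Lagrange four squares would do for
  each diagonal entry, but the greedy choice needs integer square roots only and is short enough.

  The last divisor, 1, does double duty: besides clearing the row it leaves a column of U with entry
  1 in the current row and 0 in all earlier ones. The m columns of this kind are unitriangular,
  which is why the columns of U generate the whole integer lattice.

  Clearing a row disturbs the rows that follow, by an amount proportional to \<open>w1\<close>. This
  is harmless: the next row needs entries of size at most \<open>20 * m * w1\<close>, not below
  \<open>w1\<close>, since its first division by \<open>w1\<close> then has quotients of at most
  \<open>20 * m\<close>, whose squares \<open>w1\<close> already contains.\<close>

section \<open>The Faddeev--LeVerrier recursion\<close>


text \<open>\<open>fad m a k\<close> is \<open>k!\<close> times the \<open>k\<close>-th Faddeev--LeVerrier matrix of \<open>a\<close>; the factorial avoids divisions.\<close>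

fun fad :: "nat \<Rightarrow> (nat \<Rightarrow> nat \<Rightarrow> int) \<Rightarrow> nat \<Rightarrow> nat \<Rightarrow> nat \<Rightarrow> int" where
  "fad m a 0 i j = (if i = j then 1 else 0)"
| "fad m a (Suc k) i j = int (Suc k) * (\<Sum>l<m. a i l * fad m a k l j)
     - (if i = j then \<Sum>i<m. \<Sum>l<m. a i l * fad m a k l i else 0)"

definition fad_trace :: "nat \<Rightarrow> (nat \<Rightarrow> nat \<Rightarrow> int) \<Rightarrow> nat \<Rightarrow> int" where
  "fad_trace m a k = (\<Sum>i<m. \<Sum>l<m. a i l * fad m a k l i)"

section \<open>The adjugate of the characteristic matrix and its coefficients\<close>

lemma char_poly_matrix_mat_delete:
  assumes A: "A \<in> carrier_mat m m" and "i < m"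
  shows "char_poly_matrix (mat_delete A i i) = mat_delete (char_poly_matrix A) i i"
  using assms by (intro eq_matI) (auto simp: char_poly_matrix_def mat_delete_def)

text \<open>Diagonal cofactors carry the sign + and are the characteristic polynomials of the
  principal submatrices. The identity expresses the coefficients of the characteristic polynomial by
  traces, which is what the recursion computes.\<close>

lemma trace_adj_char_poly_matrix:
  assumes A: "(A :: int mat) \<in> carrier_mat m m"
  shows "(\<Sum>i<m. adj_mat (char_poly_matrix A) $$ (i, i)) = pderiv (char_poly A)"
proof -
  have "adj_mat (char_poly_matrix A) $$ (i, i) = char_poly (mat_delete A i i)" if "i < m" for i
    using that A char_poly_matrix_mat_delete[OF A that]
    by (simp add: adj_mat_def cofactor_def char_poly_def char_poly_matrix_def)
  then show ?thesis by (simp add: pderiv_char_poly[OF A])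
qed

context
  fixes m :: nat and a :: "nat \<Rightarrow> nat \<Rightarrow> int"
begin

abbreviation "entry_mat \<equiv> mat m m (\<lambda>(i, j). a i j)"
abbreviation "adj_char \<equiv> adj_mat (char_poly_matrix entry_mat)"

text \<open>This is \<open>(x I - A) adj = det I\<close> read off entry by entry, with
  \<open>pCons 0\<close> as multiplication by x. Comparing coefficients gives the two recurrences
  below.\<close>

lemma adj_char_poly_entry:
  assumes i: "i < m" and j: "j < m"
  shows "pCons 0 (adj_char $$ (i, j)) - (\<Sum>l<m. smult (a i l) (adj_char $$ (l, j)))
    = (if i = j then char_poly entry_mat else 0)"
proof -
  have A: "entry_mat \<in> carrier_mat m m" by simp
  have X: "char_poly_matrix entry_mat \<in> carrier_mat m m" using A by simp
  note adj = adj_mat[OF X]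
  have "(char_poly_matrix entry_mat * adj_char) $$ (i, j) = (det (char_poly_matrix entry_mat) \<cdot>\<^sub>m 1\<^sub>m m) $$ (i, j)"
    using adj(2) by simp
  moreover have "(char_poly_matrix entry_mat * adj_char) $$ (i, j)
      = (\<Sum>l<m. char_poly_matrix entry_mat $$ (i, l) * adj_char $$ (l, j))"
    using carrier_matD[OF X] adj(1) i j
    by (subst index_mult_mat) (auto simp: scalar_prod_def atLeast0LessThan intro!: sum.cong)
  moreover have "\<dots> = (\<Sum>l<m. (if l = i then pCons 0 (adj_char $$ (l, j)) else 0)
      - smult (a i l) (adj_char $$ (l, j)))"
  proof (rule sum.cong[OF refl])
    fix l assume l: "l \<in> {..<m}"
    have "char_poly_matrix entry_mat $$ (i, l) = (if l = i then [:0, 1:] else 0) - [:a i l:]"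
      using i l by (auto simp: char_poly_matrix_def)
    then show "char_poly_matrix entry_mat $$ (i, l) * adj_char $$ (l, j)
      = (if l = i then pCons 0 (adj_char $$ (l, j)) else 0) - smult (a i l) (adj_char $$ (l, j))"
      by (simp add: left_diff_distrib)
  qed
  ultimately show ?thesis
    using i j by (simp add: sum_subtractf char_poly_def)
qed

lemma adj_coeff_Suc:
  assumes "i < m" "j < m"
  shows "coeff (adj_char $$ (i, j)) k = (\<Sum>l<m. a i l * coeff (adj_char $$ (l, j)) (Suc k))
    + (if i = j then coeff (char_poly entry_mat) (Suc k) else 0)"
  using arg_cong[OF adj_char_poly_entry[OF assms], of "\<lambda>p. coeff p (Suc k)"]
  by (auto simp: coeff_sum split: if_splits)

lemma adj_coeff_0:
  assumes "i < m" "j < m"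
  shows "0 = (\<Sum>l<m. a i l * coeff (adj_char $$ (l, j)) 0)
    + (if i = j then coeff (char_poly entry_mat) 0 else 0)"
  using arg_cong[OF adj_char_poly_entry[OF assms], of "\<lambda>p. coeff p 0"]
  by (auto simp: coeff_sum split: if_splits)

lemma char_poly_entry_mat: "degree (char_poly entry_mat) = m" "coeff (char_poly entry_mat) m = 1"
  using degree_monic_char_poly[of entry_mat m] by auto

text \<open>No degrees of cofactors are computed. Above some common degree bound all coefficients
  vanish, and \<open>adj_coeff_Suc\<close> carries the vanishing down as long as the characteristic
  polynomial contributes nothing, that is, down to index m.\<close>

lemma adj_coeff_large:
  assumes "i < m" "j < m" "k \<ge> m"
  shows "coeff (adj_char $$ (i, j)) k = 0"
proof -
  define D where "D = m + (\<Sum>i<m. \<Sum>j<m. degree (adj_char $$ (i, j)))"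
  have deg: "degree (adj_char $$ (i, j)) \<le> D" if "i < m" "j < m" for i j
  proof -
    have "degree (adj_char $$ (i, j)) \<le> (\<Sum>j<m. degree (adj_char $$ (i, j)))"
      using that by (intro member_le_sum) auto
    also have "\<dots> \<le> (\<Sum>i<m. \<Sum>j<m. degree (adj_char $$ (i, j)))"
      using that by (intro member_le_sum[of i "{..<m}" "\<lambda>i. \<Sum>j<m. degree (adj_char $$ (i, j))"]) auto
    finally show ?thesis by (simp add: D_def)
  qed
  have "\<forall>i<m. \<forall>j<m. coeff (adj_char $$ (i, j)) k = 0" if "m \<le> k" "k \<le> Suc D" for k
    using that(2,1)
  proof (induction rule: inc_induct)
    case base
    then show ?case using deg by (auto intro!: coeff_eq_0 simp: less_Suc_eq_le)
  next
    case (step n)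
    then show ?case using char_poly_entry_mat(1) by (auto simp: adj_coeff_Suc[of _ _ n] coeff_eq_0)
  qed
  then show ?thesis using assms deg[of i j] by (cases "k \<le> Suc D") (auto intro!: coeff_eq_0)
qed

text \<open>The matrix coefficient of \<open>x\<^sup>m\<^sup>-\<^sup>1\<^sup>-\<^sup>k\<close> in the adjugate of \<open>x I - A\<close>.\<close>

definition adj_coeffs :: "nat \<Rightarrow> nat \<Rightarrow> nat \<Rightarrow> int" where
  "adj_coeffs k i j = (if k < m then coeff (adj_char $$ (i, j)) (m - 1 - k) else 0)"

lemma adj_coeffs_0:
  assumes "i < m" "j < m"
  shows "adj_coeffs 0 i j = (if i = j then 1 else 0)"
  using assms adj_coeff_Suc[of i j "m - 1"] adj_coeff_large[of _ _ m] char_poly_entry_mat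
  by (auto simp: adj_coeffs_def)

text \<open>For \<open>Suc k = m\<close> the left-hand side is 0 by definition, and the equation is
  the one for the constant terms; this is the Cayley--Hamilton end of the recursion.\<close>

lemma adj_coeffs_Suc:
  assumes "i < m" "j < m" "k < m"
  shows "adj_coeffs (Suc k) i j = (\<Sum>l<m. a i l * adj_coeffs k l j)
    + (if i = j then coeff (char_poly entry_mat) (m - Suc k) else 0)"
proof (cases "Suc k < m")
  case True
  then have "m - Suc k = Suc (m - 1 - Suc k)" by simp
  then show ?thesis
    using adj_coeff_Suc[OF assms(1,2), of "m - 1 - Suc k"] True by (simp add: adj_coeffs_def)
next
  case False
  then have "m - 1 - k = 0" "m - Suc k = 0" using assms by auto
  then show ?thesis using adj_coeff_0[OF assms(1,2)] False assms(3) by (simp add: adj_coeffs_def split: if_splits)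
qed

text \<open>Compare the coefficients of \<open>x^(m - 1 - k)\<close> in
  \<open>trace_adj_char_poly_matrix\<close>; the factor comes from the derivative. For
  \<open>k = m\<close> both sides are 0.\<close>

lemma adj_coeffs_trace:
  assumes "k \<le> m"
  shows "(\<Sum>i<m. adj_coeffs k i i) = (int m - int k) * coeff (char_poly entry_mat) (m - k)"
proof (cases "k < m")
  case True
  then have e: "m - k = Suc (m - 1 - k)" by simp
  have "(\<Sum>i<m. adj_coeffs k i i) = coeff (pderiv (char_poly entry_mat)) (m - 1 - k)"
    using True by (simp add: adj_coeffs_def coeff_sum[symmetric] trace_adj_char_poly_matrix[of entry_mat m])
  also have "\<dots> = (int m - int k) * coeff (char_poly entry_mat) (m - k)"
    unfolding coeff_pderiv e[symmetric] using True by (simp add: of_nat_diff)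
  finally show ?thesis .
qed (use assms in \<open>auto simp: adj_coeffs_def\<close>)

text \<open>Computing the trace of \<open>adj_coeffs (Suc k)\<close> in two ways shows that the
  trace of A times the k-th matrix is \<open>- Suc k\<close> times the next coefficient of the
  characteristic polynomial. The usual recursion divides by \<open>Suc k\<close> here; multiplying
  the other term instead accumulates the factorial.\<close>

lemma fad_eq_adj_coeffs:
  assumes "k \<le> m" "i < m" "j < m"
  shows "fad m a k i j = fact k * adj_coeffs k i j"
  using assms
proof (induction k arbitrary: i j)
  case 0
  then show ?case by (simp add: adj_coeffs_0)
next
  case (Suc k)
  let ?c = "coeff (char_poly entry_mat) (m - Suc k)"
  have P: "(\<Sum>l<m. a i l * fad m a k l j) = fact k * (\<Sum>l<m. a i l * adj_coeffs k l j)"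
    if "i < m" "j < m" for i j
    using Suc that by (simp add: sum_distrib_left mult_ac)
  have "(\<Sum>i<m. adj_coeffs (Suc k) i i) = (\<Sum>i<m. \<Sum>l<m. a i l * adj_coeffs k l i) + int m * ?c"
    using Suc.prems by (simp add: adj_coeffs_Suc sum.distrib)
  then have tr: "(\<Sum>i<m. \<Sum>l<m. a i l * adj_coeffs k l i) = - int (Suc k) * ?c"
    using adj_coeffs_trace[of "Suc k"] Suc.prems by (simp add: algebra_simps)
  have "(\<Sum>i<m. \<Sum>l<m. a i l * fad m a k l i) = (\<Sum>i<m. fact k * (\<Sum>l<m. a i l * adj_coeffs k l i))"
    using P by (intro sum.cong) auto
  also have "\<dots> = - fact (Suc k) * ?c"
    unfolding sum_distrib_left[symmetric] tr by (simp add: algebra_simps)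
  finally have T: "(\<Sum>i<m. \<Sum>l<m. a i l * fad m a k l i) = - fact (Suc k) * ?c" .
  show ?case
    using Suc.prems unfolding fad.simps T P[OF Suc.prems(2,3)]
    by (auto simp: adj_coeffs_Suc algebra_simps)
qed

lemma fad_m:
  assumes "i < m" "j < m"
  shows "fad m a m i j = 0"
  using fad_eq_adj_coeffs[OF le_refl assms] by (simp add: adj_coeffs_def)

lemma fad_trace_eq:
  "k < m \<Longrightarrow> (\<Sum>i<m. fad m a (Suc k) i i) = (int (Suc k) - int m) * fad_trace m a k"
  by (simp add: sum_subtractf fad_trace_def sum_distrib_left[symmetric] algebra_simps)

text \<open>As \<open>fad m a m\<close> vanishes, the last step of the recursion has become an
  equation for an inverse up to a scalar. By the preceding proof that scalar is, up to sign, m!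
  times the determinant.\<close>

lemma fad_inverse:
  assumes "i < m" "j < m"
  shows "int m * (\<Sum>l<m. a i l * fad m a (m - 1) l j) = (if i = j then fad_trace m a (m - 1) else 0)"
proof -
  obtain k where k: "m = Suc k" using assms by (cases m) auto
  show ?thesis using fad_m[OF assms] unfolding fad_trace_def k by (simp add: algebra_simps)
qed

text \<open>Were the last trace 0, A would annihilate \<open>fad m a (m - 1)\<close>, which would
  vanish by injectivity. Then its trace, a nonzero multiple of the trace one step earlier, vanishes
  too, and the argument descends to \<open>fad m a 0\<close>, the identity matrix.\<close>

lemma fad_trace_nonzero:
  assumes inj: "\<And>x. (\<And>i. i < m \<Longrightarrow> (\<Sum>l<m. a i l * x l) = 0) \<Longrightarrow> (\<And>i. i < m \<Longrightarrow> x i = (0::int))"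
    and m: "m > 0"
  shows "fad_trace m a (m - 1) \<noteq> 0"
proof
  assume *: "fad_trace m a (m - 1) = 0"
  have zero: "fad m a k i j = 0" if "fad_trace m a k = 0" "k < m"
      "\<And>i j. i < m \<Longrightarrow> j < m \<Longrightarrow> fad m a (Suc k) i j = 0" "i < m" "j < m" for k i j
  proof (rule inj[of "\<lambda>l. fad m a k l j"])
    fix i assume i: "i < m"
    have "int (Suc k) * (\<Sum>l<m. a i l * fad m a k l j) = 0"
      using that(3)[OF i that(5)] that(1) by (auto simp: fad_trace_def split: if_splits)
    then show "(\<Sum>l<m. a i l * fad m a k l j) = 0" by simp
  qed (use that in auto)
  have "\<forall>i<m. \<forall>j<m. fad m a k i j = 0" if "k \<le> m - 1" for k
    using that
  proof (induction rule: inc_induct)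
    case base
    show ?case using zero[of "m - 1"] * m fad_m by auto
  next
    case (step k)
    then have "k < m" "int (Suc k) - int m \<noteq> 0" by auto
    moreover have "fad_trace m a k = 0"
      using fad_trace_eq[OF \<open>k < m\<close>] step.IH calculation(2) by auto
    ultimately show ?case using zero[of k] step.IH by blast
  qed
  from this[of 0] m show False by (auto dest!: spec[of _ 0])
qed

end

section \<open>Writing a dominant multiple of the identity as a sum of squares\<close>


text \<open>A relation rather than a function: entries outside the index range and columns after c
  are left open, because the memory of the program may hold anything there.\<close>

definition emits :: "nat \<Rightarrow> nat \<Rightarrow> int \<Rightarrow> (nat \<Rightarrow> nat \<Rightarrow> int) \<Rightarrow> (nat \<Rightarrow> nat \<Rightarrow> int) \<Rightarrow> nat \<Rightarrow>
    (nat \<Rightarrow> nat \<Rightarrow> int) \<Rightarrow> (nat \<Rightarrow> nat \<Rightarrow> int) \<Rightarrow> bool" where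
  "emits m i x r z c r' z' \<longleftrightarrow>
     (\<forall>p<c. \<forall>j<m. z' p j = z p j) \<and>
     (\<forall>j<m. z' c j = (if j = i then x else r i j div x)) \<and>
     (\<forall>j<m. \<forall>l<m. r' j l = r j l - z' c j * z' c l)"

text \<open>
  \<open>F\<close> is the Gram matrix of the columns present at the start, and \<open>S I\<close> is the matrix to be reached. The
  square roots start at \<open>w1\<close>, which exceeds the entries of \<open>F\<close> by enough to absorb the changes made by
  all the rows.
\<close>

locale elimination =
  fixes m :: nat and e0 w1 S :: int and F :: "nat \<Rightarrow> nat \<Rightarrow> int"
  assumes F_le: "\<And>j l. j < m \<Longrightarrow> l < m \<Longrightarrow> \<bar>F j l\<bar> \<le> e0"
    and e0_nonneg: "0 \<le> e0"
    and w1_eq: "w1 = e0 + (20 * int m + 1)\<^sup>2"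
    and S_ge: "4 * w1\<^sup>2 \<le> S"
begin

text \<open>Bounds the change of the remaining off-diagonal entries caused by the elimination of one row.\<close>

definition drift :: int where "drift = (20 * int m + 1)\<^sup>2 + 18 * w1"

definition gram_inv :: "(nat \<Rightarrow> nat \<Rightarrow> int) \<Rightarrow> (nat \<Rightarrow> nat \<Rightarrow> int) \<Rightarrow> nat \<Rightarrow> bool" where
  "gram_inv r z c \<longleftrightarrow>
     (\<forall>j<m. \<forall>l<m. r j l + (\<Sum>p<c. z p j * z p l) = (if j = l then S else 0))"

definition zero_inv :: "nat \<Rightarrow> (nat \<Rightarrow> nat \<Rightarrow> int) \<Rightarrow> bool" where
  "zero_inv i r \<longleftrightarrow> (\<forall>j<m. \<forall>l<m. j < i \<or> l < i \<longrightarrow> r j l = 0)"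

text \<open>The witnesses are columns whose first nonzero entry is a 1 at position a, a
  unitriangular system. The condition \<open>m \<le> p\<close> places them in U and not among the
  columns of \<open>G\<^sup>T\<close>.\<close>

definition unit_inv :: "nat \<Rightarrow> (nat \<Rightarrow> nat \<Rightarrow> int) \<Rightarrow> nat \<Rightarrow> bool" where
  "unit_inv i z c \<longleftrightarrow> m \<le> c \<and> (\<forall>a<i. \<exists>p<c. m \<le> p \<and> z p a = 1 \<and> (\<forall>b<a. z p b = 0))"

definition near :: "nat \<Rightarrow> (nat \<Rightarrow> nat \<Rightarrow> int) \<Rightarrow> int \<Rightarrow> bool" where
  "near i r d \<longleftrightarrow>
     (\<forall>j<m. \<forall>l<m. i \<le> j \<longrightarrow> i \<le> l \<longrightarrow> \<bar>r j l - ((if j = l then S else 0) - F j l)\<bar> \<le> d)"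

definition row_inv :: "nat \<Rightarrow> (nat \<Rightarrow> nat \<Rightarrow> int) \<Rightarrow> (nat \<Rightarrow> nat \<Rightarrow> int) \<Rightarrow> nat \<Rightarrow> bool" where
  "row_inv i r z c \<longleftrightarrow>
     gram_inv r z c \<and> zero_inv i r \<and> unit_inv i z c \<and> near i r (int i * drift)"

text \<open>
  The term \<open>18 * (w1 - w)\<close> is a potential: passing from \<open>w\<close> to its integer square root, which is at most
  \<open>w / 2\<close>, adds a column whose other entries are at most \<open>3 * sqrt w\<close>.
\<close>

definition reduce_inv :: "nat \<Rightarrow> int \<Rightarrow> (nat \<Rightarrow> nat \<Rightarrow> int) \<Rightarrow> (nat \<Rightarrow> nat \<Rightarrow> int) \<Rightarrow> nat \<Rightarrow> bool" where
  "reduce_inv i w r z c \<longleftrightarrow>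
     gram_inv r z c \<and> zero_inv i r \<and> 1 \<le> w \<and> w \<le> w1 \<and>
     unit_inv i z c \<and> (w = 1 \<longrightarrow> unit_inv (Suc i) z c) \<and>
     near (Suc i) r (int i * drift + (20 * int m + 1)\<^sup>2 + 18 * (w1 - w)) \<and>
     (\<forall>j<m. i < j \<longrightarrow> 0 \<le> r i j \<and> r i j < w) \<and>
     S - e0 - int i * drift - w1\<^sup>2 - 2 * (w1 - w) \<le> r i i"

text \<open>The value \<open>w1\<^sup>2\<close> marks a row that is still untouched. Its integer
  square root is exactly \<open>w1\<close>, so the first column of a row comes from the same loop
  body as the later ones.\<close>

definition phase_inv :: "nat \<Rightarrow> int \<Rightarrow> (nat \<Rightarrow> nat \<Rightarrow> int) \<Rightarrow> (nat \<Rightarrow> nat \<Rightarrow> int) \<Rightarrow> nat \<Rightarrow> bool" where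
  "phase_inv i w r z c \<longleftrightarrow> w = w1\<^sup>2 \<and> row_inv i r z c \<or> reduce_inv i w r z c"

definition square_inv :: "nat \<Rightarrow> (nat \<Rightarrow> nat \<Rightarrow> int) \<Rightarrow> (nat \<Rightarrow> nat \<Rightarrow> int) \<Rightarrow> nat \<Rightarrow> bool" where
  "square_inv i r z c \<longleftrightarrow>
     gram_inv r z c \<and> zero_inv i r \<and> unit_inv (Suc i) z c \<and> near (Suc i) r (int (Suc i) * drift) \<and>
     (\<forall>j<m. i < j \<longrightarrow> r i j = 0) \<and> 0 \<le> r i i"

section \<open>Numerical estimates, and the effect of one column on the invariants\<close>

lemma w1_ge: "(20 * int m + 1)\<^sup>2 \<le> w1" "e0 \<le> w1" "1 \<le> w1" "0 < m \<Longrightarrow> 20 * int m \<le> w1" "0 < m \<Longrightarrow> 2 \<le> w1"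
proof -
  show 1: "(20 * int m + 1)\<^sup>2 \<le> w1" "e0 \<le> w1" using e0_nonneg by (simp_all add: w1_eq)
  have "20 * int m + 1 \<le> (20 * int m + 1)\<^sup>2" by (intro self_le_power) auto
  from order_trans[OF this 1(1)] have "20 * int m + 1 \<le> w1" .
  then show "1 \<le> w1" "0 < m \<Longrightarrow> 20 * int m \<le> w1" "0 < m \<Longrightarrow> 2 \<le> w1" by linarith+
qed

lemma drift_nonneg: "0 \<le> drift"
  using w1_ge(3) by (simp add: drift_def)

text \<open>By the choice of \<open>w1\<close>, \<open>drift\<close> equals
  \<open>19 * w1 - e0\<close>, so m drifts together with \<open>e0\<close> stay below
  \<open>20 * m * w1\<close>. This is the origin of the constant 20 in \<open>w1\<close>: it also
  makes \<open>20 * m * w1\<close> at most \<open>w1\<^sup>2\<close>.\<close>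

lemma e0_drift:
  assumes "0 < m" "i \<le> m"
  shows "e0 + int i * drift \<le> 20 * int m * w1"
proof -
  have "int i * drift \<le> int m * drift" using assms drift_nonneg by (intro mult_right_mono) auto
  moreover have "drift = (w1 - e0) + 18 * w1" unfolding drift_def using w1_eq by linarith
  then have "int m * drift = int m * (19 * w1 - e0)" by simp
  then have "int m * drift = 19 * (int m * w1) - int m * e0" by (simp add: right_diff_distrib)
  moreover have "1 * e0 \<le> int m * e0" using assms e0_nonneg by (intro mult_right_mono) auto
  moreover have "0 \<le> int m * w1" using w1_ge(3) by simp
  ultimately show ?thesis by linarith
qed

lemma e0_drift_le:
  assumes "0 < m" "i \<le> m"
  shows "e0 + int i * drift \<le> w1\<^sup>2"
proof -
  have "20 * int m * w1 \<le> w1 * w1" using w1_ge assms by (intro mult_right_mono) auto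
  then show ?thesis using e0_drift[OF assms] by (simp add: power2_eq_square)
qed

lemma gram_sym: "gram_inv r z c \<Longrightarrow> j < m \<Longrightarrow> l < m \<Longrightarrow> r j l = r l j"
proof -
  assume a: "gram_inv r z c" "j < m" "l < m"
  have "(\<Sum>p<c. z p j * z p l) = (\<Sum>p<c. z p l * z p j)" by (simp add: mult.commute)
  moreover have "r j l + (\<Sum>p<c. z p j * z p l) = (if j = l then S else 0)"
    "r l j + (\<Sum>p<c. z p l * z p j) = (if l = j then S else 0)"
    using a unfolding gram_inv_def by blast+
  ultimately show "r j l = r l j" by (auto split: if_splits)
qed

lemma emits_gram:
  assumes "gram_inv r z c" "emits m i x r z c r' z'"
  shows "gram_inv r' z' (Suc c)"
proof -
  have "(\<Sum>p<c. z' p j * z' p l) = (\<Sum>p<c. z p j * z p l)" if "j < m" "l < m" for j l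
    using that assms(2) by (intro sum.cong) (auto simp: emits_def)
  then show ?thesis using assms by (simp add: gram_inv_def emits_def)
qed

lemma emits_zero:
  assumes "zero_inv i r" "emits m i x r z c r' z'" "i < m"
  shows "zero_inv i r'" "j < i \<Longrightarrow> z' c j = 0"
  using assms by (auto simp: zero_inv_def emits_def)

lemma emits_unit:
  assumes "unit_inv k z c" "emits m i x r z c r' z'" "k \<le> m"
  shows "unit_inv k z' (Suc c)"
  unfolding unit_inv_def
proof (intro conjI allI impI)
  show "m \<le> Suc c" using assms(1) by (simp add: unit_inv_def)
  fix a assume a: "a < k"
  then obtain p where p: "p < c" "m \<le> p" "z p a = 1" "\<forall>b<a. z p b = 0"
    using assms(1) unfolding unit_inv_def by blast
  then have "z' p a = 1" "\<forall>b<a. z' p b = 0" using assms(2,3) a by (auto simp: emits_def)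
  then show "\<exists>p<Suc c. m \<le> p \<and> z' p a = 1 \<and> (\<forall>b<a. z' p b = 0)" using p(1,2) less_SucI by blast
qed

text \<open>Position i of the new column holds the divisor 1, and the earlier positions hold
  quotients of 0 because the earlier columns of the residual are already cleared.\<close>

lemma emits_unit_Suc:
  assumes "unit_inv i z c" "emits m i 1 r z c r' z'" "zero_inv i r" "i < m"
  shows "unit_inv (Suc i) z' (Suc c)"
proof -
  have "z' c i = 1 \<and> (\<forall>b<i. z' c b = 0)"
    using assms emits_zero(2)[OF assms(3,2,4)] by (auto simp: emits_def)
  moreover have "unit_inv i z' (Suc c)" using emits_unit assms by auto
  moreover have "m \<le> c" using assms(1) by (simp add: unit_inv_def)
  ultimately show ?thesis unfolding unit_inv_def by (metis lessI less_SucE)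
qed

lemma emits_near:
  assumes "near k r d" "emits m i x r z c r' z'" "k \<le> k'"
    and u: "\<And>j. k' \<le> j \<Longrightarrow> j < m \<Longrightarrow> \<bar>z' c j\<bar> \<le> b"
  shows "near k' r' (d + b\<^sup>2)"
  unfolding near_def
proof (intro allI impI)
  fix j l assume jl: "j < m" "l < m" "k' \<le> j" "k' \<le> l"
  have "\<bar>z' c j * z' c l\<bar> \<le> b\<^sup>2"
    unfolding abs_mult power2_eq_square using u[of j] u[of l] jl by (intro mult_mono) auto
  moreover have "\<bar>r j l - ((if j = l then S else 0) - F j l)\<bar> \<le> d"
    using assms(1,3) jl unfolding near_def by auto
  moreover have "r' j l = r j l - z' c j * z' c l" using assms(2) jl by (simp add: emits_def)
  ultimately show "\<bar>r' j l - ((if j = l then S else 0) - F j l)\<bar> \<le> d + b\<^sup>2" by linarith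
qed

lemma near_mono: "near i r d \<Longrightarrow> d \<le> d' \<Longrightarrow> i \<le> i' \<Longrightarrow> near i' r d'"
  unfolding near_def by (meson order_trans)

lemma emits_row:
  assumes e: "emits m i x r z c r' z'" and "i < m" "0 < x" "j < m" "j \<noteq> i"
  shows "r' i j = r i j mod x"
  using assms minus_div_mult_eq_mod[of "r i j" x]
  by (simp add: emits_def minus_mult_div_eq_mod)

section \<open>Clearing one row and then its diagonal entry\<close>

lemma abs_div_le_bound:
  fixes a x b :: int
  assumes "\<bar>a\<bar> \<le> b * x" "0 < x"
  shows "\<bar>a div x\<bar> \<le> b"
proof -
  have "a div x \<le> b * x div x" "(- b) * x div x \<le> a div x"
    using assms by (intro zdiv_mono1; simp)+
  moreover have "(- b) * x div x = - b" using assms(2) nonzero_mult_div_cancel_right[of x "- b"] by simp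
  ultimately show ?thesis using assms(2) by simp
qed

text \<open>Off the diagonal the row is at most \<open>e0 + i * drift\<close>, hence at most
  \<open>20 * m * w1\<close>. So the quotients by \<open>w1\<close> are at most
  \<open>20 * m\<close>, and the other rows change by at most the square that is contained in
  \<open>w1\<close>.\<close>

lemma phase_first:
  assumes inv: "row_inv i r z c" and i: "i < m" and e: "emits m i w1 r z c r' z'"
  shows "reduce_inv i w1 r' z' (Suc c)"
proof -
  have m: "0 < m" using i by simp
  have gram: "gram_inv r z c" and zero: "zero_inv i r" and unit: "unit_inv i z c"
    and near: "near i r (int i * drift)"
    using inv by (auto simp: row_inv_def)
  have w: "0 < w1" "w1 \<noteq> 1" using w1_ge m by auto
  have u: "\<bar>z' c j\<bar> \<le> 20 * int m + 1" if "Suc i \<le> j" "j < m" for j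
  proof -
    have "\<bar>r i j - ((if i = j then S else 0) - F i j)\<bar> \<le> int i * drift"
      using near that i unfolding near_def by (meson Suc_leD le_refl)
    then have "\<bar>r i j + F i j\<bar> \<le> int i * drift" using that by simp
    then have "\<bar>r i j\<bar> \<le> 20 * int m * w1"
      using F_le[OF i that(2)] e0_drift[OF m less_imp_le[OF i]] by linarith
    then have "\<bar>r i j div w1\<bar> \<le> 20 * int m" using w by (intro abs_div_le_bound) auto
    then show ?thesis using e that by (simp add: emits_def)
  qed
  have "near (Suc i) r' (int i * drift + (20 * int m + 1)\<^sup>2)"
    by (rule emits_near[OF near e _ u]) auto
  moreover have "S - e0 - int i * drift - w1\<^sup>2 \<le> r' i i"
  proof -
    have "\<bar>r i i - ((if i = i then S else 0) - F i i)\<bar> \<le> int i * drift"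
      using near i unfolding near_def by blast
    moreover have "r' i i = r i i - w1\<^sup>2" using e i by (simp add: emits_def power2_eq_square)
    ultimately show ?thesis using F_le[OF i i] by (smt (verit))
  qed
  ultimately show ?thesis
    using emits_gram[OF gram e] emits_zero(1)[OF zero e i] emits_unit[OF unit e] i w
      emits_row[OF e i w(1)]
    by (auto simp: reduce_inv_def)
qed

text \<open>Both potentials are paid for by \<open>2 * x \<le> w\<close>, which gives
  \<open>x\<^sup>2 \<le> w \<le> 2 * (w - x)\<close>. The diagonal loses \<open>x\<^sup>2\<close>,
  whence the factor 2. The row entries are below \<open>w \<le> x * (x + 2)\<close>, so the
  quotients are at most \<open>x + 2 \<le> 3 * x\<close>, and nine times the same estimate gives the
  factor 18.\<close>

lemma phase_reduce:
  assumes inv: "reduce_inv i w r z c" and i: "i < m" and e: "emits m i x r z c r' z'"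
    and w: "1 < w" and x: "0 \<le> x" "x\<^sup>2 \<le> w" "w < (x + 1)\<^sup>2"
  shows "reduce_inv i x r' z' (Suc c)"
proof -
  have gram: "gram_inv r z c" and zero: "zero_inv i r" and unit: "unit_inv i z c" and w1: "w \<le> w1"
    and near: "near (Suc i) r (int i * drift + (20 * int m + 1)\<^sup>2 + 18 * (w1 - w))"
    and row: "\<And>j. j < m \<Longrightarrow> i < j \<Longrightarrow> 0 \<le> r i j \<and> r i j < w"
    and diag: "S - e0 - int i * drift - w1\<^sup>2 - 2 * (w1 - w) \<le> r i i"
    using inv by (auto simp: reduce_inv_def)
  have x1: "1 \<le> x" using x w by (cases "x = 0") auto
  have wx: "w \<le> x * (x + 2)" using x(3) by (simp add: power2_eq_square algebra_simps)
  have x2: "2 * x \<le> w"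
  proof (cases "x = 1")
    case False
    then have "2 * x \<le> x * x" using x1 by (intro mult_right_mono) auto
    then show ?thesis using x(2) by (simp add: power2_eq_square)
  qed (use w in auto)
  have u: "\<bar>z' c j\<bar> \<le> 3 * x" if "Suc i \<le> j" "j < m" for j
  proof -
    have "\<bar>r i j\<bar> \<le> (x + 2) * x" using row[of j] wx that by (auto simp: mult.commute)
    then have "\<bar>r i j div x\<bar> \<le> x + 2" using x1 by (intro abs_div_le_bound) auto
    then show ?thesis using e that x1 by (simp add: emits_def)
  qed
  have "near (Suc i) r' (int i * drift + (20 * int m + 1)\<^sup>2 + 18 * (w1 - w) + (3 * x)\<^sup>2)"
    by (rule emits_near[OF near e _ u]) auto
  then have "near (Suc i) r' (int i * drift + (20 * int m + 1)\<^sup>2 + 18 * (w1 - x))"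
    by (rule near_mono) (use x(2) x2 in \<open>auto simp: power_mult_distrib\<close>)
  moreover have "S - e0 - int i * drift - w1\<^sup>2 - 2 * (w1 - x) \<le> r' i i"
  proof -
    have "r' i i = r i i - x\<^sup>2" using e i by (simp add: emits_def power2_eq_square)
    \<comment> \<open>The squares are replaced by variables W and X, so that what remains is
      linear.\<close>
    moreover have "S - e0 - int i * drift - W - 2 * (w1 - x) \<le> r' i i"
      if "S - e0 - int i * drift - W - 2 * (w1 - w) \<le> r i i" "r' i i = r i i - X" "X \<le> w" for W X
      using that x2 by (simp add: algebra_simps)
    ultimately show ?thesis using diag x(2) by blast
  qed
  moreover have "x = 1 \<longrightarrow> unit_inv (Suc i) z' (Suc c)" using emits_unit_Suc[OF unit _ zero i] e by auto
  ultimately show ?thesis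
    using emits_gram[OF gram e] emits_zero(1)[OF zero e i] emits_unit[OF unit e] i x1 x2 w1
      emits_row[OF e i]
    by (auto simp: reduce_inv_def)
qed

lemma square_unique: 
  fixes x y :: int
  assumes "0 \<le> x" "x\<^sup>2 \<le> y\<^sup>2" "y\<^sup>2 < (x + 1)\<^sup>2" "0 \<le> y"
  shows "x = y"
  using power2_le_imp_le[of x y] power2_less_imp_less[of y "x + 1"] assms by auto

lemma phase_step:
  assumes inv: "phase_inv i w r z c" and i: "i < m" and e: "emits m i x r z c r' z'"
    and w: "1 < w" and x: "0 \<le> x" "x\<^sup>2 \<le> w" "w < (x + 1)\<^sup>2"
  shows "phase_inv i x r' z' (Suc c)"
proof (cases "w = w1\<^sup>2 \<and> row_inv i r z c")
  case True
  then have "x = w1" using square_unique[of x w1] x w1_ge by auto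
  then show ?thesis using phase_first[of i r z c r' z'] True e i by (auto simp: phase_inv_def)
next
  case False
  then show ?thesis using phase_reduce[OF _ i e w x] inv by (auto simp: phase_inv_def)
qed

text \<open>Row entries in the half-open interval from 0 to 1 are 0. The diagonal has lost at most
  \<open>e0 + i * drift\<close>, \<open>w1\<^sup>2\<close> and \<open>2 * w1\<close>, each of which
  is at most \<open>w1\<^sup>2\<close>; since S is at least \<open>4 * w1\<^sup>2\<close>, it is
  still nonnegative.\<close>

lemma phase_exit:
  assumes inv: "phase_inv i w r z c" and i: "i < m" and w: "w \<le> 1"
  shows "square_inv i r z c"
proof -
  have m: "0 < m" using i by simp
  have "1\<^sup>2 < w1\<^sup>2" using w1_ge(5)[OF m] by (intro power_strict_mono) auto
  then have "w \<noteq> w1\<^sup>2" using w by auto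
  then have inv: "reduce_inv i w r z c" using inv by (auto simp: phase_inv_def)
  then have w1: "w = 1" using w by (auto simp: reduce_inv_def)
  have "near (Suc i) r (int i * drift + (20 * int m + 1)\<^sup>2 + 18 * (w1 - w))"
    using inv by (auto simp: reduce_inv_def)
  then have "near (Suc i) r (int (Suc i) * drift)"
    by (rule near_mono) (auto simp: w1 drift_def algebra_simps)
  moreover have "S - e0 - int i * drift - w1\<^sup>2 - 2 * (w1 - w) \<le> r i i"
    using inv by (auto simp: reduce_inv_def)
  then have "0 \<le> r i i"
  proof -
    have "2 * w1 \<le> w1\<^sup>2" unfolding power2_eq_square using w1_ge(5)[OF m] by (intro mult_right_mono) auto
    then show ?thesis using \<open>_ \<le> r i i\<close> S_ge e0_drift_le[OF m less_imp_le[OF i]] w1 w1_ge(3) by (smt (verit))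
  qed
  moreover have "r i j = 0" if "i < j" "j < m" for j
    using inv that unfolding reduce_inv_def w1 by force
  ultimately show ?thesis using inv w1 by (auto simp: square_inv_def reduce_inv_def)
qed

text \<open>The row is 0 off the diagonal, so the new column is x times a unit vector and changes
  nothing but the diagonal entry.\<close>

lemma square_step:
  assumes inv: "square_inv i r z c" and i: "i < m" and e: "emits m i x r z c r' z'"
    and x: "0 \<le> x" "x\<^sup>2 \<le> r i i" "r i i < (x + 1)\<^sup>2"
  shows "square_inv i r' z' (Suc c)" "r' i i \<le> 2 * x" "r' i i = r i i - x\<^sup>2"
proof -
  have gram: "gram_inv r z c" and zero: "zero_inv i r" and unit: "unit_inv (Suc i) z c"
    and near: "near (Suc i) r (int (Suc i) * drift)"
    and row: "\<And>j. j < m \<Longrightarrow> i < j \<Longrightarrow> r i j = 0"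
    using inv by (auto simp: square_inv_def)
  have u: "z' c j = 0" if "Suc i \<le> j" "j < m" for j
    using row[of j] that e by (simp add: emits_def)
  have "near (Suc i) r' (int (Suc i) * drift + 0\<^sup>2)"
    by (rule emits_near[OF near e]) (use u in auto)
  moreover show d: "r' i i = r i i - x\<^sup>2" using e i by (simp add: emits_def power2_eq_square)
  moreover have "r' i j = 0" if "i < j" "j < m" for j
    using e i u that row by (simp add: emits_def)
  ultimately show "square_inv i r' z' (Suc c)"
    using emits_gram[OF gram e] emits_zero(1)[OF zero e i] emits_unit[OF unit e] i x
    by (auto simp: square_inv_def)
  show "r' i i \<le> 2 * x" using d x by (simp add: power2_eq_square algebra_simps)
qed

lemma square_exit:
  assumes inv: "square_inv i r z c" and i: "i < m" and "r i i \<le> 0"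
  shows "row_inv (Suc i) r z c"
proof -
  have gram: "gram_inv r z c" using inv by (auto simp: square_inv_def)
  have r: "r i j = 0" if "i \<le> j" "j < m" for j
    using inv assms(3) that by (cases "i = j") (auto simp: square_inv_def)
  have "zero_inv (Suc i) r"
    unfolding zero_inv_def
  proof (intro allI impI)
    fix j l assume jl: "j < m" "l < m" "j < Suc i \<or> l < Suc i"
    then consider "j < i \<or> l < i" | "j = i" "i \<le> l" | "l = i" "i \<le> j" by linarith
    then show "r j l = 0"
    proof cases
      case 1
      then show ?thesis using inv jl by (auto simp: square_inv_def zero_inv_def)
    next
      case 2
      then show ?thesis using r jl by auto
    next
      case 3
      then show ?thesis using r[of j] jl gram_sym[OF gram, of j l] by auto
    qed
  qed
  then show ?thesis using inv by (auto simp: square_inv_def row_inv_def)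
qed

section \<open>Bounds on the residual matrix, needed for the sizes of memory cells\<close>

lemma gram_diag_le:
  assumes "gram_inv r z c" "j < m"
  shows "r j j \<le> S"
proof -
  have "r j j + (\<Sum>p<c. z p j * z p j) = S" using assms unfolding gram_inv_def by force
  moreover have "0 \<le> (\<Sum>p<c. z p j * z p j)" by (intro sum_nonneg) auto
  ultimately show ?thesis by linarith
qed

text \<open>The entry differs from S or 0 by at most \<open>e0 + d\<close>, which is at most
  \<open>2 * w1\<^sup>2\<close> and so at most S.\<close>

lemma near_bound:
  assumes "near i r d" "d \<le> w1\<^sup>2" "i \<le> j" "i \<le> l" "j < m" "l < m"
  shows "\<bar>r j l\<bar> \<le> 2 * S"
proof -
  have "\<bar>r j l - ((if j = l then S else 0) - F j l)\<bar> \<le> d"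
    using assms unfolding near_def by blast
  moreover have "e0 \<le> w1\<^sup>2" using w1_ge mult_mono[of 1 w1 e0 w1] e0_nonneg
    by (auto simp: power2_eq_square)
  moreover have "0 \<le> w1\<^sup>2" by simp
  ultimately show ?thesis using F_le[of j l] assms(2,5,6) S_ge by (auto split: if_splits)
qed

lemma S_nonneg: "0 \<le> S"
  using S_ge zero_le_power2[of w1] by linarith

lemma row_bound:
  assumes "row_inv i r z c" "i \<le> m" "j < m" "l < m"
  shows "\<bar>r j l\<bar> \<le> 2 * S"
proof (cases "j < i \<or> l < i")
  case True
  then have "r j l = 0" using assms by (auto simp: row_inv_def zero_inv_def)
  then show ?thesis using S_nonneg by simp
next
  case False
  moreover have "int i * drift \<le> w1\<^sup>2" using e0_drift_le[of i] e0_nonneg assms by linarith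
  ultimately show ?thesis using assms near_bound[of i r] by (auto simp: row_inv_def)
qed

lemma Suc_drift: "int (Suc i) * drift = int i * drift + drift"
  by (simp add: algebra_simps)

lemma square_bound:
  assumes inv: "square_inv i r z c" and i: "i < m" and "j < m" "l < m"
  shows "\<bar>r j l\<bar> \<le> 2 * S"
proof -
  have gram: "gram_inv r z c" using inv by (simp add: square_inv_def)
  have *: "\<bar>r i l\<bar> \<le> 2 * S" if "l < m" for l
    using inv i that S_nonneg gram_diag_le[OF gram, of i]
    by (cases l i rule: linorder_cases) (auto simp: square_inv_def zero_inv_def)
  consider "j < i \<or> l < i" | "j = i" | "l = i" | "Suc i \<le> j" "Suc i \<le> l" by linarith
  then show ?thesis
  proof cases
    case 1
    then have "r j l = 0" using assms by (auto simp: square_inv_def zero_inv_def)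
    then show ?thesis using S_nonneg by simp
  next
    case 4
    have "int (Suc i) * drift \<le> w1\<^sup>2" using e0_drift_le[of "Suc i"] e0_nonneg i by linarith
    then show ?thesis using 4 inv assms(3,4) near_bound[of "Suc i" r] unfolding square_inv_def by blast
  next
    case 2
    then show ?thesis using * assms by blast
  next
    case 3
    then show ?thesis using *[of j] gram_sym[OF gram, of j i] assms by auto
  qed
qed

lemma reduce_bound:
  assumes inv: "reduce_inv i w r z c" and i: "i < m" and "j < m" "l < m"
  shows "\<bar>r j l\<bar> \<le> 2 * S"
proof -
  have gram: "gram_inv r z c" using inv by (simp add: reduce_inv_def)
  have m: "0 < m" using i by simp
  have w: "1 \<le> w" "w \<le> w1" using inv by (auto simp: reduce_inv_def)
  have w1S: "w1 \<le> w1\<^sup>2" using w1_ge by (simp add: power2_eq_square)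
  have *: "\<bar>r i l\<bar> \<le> 2 * S" if l: "l < m" for l
  proof (cases l i rule: linorder_cases)
    case less
    then show ?thesis using inv l i S_nonneg by (auto simp: reduce_inv_def zero_inv_def)
  next
    case equal
    have "S - e0 - int i * drift - w1\<^sup>2 - 2 * (w1 - w) \<le> r i i"
      using inv by (auto simp: reduce_inv_def)
    moreover have "- S \<le> r i i"
      if "S - e0 - int i * drift - W - 2 * (w1 - w) \<le> r i i" "e0 + int i * drift \<le> W" "w1 \<le> W" "4 * W \<le> S" for W
      using that w by presburger
    ultimately have "- S \<le> r i i"
      using e0_drift_le[OF m less_imp_le[OF i]] w1S S_ge by blast
    then show ?thesis using gram_diag_le[OF gram i] S_nonneg equal by auto
  next
    case greater
    then have "0 \<le> r i l \<and> r i l < w" using inv l by (auto simp: reduce_inv_def)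
    then show ?thesis using w w1S S_ge by auto
  qed
  consider "j < i \<or> l < i" | "j = i" | "l = i" | "Suc i \<le> j" "Suc i \<le> l" by linarith
  then show ?thesis
  proof cases
    case 1
    then have "r j l = 0" using assms by (auto simp: reduce_inv_def zero_inv_def)
    then show ?thesis using S_nonneg by simp
  next
    case 4
    have "int (Suc i) * drift \<le> w1\<^sup>2" using e0_drift_le[of "Suc i"] e0_nonneg i by linarith
    then have "int i * drift + (20 * int m + 1)\<^sup>2 + 18 * (w1 - w) \<le> w1\<^sup>2"
      using w unfolding Suc_drift by (simp add: drift_def)
    then show ?thesis using 4 inv assms(3,4) near_bound[of "Suc i" r] unfolding reduce_inv_def by blast
  next
    case 2
    then show ?thesis using * assms by blast
  next
    case 3
    then show ?thesis using *[of j] gram_sym[OF gram, of j i] assms by auto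
  qed
qed

lemma phase_bound:
  assumes "phase_inv i w r z c" "i < m" "j < m" "l < m"
  shows "\<bar>r j l\<bar> \<le> 2 * S"
  using assms row_bound reduce_bound unfolding phase_inv_def by (meson less_imp_le)

lemma phase_start: "row_inv i r z c \<Longrightarrow> phase_inv i (w1\<^sup>2) r z c"
  by (simp add: phase_inv_def)

lemma row_final:
  assumes "row_inv m r z c" "j < m" "l < m"
  shows "(\<Sum>p<c. z p j * z p l) = (if j = l then S else 0)"
  using assms by (auto simp: row_inv_def zero_inv_def gram_inv_def)

end

section \<open>The orthogonal basis and its projection\<close>


lemma orthonormal_basisI:
  fixes vs :: "real vec list"
  assumes len: "length vs = n" and dim: "\<And>v. v \<in> set vs \<Longrightarrow> v \<in> carrier_vec n"
    and orth: "\<And>i j. i < n \<Longrightarrow> j < n \<Longrightarrow> vs ! i \<bullet> vs ! j = (if i = j then 1 else 0)"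
  shows "orthonormal_basis n vs"
proof -
  interpret vec_space "TYPE(real)" n .
  define A where "A = mat_of_rows n vs"
  have A: "A \<in> carrier_mat n n" using len by (auto simp: A_def)
  have rows: "rows A = vs" using dim by (auto simp: A_def intro!: rows_mat_of_rows)
  have "distinct vs"
    unfolding distinct_conv_nth using orth len by (metis zero_neq_one)
  have "A * A\<^sup>T = 1\<^sub>m n"
  proof (rule eq_matI)
    fix i j assume "i < dim_row (1\<^sub>m n :: real mat)" "j < dim_col (1\<^sub>m n :: real mat)"
    then have ij: "i < n" "j < n" by auto
    then have "row A i = vs ! i" "row A j = vs ! j" using rows A len by (metis carrier_matD(1) nth_rows)+
    then show "(A * A\<^sup>T) $$ (i, j) = 1\<^sub>m n $$ (i, j)" using A ij orth by simp
  qed (use A in auto)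
  then have "det A * det A = 1" using A det_mult[of A n "A\<^sup>T"] det_transpose[OF A] by simp
  then have "det A \<noteq> 0" by auto
  from det_not_0_imp_lin_indpt_rows[OF A this] have "lin_indpt (set vs)" by (simp add: rows)
  moreover have "card (set vs) = n" using \<open>distinct vs\<close> len by (simp add: distinct_card)
  ultimately have "basis (set vs)"
    using dim by (intro dim_li_is_basis) (auto simp: dim_is_n)
  then show ?thesis
    using \<open>distinct vs\<close> orth len by (simp add: orthonormal_basis_def)
qed

text \<open>\<open>z p\<close> is the p-th column of Z. Hence \<open>z_G\<close> says that Z begins
  with \<open>G\<^sup>T\<close>, \<open>gram\<close> is \<open>Z Z\<^sup>T = 2 s I\<close>, and
  \<open>scaled\<close> says that s times every integer vector lies in the image of G.\<close>

locale projection_data =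
  fixes m n :: nat and s :: int and G :: "int mat" and z :: "nat \<Rightarrow> nat \<Rightarrow> int"
  assumes G: "G \<in> carrier_mat m m" and m_le_n: "m \<le> n" and s: "s > 0"
    and z_G: "\<And>p j. p < m \<Longrightarrow> j < m \<Longrightarrow> z p j = G $$ (p, j)"
    and gram: "\<And>j l. j < m \<Longrightarrow> l < m \<Longrightarrow> (\<Sum>p<n. z p j * z p l) = (if j = l then 2 * s else 0)"
    and units: "\<And>a. a < m \<Longrightarrow> \<exists>p<n. m \<le> p \<and> z p a = 1 \<and> (\<forall>b<a. z p b = 0)"
    and scaled: "\<exists>X. \<forall>i<m. \<forall>j<m. (\<Sum>l<m. G $$ (i, l) * X l j) = (if i = j then s else 0)"
begin

text \<open>This is the integer matrix \<open>s V\<close>: the inner product of the columns p and q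
  of Z is the entry of \<open>Z\<^sup>T Z\<close>.\<close>

definition num :: "nat \<Rightarrow> nat \<Rightarrow> int" where
  "num p q = (if p = q then s else 0) - (\<Sum>r<m. z p r * z q r)"

definition basis_vecs :: "rat vec list" where
  "basis_vecs = map (\<lambda>p. vec n (\<lambda>q. of_int (num p q) / of_int s)) [0..<n]"

text \<open>In matrix form, \<open>(Z\<^sup>T Z)\<^sup>2 = Z\<^sup>T (Z Z\<^sup>T) Z = 2 s Z\<^sup>T
  Z\<close>.\<close>

lemma gram_rows:
  assumes "p < n" "q < n"
  shows "(\<Sum>l<n. (\<Sum>r<m. z p r * z l r) * (\<Sum>r<m. z q r * z l r)) = 2 * s * (\<Sum>r<m. z p r * z q r)"
proof -
  have "(\<Sum>l<n. (\<Sum>r<m. z p r * z l r) * (\<Sum>r<m. z q r * z l r))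
    = (\<Sum>l<n. \<Sum>r<m. \<Sum>t<m. z p r * z q t * (z l r * z l t))"
    by (simp add: sum_product mult_ac)
  also have "\<dots> = (\<Sum>r<m. \<Sum>l<n. \<Sum>t<m. z p r * z q t * (z l r * z l t))"
    by (rule sum.swap)
  also have "\<dots> = (\<Sum>r<m. \<Sum>t<m. \<Sum>l<n. z p r * z q t * (z l r * z l t))"
    by (intro sum.cong refl sum.swap)
  also have "\<dots> = (\<Sum>r<m. \<Sum>t<m. z p r * z q t * (\<Sum>l<n. z l r * z l t))"
    by (simp add: sum_distrib_left)
  also have "\<dots> = (\<Sum>r<m. \<Sum>t<m. if r = t then z p r * z q t * (2 * s) else 0)"
    by (intro sum.cong refl) (auto simp: gram)
  also have "\<dots> = (\<Sum>r<m. z p r * z q r * (2 * s))"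
    by (intro sum.cong refl) simp
  finally show ?thesis by (simp add: sum_distrib_left mult_ac)
qed

text \<open>With \<open>K = Z\<^sup>T Z\<close>, the square of \<open>s I - K\<close> is
  \<open>s\<^sup>2 I - 2 s K + K\<^sup>2\<close>, and \<open>gram_rows\<close> cancels the last two
  terms.\<close>

lemma num_orth:
  assumes "p < n" "q < n"
  shows "(\<Sum>l<n. num p l * num q l) = (if p = q then s * s else 0)"
proof -
  let ?K = "\<lambda>p q. \<Sum>r<m. z p r * z q r"
  have sym: "?K p q = ?K q p" by (simp add: mult.commute)
  have "(\<Sum>l<n. num p l * num q l) = (\<Sum>l<n. (if l = p then if p = q then s * s else 0 else 0)
      - (if l = p then s * ?K q l else 0) - (if l = q then s * ?K p l else 0) + ?K p l * ?K q l)"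
    by (intro sum.cong refl) (auto simp: num_def algebra_simps)
  also have "\<dots> = (if p = q then s * s else 0) - s * ?K q p - s * ?K p q + 2 * s * ?K p q"
    using assms gram_rows[OF assms] by (simp add: sum.distrib sum_subtractf)
  finally show ?thesis using sym by simp
qed

lemma real_basis_vecs:
  "map (map_vec real_of_rat) basis_vecs = map (\<lambda>p. vec n (\<lambda>q. of_int (num p q) / of_int s)) [0..<n]"
  by (auto simp: basis_vecs_def of_rat_divide intro!: eq_vecI)

lemma orthonormal: "orthonormal_basis n (map (map_vec real_of_rat) basis_vecs)"
proof (rule orthonormal_basisI)
  fix i j assume ij: "i < n" "j < n"
  have "(\<Sum>l<n. real_of_int (num i l) / of_int s * (of_int (num j l) / of_int s))
    = real_of_int (\<Sum>l<n. num i l * num j l) / (of_int s * of_int s)"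
    by (simp add: sum_divide_distrib)
  then show "map (map_vec real_of_rat) basis_vecs ! i \<bullet> map (map_vec real_of_rat) basis_vecs ! j
      = (if i = j then 1 else 0)"
    using ij s by (simp add: real_basis_vecs num_orth scalar_prod_def atLeast0LessThan)
qed (auto simp: basis_vecs_def)

text \<open>Forward substitution with the unitriangular columns: the one for k clears coordinate k
  without disturbing the coordinates before it. The coefficients of the first m columns are kept at
  0 so that the block \<open>s I - G G\<^sup>T\<close> does not enter.\<close>

lemma columns_generate:
  fixes x :: "nat \<Rightarrow> int"
  shows "\<exists>a. (\<forall>p<m. a p = 0) \<and> (\<forall>j<m. (\<Sum>p<n. a p * z p j) = x j)"
proof -
  have "\<exists>a. (\<forall>p<m. a p = 0) \<and> (\<forall>j<m. (\<Sum>p<n. a p * z p j) = x j)"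
    if "k \<le> m" "\<forall>b<k. x b = 0" for k and x :: "nat \<Rightarrow> int"
    using that
  proof (induction k arbitrary: x rule: inc_induct)
    case base
    then show ?case by (intro exI[of _ "\<lambda>_. 0"]) auto
  next
    case (step k)
    from units[OF step.hyps(2)] obtain p where p: "p < n" "m \<le> p" "z p k = 1" "\<forall>b<k. z p b = 0"
      by blast
    have "\<forall>b<Suc k. x b - x k * z p b = 0" using p step.prems by (auto simp: less_Suc_eq)
    from step.IH[OF this] obtain a where a: "\<forall>p<m. a p = 0"
      "\<forall>j<m. (\<Sum>p<n. a p * z p j) = x j - x k * z p j" by blast
    have "(\<Sum>q<n. (a q + (if q = p then x k else 0)) * z q j) = x j" if "j < m" for j
    proof -
      have "(\<Sum>q<n. (a q + (if q = p then x k else 0)) * z q j)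
        = (\<Sum>q<n. a q * z q j + (if q = p then x k * z q j else 0))"
        by (intro sum.cong) (auto simp: algebra_simps)
      then show ?thesis using a(2) that p(1) by (simp add: sum.distrib)
    qed
    then show ?case using a(1) p(2) by (intro exI[of _ "\<lambda>q. a q + (if q = p then x k else 0)"]) auto
  qed
  from this[of 0] show ?thesis by simp
qed

text \<open>The first m rows of \<open>s V\<close> are \<open>[s I | 0] - G Z\<close>; this is their
  product with a.\<close>

definition image_vec :: "(nat \<Rightarrow> int) \<Rightarrow> nat \<Rightarrow> int" where
  "image_vec a i = s * a i - (\<Sum>l<m. G $$ (i, l) * (\<Sum>p<n. a p * z p l))"

lemma sum_num:
  assumes "i < m"
  shows "(\<Sum>p<n. a p * num p i) = image_vec a i"
proof -
  have "(\<Sum>p<n. a p * num p i) = (\<Sum>p<n. (if p = i then s * a p else 0) - (\<Sum>r<m. a p * z p r * z i r))"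
    by (intro sum.cong) (auto simp: num_def algebra_simps sum_distrib_left)
  also have "\<dots> = s * a i - (\<Sum>p<n. \<Sum>r<m. a p * z p r * z i r)"
    using assms m_le_n by (simp add: sum_subtractf)
  also have "(\<Sum>p<n. \<Sum>r<m. a p * z p r * z i r) = (\<Sum>r<m. \<Sum>p<n. a p * z p r * z i r)"
    by (rule sum.swap)
  also have "\<dots> = (\<Sum>r<m. G $$ (i, r) * (\<Sum>p<n. a p * z p r))"
    using assms by (intro sum.cong) (auto simp: z_G sum_distrib_left mult_ac)
  finally show ?thesis by (simp add: image_vec_def)
qed

lemma image_int_span:
  "(\<lambda>w. real_of_int s \<cdot>\<^sub>v vec_first w m) ` int_span n (map (map_vec real_of_rat) basis_vecs)
    = {vec m (\<lambda>i. real_of_int (image_vec a i)) | a. True}"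
proof -
  let ?vs = "map (map_vec real_of_rat) basis_vecs"
  have *: "real_of_int s \<cdot>\<^sub>v vec_first (finsum_vec TYPE(real) n (\<lambda>i. real_of_int (a i) \<cdot>\<^sub>v ?vs ! i) {..<length ?vs}) m
      = vec m (\<lambda>i. real_of_int (image_vec a i))" (is "?l = ?r") for a
  proof (rule eq_vecI)
    fix i assume "i < dim_vec ?r"
    then have i: "i < m" "i < n" using m_le_n by auto
    have len: "length ?vs = n" by (simp add: basis_vecs_def)
    have "finsum_vec TYPE(real) n (\<lambda>i. real_of_int (a i) \<cdot>\<^sub>v ?vs ! i) {..<n} $ i
      = (\<Sum>p<n. real_of_int (a p) * (of_int (num p i) / of_int s))"
      using i by (subst index_finsum_vec) (auto simp: real_basis_vecs)
    also have "real_of_int s * \<dots> = (\<Sum>p<n. real_of_int (a p * num p i))"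
      using s by (simp add: sum_distrib_left)
    finally show "?l $ i = ?r $ i"
      using i unfolding len by (simp add: vec_first_def sum_num[symmetric])
  qed auto
  show ?thesis
  proof (intro equalityI subsetI)
    fix v assume "v \<in> (\<lambda>w. real_of_int s \<cdot>\<^sub>v vec_first w m) ` int_span n ?vs"
    then obtain a where "v = real_of_int s \<cdot>\<^sub>v vec_first (finsum_vec TYPE(real) n (\<lambda>i. real_of_int (a i) \<cdot>\<^sub>v ?vs ! i) {..<length ?vs}) m"
      unfolding int_span_def by blast
    then show "v \<in> {vec m (\<lambda>i. real_of_int (image_vec a i)) | a. True}" unfolding * by blast
  next
    fix v assume "v \<in> {vec m (\<lambda>i. real_of_int (image_vec a i)) | a. True}"
    then show "v \<in> (\<lambda>w. real_of_int s \<cdot>\<^sub>v vec_first w m) ` int_span n ?vs"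
      unfolding int_span_def using *[symmetric] by blast
  qed
qed

lemma lattice_vec:
  "map_mat real_of_int G *\<^sub>v map_vec real_of_int x = vec m (\<lambda>i. real_of_int (\<Sum>l<m. G $$ (i, l) * x $ l))"
  if "x \<in> carrier_vec m"
  using that G by (intro eq_vecI) (auto simp: scalar_prod_def atLeast0LessThan)

text \<open>To reach \<open>G x\<close>, choose a supported on U with \<open>Z a = - x\<close>, so
  that the term \<open>s a\<close> vanishes in the first m coordinates. Conversely, with
  \<open>G X = s I\<close>, the vector \<open>s a - G Z a\<close> is G applied to
  \<open>X a - Z a\<close>, where X sees only the first m coefficients of a.\<close>

lemma lattice_eq:
  "int_lattice G = (\<lambda>w. real_of_int s \<cdot>\<^sub>v vec_first w m) ` int_span n (map (map_vec real_of_rat) basis_vecs)"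
  unfolding image_int_span
proof (intro equalityI subsetI)
  fix v assume "v \<in> int_lattice G"
  then obtain x where x: "x \<in> carrier_vec m" "v = map_mat real_of_int G *\<^sub>v map_vec real_of_int x"
    using G unfolding int_lattice_def by auto
  obtain a where a: "\<forall>p<m. a p = 0" "\<forall>j<m. (\<Sum>p<n. a p * z p j) = - x $ j"
    using columns_generate[of "\<lambda>j. - x $ j"] by blast
  have "v = vec m (\<lambda>i. real_of_int (image_vec a i))"
    unfolding x(2) lattice_vec[OF x(1)] using a
    by (intro eq_vecI) (auto simp: image_vec_def sum_negf)
  then show "v \<in> {vec m (\<lambda>i. real_of_int (image_vec a i)) | a. True}" by blast
next
  fix v assume "v \<in> {vec m (\<lambda>i. real_of_int (image_vec a i)) | a. True}"
  then obtain a where v: "v = vec m (\<lambda>i. real_of_int (image_vec a i))" by blast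
  obtain X where X: "\<And>i j. i < m \<Longrightarrow> j < m \<Longrightarrow> (\<Sum>l<m. G $$ (i, l) * X l j) = (if i = j then s else 0)"
    using scaled by blast
  define x where "x = vec m (\<lambda>l. (\<Sum>j<m. X l j * a j) - (\<Sum>p<n. a p * z p l))"
  have "(\<Sum>l<m. G $$ (i, l) * (\<Sum>j<m. X l j * a j)) = s * a i" if "i < m" for i
  proof -
    have "(\<Sum>l<m. G $$ (i, l) * (\<Sum>j<m. X l j * a j)) = (\<Sum>l<m. \<Sum>j<m. G $$ (i, l) * X l j * a j)"
      by (simp add: sum_distrib_left mult_ac)
    also have "\<dots> = (\<Sum>j<m. \<Sum>l<m. G $$ (i, l) * X l j * a j)" by (rule sum.swap)
    also have "\<dots> = (\<Sum>j<m. if i = j then s * a j else 0)"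
      using that by (intro sum.cong) (auto simp: sum_distrib_right[symmetric] X)
    finally show ?thesis using that by simp
  qed
  then have Gx: "image_vec a i = (\<Sum>l<m. G $$ (i, l) * x $ l)" if "i < m" for i
    using that by (simp add: x_def image_vec_def right_diff_distrib sum_subtractf)
  have "x \<in> carrier_vec m" by (simp add: x_def)
  then have "v = map_mat real_of_int G *\<^sub>v map_vec real_of_int x"
    unfolding v lattice_vec[OF \<open>x \<in> carrier_vec m\<close>] by (intro eq_vecI) (auto simp: Gx)
  then show "v \<in> int_lattice G" using G unfolding int_lattice_def x_def by auto
qed

end

section \<open>Weakest preconditions with time and memory bounds\<close>


text \<open>If all cells have size at most L, then the value of an expression has size at most
  \<open>width\<close> times L, and evaluating it costs at most \<open>cost_factor\<close> times L.
  Both numbers depend on the program text only. A loaded value is itself a cell, and a quotient is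
  no larger than its dividend.\<close>

fun width :: "aexp \<Rightarrow> nat" where
  "width (Const c) = nat \<bar>c\<bar> + 2"
| "width (Load e) = 1"
| "width (Add e1 e2) = width e1 + width e2"
| "width (Sub e1 e2) = width e1 + width e2"
| "width (Mul e1 e2) = width e1 + width e2"
| "width (Div e1 e2) = width e1"

fun cost_factor :: "aexp \<Rightarrow> nat" where
  "cost_factor (Const c) = nat \<bar>c\<bar> + 2"
| "cost_factor (Load e) = cost_factor e + width e + 1"
| "cost_factor (Add e1 e2) = cost_factor e1 + cost_factor e2 + width e1 + width e2"
| "cost_factor (Sub e1 e2) = cost_factor e1 + cost_factor e2 + width e1 + width e2"
| "cost_factor (Mul e1 e2) = cost_factor e1 + cost_factor e2 + width e1 + width e2"
| "cost_factor (Div e1 e2) = cost_factor e1 + cost_factor e2 + width e1 + width e2"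

lemma int_size_le_iff: "int_size a \<le> Suc b \<longleftrightarrow> \<bar>a\<bar> < 2 ^ b"
proof -
  have "int_size a \<le> Suc b \<longleftrightarrow> nat \<bar>a\<bar> < 2 ^ b"
    by (simp add: int_size_def floorlog_le_iff)
  also have "\<dots> \<longleftrightarrow> \<bar>a\<bar> < 2 ^ b"
    by (metis abs_ge_zero nat_less_numeral_power_cancel_iff nat_less_iff of_nat_power of_nat_numeral)
  finally show ?thesis .
qed

lemma int_size_pos: "int_size a = Suc (int_size a - 1)"
  by (simp add: int_size_def)

lemma abs_less_int_size: "\<bar>a\<bar> < 2 ^ (int_size a - 1)"
  using int_size_le_iff[of a "int_size a - 1"] int_size_pos[of a] by simp

lemma int_size_const: "int_size c \<le> nat \<bar>c\<bar> + 2"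
proof -
  have "int (nat \<bar>c\<bar>) < 2 ^ (nat \<bar>c\<bar>)" using less_exp[of "nat \<bar>c\<bar>"]
    by (metis of_nat_less_iff of_nat_numeral of_nat_power)
  then have "int_size c \<le> Suc (nat \<bar>c\<bar>)" unfolding int_size_le_iff by simp
  then show ?thesis by simp
qed

lemma int_size_add: 
  assumes "0 < x" "0 < y" "int_size a \<le> x" "int_size b \<le> y"
  shows "int_size (a + b) \<le> x + y" "int_size (a - b) \<le> x + y" "int_size (a * b) \<le> x + y"
proof -
  obtain u v where uv: "x = Suc u" "y = Suc v" using assms by (metis gr0_implies_Suc)
  have ab: "\<bar>a\<bar> < 2 ^ u" "\<bar>b\<bar> < 2 ^ v" using assms by (simp_all add: uv int_size_le_iff)
  have "(2::int) ^ u \<le> 2 ^ (u + v)" "(2::int) ^ v \<le> 2 ^ (u + v)" by simp_all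
  then have "\<bar>a\<bar> < 2 ^ (u + v)" "\<bar>b\<bar> < 2 ^ (u + v)" using ab by linarith+
  then have "\<bar>a + b\<bar> < 2 ^ Suc (u + v)" "\<bar>a - b\<bar> < 2 ^ Suc (u + v)" using ab by auto
  moreover have "\<bar>a * b\<bar> < 2 ^ Suc (u + v)"
  proof -
    have "\<bar>a * b\<bar> \<le> 2 ^ u * 2 ^ v"
      unfolding abs_mult using ab by (intro mult_mono) auto
    also have "\<dots> < 2 ^ Suc (u + v)" by (simp add: power_add)
    finally show ?thesis .
  qed
  ultimately show "int_size (a + b) \<le> x + y" "int_size (a - b) \<le> x + y" "int_size (a * b) \<le> x + y"
    using int_size_le_iff[of _ "Suc (u + v)"] by (simp_all add: uv)
qed

lemma abs_div_le: "\<bar>a div b\<bar> \<le> \<bar>a\<bar>" for a b :: int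
proof (cases "b = 0")
  case False
  have *: "\<bar>a div c\<bar> \<le> \<bar>a\<bar>" if "c > 0" for a c :: int
  proof (cases "a \<ge> 0")
    case True
    then show ?thesis using that zdiv_mono2[of a 1 c] by (simp add: pos_imp_zdiv_nonneg_iff)
  next
    case False
    then have "a * c \<le> a * 1" using that by (intro mult_left_mono_neg) auto
    then have "a * c div c \<le> a div c" using that by (intro zdiv_mono1) auto
    then have "a \<le> a div c" using that by simp
    moreover have "a div c < 0" using that False by (intro div_neg_pos_less0) auto
    ultimately show ?thesis by linarith
  qed
  show ?thesis
  proof (cases "b > 0")
    case False
    then show ?thesis using *[of "-b" "-a"] \<open>b \<noteq> 0\<close> by simp
  qed (rule *)
qed simp

lemma int_size_mono: "\<bar>a\<bar> \<le> \<bar>b\<bar> \<Longrightarrow> int_size a \<le> int_size b"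
  by (simp add: int_size_def floorlog_mono nat_mono)

lemma width_pos: "width e > 0"
  by (induction e) auto

lemma cost_le:
  assumes "\<And>a. int_size (M a) \<le> L"
  shows "int_size (val M e) \<le> width e * L \<and> cost M e \<le> cost_factor e * L"
proof -
  have L: "L > 0" using assms[of 0] by (simp add: int_size_def)
  show ?thesis
  proof (induction e)
    case (Const c)
    have "int_size c \<le> (nat \<bar>c\<bar> + 2) * 1" using int_size_const by simp
    also have "\<dots> \<le> (nat \<bar>c\<bar> + 2) * L" using L by (intro mult_le_mono) auto
    finally show ?case by simp
  next
    case (Load e)
    then show ?case using assms[of "val M e"] by (simp add: algebra_simps)
  next
    case (Add e1 e2)
    then show ?case using int_size_add(1)[of "width e1 * L" "width e2 * L"] width_pos L
      by (simp add: algebra_simps)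
  next
    case (Sub e1 e2)
    then show ?case using int_size_add(2)[of "width e1 * L" "width e2 * L"] width_pos L
      by (simp add: algebra_simps)
  next
    case (Mul e1 e2)
    then show ?case using int_size_add(3)[of "width e1 * L" "width e2 * L"] width_pos L
      by (simp add: algebra_simps)
  next
    case (Div e1 e2)
    have "int_size (val M e1 div val M e2) \<le> int_size (val M e1)"
      by (intro int_size_mono abs_div_le)
    then show ?case using Div L by (simp add: algebra_simps)
  qed
qed

text \<open>Four arrays interleaved by the residue of the address modulo 4; the first one holds the scalars.\<close>

definition mem :: "(int \<Rightarrow> int) \<Rightarrow> (int \<Rightarrow> int) \<Rightarrow> (int \<Rightarrow> int) \<Rightarrow> (int \<Rightarrow> int) \<Rightarrow> memory" where
  "mem V Z R P a = (let q = a div 4; r = a mod 4 in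
     if r = 0 then V q else if r = 1 then Z q else if r = 2 then R q else P q)"

lemma mem_nth [simp]:
  "mem V Z R P (4 * a) = V a" "mem V Z R P (4 * a + 1) = Z a"
  "mem V Z R P (4 * a + 2) = R a" "mem V Z R P (4 * a + 3) = P a"
  by (simp_all add: mem_def Let_def)

lemma mem_upd:
  "(mem V Z R P)(4 * a := x) = mem (V(a := x)) Z R P"
  "(mem V Z R P)(4 * a + 1 := x) = mem V (Z(a := x)) R P"
  "(mem V Z R P)(4 * a + 2 := x) = mem V Z (R(a := x)) P"
  "(mem V Z R P)(4 * a + 3 := x) = mem V Z R (P(a := x))"
proof -
  have *: "b = 4 * (b div 4) + b mod 4" "b mod 4 = 0 \<or> b mod 4 = 1 \<or> b mod 4 = 2 \<or> b mod 4 = 3"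
    for b :: int by presburger+
  show "(mem V Z R P)(4 * a := x) = mem (V(a := x)) Z R P"
    "(mem V Z R P)(4 * a + 1 := x) = mem V (Z(a := x)) R P"
    "(mem V Z R P)(4 * a + 2 := x) = mem V Z (R(a := x)) P"
    "(mem V Z R P)(4 * a + 3 := x) = mem V Z R (P(a := x))"
    unfolding mem_def Let_def fun_eq_iff fun_upd_apply using * by (smt (verit))+
qed

definition bounded_by :: "int \<Rightarrow> (int \<Rightarrow> int) \<Rightarrow> bool" where
  "bounded_by B f \<longleftrightarrow> (\<forall>a. \<bar>f a\<bar> \<le> B)"

abbreviation "all_bounded B V Z R P \<equiv>
  bounded_by B V \<and> bounded_by B Z \<and> bounded_by B R \<and> bounded_by B P"

lemma bounded_mem: "all_bounded B V Z R P \<Longrightarrow> \<bar>mem V Z R P a\<bar> \<le> B"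
  by (auto simp: bounded_by_def mem_def Let_def)

lemma bounded_upd: "bounded_by B f \<Longrightarrow> \<bar>x\<bar> \<le> B \<Longrightarrow> bounded_by B (f(a := x))"
  by (auto simp: bounded_by_def)

definition scalar :: "int \<Rightarrow> aexp" where "scalar x = Load (Const (4 * x))"
definition arr_z :: "aexp \<Rightarrow> aexp" where "arr_z e = Load (Add (Mul (Const 4) e) (Const 1))"
definition arr_r :: "aexp \<Rightarrow> aexp" where "arr_r e = Load (Add (Mul (Const 4) e) (Const 2))"
definition arr_p :: "aexp \<Rightarrow> aexp" where "arr_p e = Load (Add (Mul (Const 4) e) (Const 3))"

lemma val_arrays [simp]:
  "val (mem V Z R P) (scalar x) = V x"
  "val (mem V Z R P) (arr_z e) = Z (val (mem V Z R P) e)"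
  "val (mem V Z R P) (arr_r e) = R (val (mem V Z R P) e)"
  "val (mem V Z R P) (arr_p e) = P (val (mem V Z R P) e)"
  unfolding scalar_def arr_z_def arr_r_def arr_p_def val.simps by (rule mem_nth)+

lemma width_arrays [simp]: "width (scalar x) = 1" "width (arr_z e) = 1" "width (arr_r e) = 1" "width (arr_p e) = 1"
  by (simp_all add: scalar_def arr_z_def arr_r_def arr_p_def)

lemma cost_factor_arrays [simp]:
  "cost_factor (scalar x) = 2 * nat \<bar>4 * x\<bar> + 5"
  "cost_factor (arr_z e) = cost_factor e + 3 * width e + 34"
  "cost_factor (arr_r e) = cost_factor e + 3 * width e + 37"
  "cost_factor (arr_p e) = cost_factor e + 3 * width e + 40"
  by (simp_all add: scalar_def arr_z_def arr_r_def arr_p_def)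

definition set_scalar :: "int \<Rightarrow> aexp \<Rightarrow> com" where "set_scalar x = Store (Const (4 * x))"
definition set_z :: "aexp \<Rightarrow> aexp \<Rightarrow> com" where "set_z e = Store (Add (Mul (Const 4) e) (Const 1))"
definition set_r :: "aexp \<Rightarrow> aexp \<Rightarrow> com" where "set_r e = Store (Add (Mul (Const 4) e) (Const 2))"
definition set_p :: "aexp \<Rightarrow> aexp \<Rightarrow> com" where "set_p e = Store (Add (Mul (Const 4) e) (Const 3))"

type_synonym assn = "(int \<Rightarrow> int) \<Rightarrow> (int \<Rightarrow> int) \<Rightarrow> (int \<Rightarrow> int) \<Rightarrow> (int \<Rightarrow> int) \<Rightarrow> int list \<Rightarrow> int list \<Rightarrow> bool"

text \<open>
  Every memory cell stays bounded by \<open>B\<close>, so each elementary command costs at most a constant times the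
  size of \<open>B\<close>; that constant is 10000, and \<open>k\<close> counts the elementary commands.
\<close>

definition wp :: "int \<Rightarrow> com \<Rightarrow> nat \<Rightarrow> assn \<Rightarrow> assn" where
  "wp B c k Q V Z R P xs ys \<longleftrightarrow> (all_bounded B V Z R P \<longrightarrow>
     (\<exists>t V' Z' R' P' xs' ys'. exec c (mem V Z R P, xs, ys) t (mem V' Z' R' P', xs', ys') \<and>
        t \<le> k * (10000 * int_size B) \<and> all_bounded B V' Z' R' P' \<and> Q V' Z' R' P' xs' ys'))"

section \<open>Proof rules for the commands\<close>

lemma wp_weaken:
  assumes "wp B c k Q V Z R P xs ys"
    and "\<And>V Z R P xs ys. all_bounded B V Z R P \<Longrightarrow> Q V Z R P xs ys \<Longrightarrow> Q' V Z R P xs ys" "k \<le> k'"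
  shows "wp B c k' Q' V Z R P xs ys"
proof -
  have "t \<le> k * (10000 * int_size B) \<Longrightarrow> t \<le> k' * (10000 * int_size B)" for t
    using mult_le_mono1[OF assms(3), of "10000 * int_size B"] by linarith
  then show ?thesis using assms(1,2) unfolding wp_def by blast
qed

lemma mem_cost:
  assumes "all_bounded B V Z R P"
  shows "int_size (val (mem V Z R P) e) \<le> width e * int_size B"
    "cost (mem V Z R P) e \<le> cost_factor e * int_size B"
proof -
  have "int_size (mem V Z R P a) \<le> int_size B" for a
    using bounded_mem[OF assms] by (intro int_size_mono) (metis abs_ge_self order_trans)
  from cost_le[where M = "mem V Z R P", OF this] show "int_size (val (mem V Z R P) e) \<le> width e * int_size B"
    "cost (mem V Z R P) e \<le> cost_factor e * int_size B" by blast+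
qed

lemma wp_store:
  assumes "cost_factor e1 + width e1 + cost_factor e2 + width e2 \<le> 10000"
    and eq: "(mem V Z R P)(val (mem V Z R P) e1 := val (mem V Z R P) e2) = mem V' Z' R' P'"
    and bd: "all_bounded B V Z R P \<Longrightarrow> all_bounded B V' Z' R' P'"
    and Q: "Q V' Z' R' P' xs ys"
  shows "wp B (Store e1 e2) 1 Q V Z R P xs ys"
  unfolding wp_def
proof
  assume b: "all_bounded B V Z R P"
  let ?M = "mem V Z R P"
  let ?t = "cost ?M e1 + cost ?M e2 + int_size (val ?M e1) + int_size (val ?M e2)"
  have "exec (Store e1 e2) (?M, xs, ys) ?t (mem V' Z' R' P', xs, ys)"
    using exec.Store[of e1 e2 ?M xs ys] by (simp only: eq)
  moreover have "?t \<le> (cost_factor e1 + width e1 + cost_factor e2 + width e2) * int_size B"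
    using mem_cost[OF b, of e1] mem_cost[OF b, of e2] by (simp add: algebra_simps)
  then have "?t \<le> 1 * (10000 * int_size B)"
    using mult_le_mono1[OF assms(1), of "int_size B"] by linarith
  ultimately show "\<exists>t V' Z' R' P' xs' ys'. exec (Store e1 e2) (?M, xs, ys) t (mem V' Z' R' P', xs', ys') \<and>
        t \<le> 1 * (10000 * int_size B) \<and> all_bounded B V' Z' R' P' \<and> Q V' Z' R' P' xs' ys'"
    using bd[OF b] Q by blast
qed

lemma wp_set_scalar:
  assumes "8 * nat \<bar>x\<bar> + 4 + cost_factor e + width e \<le> 10000" "\<bar>val (mem V Z R P) e\<bar> \<le> B"
    "Q (V(x := val (mem V Z R P) e)) Z R P xs ys"
  shows "wp B (set_scalar x e) 1 Q V Z R P xs ys"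
  unfolding set_scalar_def
  by (rule wp_store) (use assms in \<open>auto simp: mem_upd bounded_upd nat_mult_distrib abs_mult\<close>)

lemma wp_set_z:
  assumes "cost_factor i + 3 * width i + 40 + cost_factor e + width e \<le> 10000" "\<bar>val (mem V Z R P) e\<bar> \<le> B"
    "Q V (Z(val (mem V Z R P) i := val (mem V Z R P) e)) R P xs ys"
  shows "wp B (set_z i e) 1 Q V Z R P xs ys"
  unfolding set_z_def
  by (rule wp_store) (use assms in \<open>auto simp: mem_upd bounded_upd\<close>)

lemma wp_set_r:
  assumes "cost_factor i + 3 * width i + 40 + cost_factor e + width e \<le> 10000" "\<bar>val (mem V Z R P) e\<bar> \<le> B"
    "Q V Z (R(val (mem V Z R P) i := val (mem V Z R P) e)) P xs ys"
  shows "wp B (set_r i e) 1 Q V Z R P xs ys"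
  unfolding set_r_def
  by (rule wp_store) (use assms in \<open>auto simp: mem_upd bounded_upd\<close>)

lemma wp_set_p:
  assumes "cost_factor i + 3 * width i + 40 + cost_factor e + width e \<le> 10000" "\<bar>val (mem V Z R P) e\<bar> \<le> B"
    "Q V Z R (P(val (mem V Z R P) i := val (mem V Z R P) e)) xs ys"
  shows "wp B (set_p i e) 1 Q V Z R P xs ys"
  unfolding set_p_def
  by (rule wp_store) (use assms in \<open>auto simp: mem_upd bounded_upd\<close>)

lemma wp_read:
  assumes "cost_factor e1 + width e1 + 1 \<le> 10000" "\<bar>x\<bar> \<le> B"
    and eq: "(mem V Z R P)(val (mem V Z R P) e1 := x) = mem V' Z' R' P'"
    and bd: "all_bounded B V Z R P \<Longrightarrow> all_bounded B V' Z' R' P'"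
    and Q: "Q V' Z' R' P' xs ys"
  shows "wp B (Read e1) 1 Q V Z R P (x # xs) ys"
  unfolding wp_def
proof
  assume b: "all_bounded B V Z R P"
  let ?M = "mem V Z R P"
  let ?t = "cost ?M e1 + int_size (val ?M e1) + int_size x"
  have "exec (Read e1) (?M, x # xs, ys) ?t (mem V' Z' R' P', xs, ys)"
    using exec.Read[of e1 ?M x xs ys] by (simp only: eq)
  moreover have "int_size x \<le> int_size B" using assms(2) by (intro int_size_mono) linarith
  then have "?t \<le> (cost_factor e1 + width e1 + 1) * int_size B"
    using mem_cost[OF b, of e1] by (simp add: algebra_simps)
  then have "?t \<le> 1 * (10000 * int_size B)"
    using mult_le_mono1[OF assms(1), of "int_size B"] by linarith
  ultimately show "\<exists>t V' Z' R' P' xs' ys'. exec (Read e1) (?M, x # xs, ys) t (mem V' Z' R' P', xs', ys') \<and>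
        t \<le> 1 * (10000 * int_size B) \<and> all_bounded B V' Z' R' P' \<and> Q V' Z' R' P' xs' ys'"
    using bd[OF b] Q by blast
qed

lemma wp_read_scalar:
  assumes "8 * nat \<bar>x\<bar> + 5 \<le> 10000" "\<bar>a\<bar> \<le> B" "Q (V(x := a)) Z R P xs ys"
  shows "wp B (Read (Const (4 * x))) 1 Q V Z R P (a # xs) ys"
  by (rule wp_read) (use assms in \<open>auto simp: mem_upd bounded_upd nat_mult_distrib abs_mult\<close>)

lemma wp_read_z:
  assumes "cost_factor i + 3 * width i + 40 \<le> 10000" "\<bar>a\<bar> \<le> B"
    "Q V (Z(val (mem V Z R P) i := a)) R P xs ys"
  shows "wp B (Read (Add (Mul (Const 4) i) (Const 1))) 1 Q V Z R P (a # xs) ys"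
  by (rule wp_read) (use assms in \<open>auto simp: mem_upd bounded_upd\<close>)

lemma wp_write:
  assumes "cost_factor e + width e \<le> 10000" "Q V Z R P xs (ys @ [val (mem V Z R P) e])"
  shows "wp B (Write e) 1 Q V Z R P xs ys"
  unfolding wp_def
proof
  assume b: "all_bounded B V Z R P"
  let ?M = "mem V Z R P"
  let ?t = "cost ?M e + int_size (val ?M e)"
  have "?t \<le> (cost_factor e + width e) * int_size B"
    using mem_cost[OF b, of e] by (simp add: algebra_simps)
  then have "?t \<le> 1 * (10000 * int_size B)"
    using mult_le_mono1[OF assms(1), of "int_size B"] by linarith
  then show "\<exists>t V' Z' R' P' xs' ys'. exec (Write e) (?M, xs, ys) t (mem V' Z' R' P', xs', ys') \<and>
        t \<le> 1 * (10000 * int_size B) \<and> all_bounded B V' Z' R' P' \<and> Q V' Z' R' P' xs' ys'"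
    using b assms(2) exec.Write[of e ?M xs ys] by blast
qed

lemma wp_seq:
  assumes "wp B c1 k1 (wp B c2 k2 Q) V Z R P xs ys"
  shows "wp B (Seq c1 c2) (k1 + k2) Q V Z R P xs ys"
  unfolding wp_def
proof
  assume b: "all_bounded B V Z R P"
  let ?L = "10000 * int_size B"
  obtain t1 V1 Z1 R1 P1 xs1 ys1 where 1: "exec c1 (mem V Z R P, xs, ys) t1 (mem V1 Z1 R1 P1, xs1, ys1)"
    "t1 \<le> k1 * ?L" "all_bounded B V1 Z1 R1 P1" "wp B c2 k2 Q V1 Z1 R1 P1 xs1 ys1"
    using assms b unfolding wp_def[of B c1] by blast
  obtain t2 V2 Z2 R2 P2 xs2 ys2 where 2: "exec c2 (mem V1 Z1 R1 P1, xs1, ys1) t2 (mem V2 Z2 R2 P2, xs2, ys2)"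
    "t2 \<le> k2 * ?L" "all_bounded B V2 Z2 R2 P2" "Q V2 Z2 R2 P2 xs2 ys2"
    using 1(3,4) unfolding wp_def[of B c2] by blast
  have "t1 + t2 \<le> (k1 + k2) * ?L" using 1(2) 2(2) by (simp add: add_mult_distrib)
  then show "\<exists>t V' Z' R' P' xs' ys'. exec (Seq c1 c2) (mem V Z R P, xs, ys) t (mem V' Z' R' P', xs', ys') \<and>
        t \<le> (k1 + k2) * ?L \<and> all_bounded B V' Z' R' P' \<and> Q V' Z' R' P' xs' ys'"
    using exec.Seq[OF 1(1) 2(1)] 2 by blast
qed

lemma wp_cond:
  assumes "cost_factor b + width b \<le> 10000"
    "0 < val (mem V Z R P) b \<Longrightarrow> wp B c1 k Q V Z R P xs ys"
    "\<not> 0 < val (mem V Z R P) b \<Longrightarrow> wp B c2 k Q V Z R P xs ys"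
  shows "wp B (Cond b c1 c2) (k + 1) Q V Z R P xs ys"
  unfolding wp_def
proof
  assume bd: "all_bounded B V Z R P"
  let ?L = "10000 * int_size B"
  let ?M = "mem V Z R P"
  let ?t = "cost ?M b + int_size (val ?M b)"
  have "?t \<le> (cost_factor b + width b) * int_size B"
    using mem_cost[OF bd, of b] by (simp add: algebra_simps)
  then have t: "?t + t \<le> (k + 1) * ?L" if "t \<le> k * ?L" for t
    using that mult_le_mono1[OF assms(1), of "int_size B"] by (simp add: add_mult_distrib)
  show "\<exists>t V' Z' R' P' xs' ys'. exec (Cond b c1 c2) (mem V Z R P, xs, ys) t (mem V' Z' R' P', xs', ys') \<and>
        t \<le> (k + 1) * ?L \<and> all_bounded B V' Z' R' P' \<and> Q V' Z' R' P' xs' ys'"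
  proof (cases "0 < val ?M b")
    case True
    then show ?thesis using assms(2) bd t exec.CondTrue[OF True] unfolding wp_def by meson
  next
    case False
    then show ?thesis using assms(3) bd t exec.CondFalse[OF False] unfolding wp_def by meson
  qed
qed

text \<open>The index of the invariant is a budget of rounds that need not be used up. The step must
  show that the budget is positive whenever the guard holds, which gives termination and the time
  bound at once.\<close>

lemma wp_while:
  assumes b: "cost_factor b + width b \<le> 10000"
    and step: "\<And>n V Z R P xs ys. I n V Z R P xs ys \<Longrightarrow> 0 < val (mem V Z R P) b \<Longrightarrow>
      n > 0 \<and> wp B c k (I (n - 1)) V Z R P xs ys"
    and exit: "\<And>n V Z R P xs ys. I n V Z R P xs ys \<Longrightarrow> \<not> 0 < val (mem V Z R P) b \<Longrightarrow> Q V Z R P xs ys"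
    and init: "I n V Z R P xs ys"
  shows "wp B (While b c) (n * (k + 1) + 1) Q V Z R P xs ys"
  using init
proof (induction n arbitrary: V Z R P xs ys rule: less_induct)
  case (less n)
  show ?case unfolding wp_def
  proof
    assume bd: "all_bounded B V Z R P"
    let ?L = "10000 * int_size B"
    let ?M = "mem V Z R P"
    let ?t = "cost ?M b + int_size (val ?M b)"
    have "?t \<le> (cost_factor b + width b) * int_size B"
      using mem_cost[OF bd, of b] by (simp add: algebra_simps)
    then have t: "?t \<le> ?L"
      using mult_le_mono1[OF assms(1), of "int_size B"] by linarith
    show "\<exists>t V' Z' R' P' xs' ys'. exec (While b c) (mem V Z R P, xs, ys) t (mem V' Z' R' P', xs', ys') \<and>
        t \<le> (n * (k + 1) + 1) * ?L \<and> all_bounded B V' Z' R' P' \<and> Q V' Z' R' P' xs' ys'"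
    proof (cases "0 < val ?M b")
      case True
      note s = step[OF less.prems True]
      obtain t1 V1 Z1 R1 P1 xs1 ys1 where 1: "exec c (?M, xs, ys) t1 (mem V1 Z1 R1 P1, xs1, ys1)"
        "t1 \<le> k * ?L" "all_bounded B V1 Z1 R1 P1" "I (n - 1) V1 Z1 R1 P1 xs1 ys1"
        using s bd unfolding wp_def by blast
      from s have n: "n - 1 < n" by simp
      obtain t2 V2 Z2 R2 P2 xs2 ys2 where 2:
        "exec (While b c) (mem V1 Z1 R1 P1, xs1, ys1) t2 (mem V2 Z2 R2 P2, xs2, ys2)"
        "t2 \<le> ((n - 1) * (k + 1) + 1) * ?L" "all_bounded B V2 Z2 R2 P2" "Q V2 Z2 R2 P2 xs2 ys2"
        using less.IH[OF n 1(4)] 1(3) unfolding wp_def by blast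
      have n': "n = Suc (n - 1)" using s by simp
      have "?t + t1 + t2 \<le> (n * (k + 1) + 1) * ?L"
        using t 1(2) 2(2) by (subst n') (simp add: algebra_simps)
      then show ?thesis using exec.WhileTrue[OF True 1(1) 2(1)] 2 by blast
    next
      case False
      have "?t \<le> (n * (k + 1) + 1) * ?L" using t by (simp add: algebra_simps)
      then show ?thesis using exec.WhileFalse[OF False, of c xs ys] exit[OF less.prems False] bd by blast
    qed
  qed
qed

definition for_loop :: "int \<Rightarrow> aexp \<Rightarrow> com \<Rightarrow> com" where
  "for_loop x e c = Seq (set_scalar x (Const 0))
     (While (Sub e (scalar x)) (Seq c (set_scalar x (Add (scalar x) (Const 1)))))"

text \<open>The bound \<open>e\<close> is evaluated anew in every round, hence the assumption
  \<open>bound\<close>. The body ends before the increment, so its postcondition states the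
  invariant for the updated counter. The limit 9000 leaves room below 10000 for the commands of the
  loop itself.\<close>

lemma wp_for:
  assumes c: "16 * nat \<bar>x\<bar> + cost_factor e + 2 * width e \<le> 9000"
    and n: "int n \<le> B"
    and step: "\<And>j V Z R P xs ys. j < n \<Longrightarrow> V x = int j \<Longrightarrow> I j V Z R P xs ys \<Longrightarrow>
      wp B c k (\<lambda>V Z R P xs ys. V x = int j \<and> I (Suc j) (V(x := int (Suc j))) Z R P xs ys) V Z R P xs ys"
    and bound: "\<And>j V Z R P xs ys. j \<le> n \<Longrightarrow> V x = int j \<Longrightarrow> I j V Z R P xs ys \<Longrightarrow>
      val (mem V Z R P) e = int n"
    and exit: "\<And>V Z R P xs ys. V x = int n \<Longrightarrow> I n V Z R P xs ys \<Longrightarrow> Q V Z R P xs ys"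
    and init: "I 0 (V(x := 0)) Z R P xs ys"
    and k': "n * (k + 2) + 2 \<le> k'"
  shows "wp B (for_loop x e c) k' Q V Z R P xs ys"
proof -
  \<comment> \<open>The budget of \<open>wp_while\<close> counts the remaining rounds downwards,
    while the counter x goes up.\<close>
  define J where "J i V Z R P xs ys \<longleftrightarrow> i \<le> n \<and> V x = int (n - i) \<and> I (n - i) V Z R P xs ys" for i V Z R P xs ys
  have "wp B (for_loop x e c) (1 + (n * ((k + 1) + 1) + 1)) Q V Z R P xs ys"
    unfolding for_loop_def
  proof (rule wp_seq, rule wp_set_scalar)
    show "wp B (While (Sub e (scalar x)) (Seq c (set_scalar x (Add (scalar x) (Const 1))))) (n * ((k + 1) + 1) + 1) Q
      (V(x := val (mem V Z R P) (Const 0))) Z R P xs ys"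
    proof (rule wp_while[where I = J])
      fix i V Z R P xs ys
      assume J: "J i V Z R P xs ys" and pos: "0 < val (mem V Z R P) (Sub e (scalar x))"
      let ?j = "n - i"
      have i: "i > 0" using pos J bound[of ?j V Z R P xs ys] by (auto simp: J_def)
      have e: "n - (i - 1) = Suc ?j" using i J by (auto simp: J_def)
      have "wp B c k (\<lambda>V Z R P xs ys. V x = int ?j \<and> I (Suc ?j) (V(x := int (Suc ?j))) Z R P xs ys) V Z R P xs ys"
        using J i by (intro step) (auto simp: J_def)
      then have "wp B (Seq c (set_scalar x (Add (scalar x) (Const 1)))) (k + 1) (J (i - 1)) V Z R P xs ys"
      proof (intro wp_seq, elim wp_weaken)
        fix V Z R P xs ys
        assume "V x = int ?j \<and> I (Suc ?j) (V(x := int (Suc ?j))) Z R P xs ys"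
        moreover have "int (Suc ?j) = V x + 1" using calculation by simp
        ultimately show "wp B (set_scalar x (Add (scalar x) (Const 1))) 1 (J (i - 1)) V Z R P xs ys"
          using c n J i e by (intro wp_set_scalar) (auto simp: J_def nat_mult_distrib abs_mult simp del: of_nat_Suc)
      qed simp
      then show "i > 0 \<and> wp B (Seq c (set_scalar x (Add (scalar x) (Const 1)))) (k + 1) (J (i - 1)) V Z R P xs ys"
        using i by blast
    next
      fix i V Z R P xs ys
      assume J: "J i V Z R P xs ys" and neg: "\<not> 0 < val (mem V Z R P) (Sub e (scalar x))"
      then have "i = 0" using bound[of "n - i" V Z R P xs ys] by (auto simp: J_def)
      then show "Q V Z R P xs ys" using exit J by (auto simp: J_def)
    qed (use init c in \<open>auto simp: J_def nat_mult_distrib abs_mult\<close>)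
  qed (use n c in auto)
  then show ?thesis by (rule wp_weaken) (use k' in auto)
qed

lemma wp_seq_le:
  assumes "wp B c ka (wp B d kb Q) V Z R P xs ys" "ka + kb \<le> k"
  shows "wp B (Seq c d) k Q V Z R P xs ys"
  using wp_weaken[OF wp_seq[OF assms(1)] _ assms(2)] by blast

section \<open>Loops over arrays and sums\<close>

definition fill :: "int \<Rightarrow> nat \<Rightarrow> (nat \<Rightarrow> int) \<Rightarrow> (int \<Rightarrow> int) \<Rightarrow> int \<Rightarrow> int" where
  "fill off n F f a = (if off \<le> a \<and> a < off + int n then F (nat (a - off)) else f a)"

lemma fill_0 [simp]: "fill off 0 F f = f"
  by (auto simp: fill_def)

lemma fill_Suc: "fill off (Suc n) F f = (fill off n F f)(off + int n := F n)"
  by (auto simp: fill_def fun_eq_iff)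

definition entry :: "nat \<Rightarrow> (int \<Rightarrow> int) \<Rightarrow> nat \<Rightarrow> nat \<Rightarrow> int" where
  "entry m f j l = f (int (j * m + l))"

lemma index_less: "j < n \<Longrightarrow> l < m \<Longrightarrow> j * m + l < n * (m :: nat)"
proof -
  assume a: "j < n" "l < m"
  have "j * m + l < Suc j * m" using a(2) by simp
  also have "\<dots> \<le> n * m" using a(1) by (intro mult_le_mono1) simp
  finally show ?thesis .
qed

lemma entry_fill:
  assumes "j < m" "l < m"
  shows "entry m (fill 0 (m * m) (\<lambda>x. F (x div m) (x mod m)) f) j l = F j l"
  using index_less[OF assms] assms by (simp add: entry_def fill_def del: of_nat_add of_nat_mult)

text \<open>The expression may depend on the array that is overwritten, but only on the cell about
  to be written, whose old contents are still there.\<close>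

lemma wp_map_r:
  assumes c: "16 * nat \<bar>x\<bar> + cost_factor en + 2 * width en \<le> 9000" "16 * nat \<bar>x\<bar> + cost_factor e + width e \<le> 9000"
    and n: "int n \<le> B"
    and en: "\<And>j R'. j \<le> n \<Longrightarrow> val (mem (V(x := int j)) Z R' P) en = int n"
    and e: "\<And>j R'. j < n \<Longrightarrow> R' (int j) = R (int j) \<Longrightarrow>
      val (mem (V(x := int j)) Z R' P) e = F j"
    and bd: "\<And>j. j < n \<Longrightarrow> \<bar>F j\<bar> \<le> B"
    and Q: "Q (V(x := int n)) Z (fill 0 n F R) P xs ys"
  shows "wp B (for_loop x en (set_r (scalar x) e)) (3 * n + 2) Q V Z R P xs ys"
proof (rule wp_for[where n = n and k = 1 and I = "\<lambda>j V' Z' R' P' xs' ys'.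
    V' = V(x := int j) \<and> Z' = Z \<and> R' = fill 0 j F R \<and> P' = P \<and> xs' = xs \<and> ys' = ys"])
  fix j V' Z' R' P' xs' ys'
  assume j: "j < n" and "V' x = int j"
    and "V' = V(x := int j) \<and> Z' = Z \<and> R' = fill 0 j F R \<and> P' = P \<and> xs' = xs \<and> ys' = ys"
  then have eqs: "V' = V(x := int j)" "Z' = Z" "R' = fill 0 j F R" "P' = P" "xs' = xs" "ys' = ys" by auto
  have e': "val (mem V' Z' R' P') e = F j"
    unfolding eqs by (rule e[OF j]) (simp add: fill_def)
  show "wp B (set_r (scalar x) e) 1 (\<lambda>V' Z' R' P' xs' ys'. V' x = int j \<and>
      V'(x := int (Suc j)) = V(x := int (Suc j)) \<and> Z' = Z \<and> R' = fill 0 (Suc j) F R \<and> P' = P \<and>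
      xs' = xs \<and> ys' = ys) V' Z' R' P' xs' ys'"
    by (rule wp_set_r) (use c e' bd[OF j] in \<open>auto simp: nat_mult_distrib abs_mult eqs fill_Suc\<close>)
qed (use c n en Q in auto)

lemma wp_map_z:
  assumes c: "16 * nat \<bar>x\<bar> + cost_factor en + 2 * width en \<le> 9000" "cost_factor ie + 3 * width ie + cost_factor e + width e \<le> 9000"
    and n: "int n \<le> B"
    and en: "\<And>j Z'. j \<le> n \<Longrightarrow> val (mem (V(x := int j)) Z' R P) en = int n"
    and ie: "\<And>j Z'. j < n \<Longrightarrow> val (mem (V(x := int j)) Z' R P) ie = off + int j"
    and e: "\<And>j Z'. j < n \<Longrightarrow> val (mem (V(x := int j)) Z' R P) e = F j"
    and bd: "\<And>j. j < n \<Longrightarrow> \<bar>F j\<bar> \<le> B"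
    and Q: "Q (V(x := int n)) (fill off n F Z) R P xs ys"
  shows "wp B (for_loop x en (set_z ie e)) (3 * n + 2) Q V Z R P xs ys"
proof (rule wp_for[where n = n and k = 1 and I = "\<lambda>j V' Z' R' P' xs' ys'.
    V' = V(x := int j) \<and> Z' = fill off j F Z \<and> R' = R \<and> P' = P \<and> xs' = xs \<and> ys' = ys"])
  fix j V' Z' R' P' xs' ys'
  assume j: "j < n" and "V' x = int j"
    and "V' = V(x := int j) \<and> Z' = fill off j F Z \<and> R' = R \<and> P' = P \<and> xs' = xs \<and> ys' = ys"
  then have eqs: "V' = V(x := int j)" "Z' = fill off j F Z" "R' = R" "P' = P" "xs' = xs" "ys' = ys" by auto
  show "wp B (set_z ie e) 1 (\<lambda>V' Z' R' P' xs' ys'. V' x = int j \<and>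
      V'(x := int (Suc j)) = V(x := int (Suc j)) \<and> Z' = fill off (Suc j) F Z \<and> R' = R \<and> P' = P \<and>
      xs' = xs \<and> ys' = ys) V' Z' R' P' xs' ys'"
    by (rule wp_set_z) (use c e ie bd j in \<open>auto simp: eqs fill_Suc\<close>)
qed (use c n en Q in auto)

definition sum_loop :: "int \<Rightarrow> int \<Rightarrow> aexp \<Rightarrow> aexp \<Rightarrow> com" where
  "sum_loop acc l en e = Seq (set_scalar acc (Const 0)) (for_loop l en (set_scalar acc (Add (scalar acc) e)))"

lemma wp_sum:
  assumes c: "16 * nat \<bar>l\<bar> + cost_factor en + 2 * width en \<le> 9000" "16 * nat \<bar>acc\<bar> + cost_factor e + 2 * width e \<le> 9000"
    and n: "int n \<le> B" and "acc \<noteq> l"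
    and en: "\<And>j a. j \<le> n \<Longrightarrow> val (mem (V(acc := a, l := int j)) Z R P) en = int n"
    and e: "\<And>j a. j < n \<Longrightarrow> val (mem (V(acc := a, l := int j)) Z R P) e = F j"
    and bd: "\<And>j. j \<le> n \<Longrightarrow> \<bar>\<Sum>i<j. F i\<bar> \<le> B"
    and Q: "Q (V(acc := \<Sum>i<n. F i, l := int n)) Z R P xs ys"
  shows "wp B (sum_loop acc l en e) (3 * n + 3) Q V Z R P xs ys"
  unfolding sum_loop_def
proof (rule wp_seq_le[where ka = 1 and kb = "3 * n + 2"], rule wp_set_scalar)
  show "wp B (for_loop l en (set_scalar acc (Add (scalar acc) e))) (3 * n + 2) Q
    (V(acc := val (mem V Z R P) (Const 0))) Z R P xs ys"
  proof (rule wp_for[where n = n and k = 1 and I = "\<lambda>j V' Z' R' P' xs' ys'.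
      V' = V(acc := \<Sum>i<j. F i, l := int j) \<and> Z' = Z \<and> R' = R \<and> P' = P \<and> xs' = xs \<and> ys' = ys"])
    fix j V' Z' R' P' xs' ys'
    assume j: "j < n" and "V' l = int j"
      and "V' = V(acc := \<Sum>i<j. F i, l := int j) \<and> Z' = Z \<and> R' = R \<and> P' = P \<and> xs' = xs \<and> ys' = ys"
    then have eqs: "V' = V(acc := \<Sum>i<j. F i, l := int j)" "Z' = Z" "R' = R" "P' = P" "xs' = xs" "ys' = ys"
      by auto
    have e': "val (mem V' Z' R' P') e = F j" unfolding eqs by (rule e[OF j])
    have acc: "V' acc = (\<Sum>i<j. F i)" using \<open>acc \<noteq> l\<close> by (simp add: eqs)
    have upd: "V'(acc := v, l := y) = V(acc := v, l := y)" for v y by (auto simp: eqs fun_eq_iff)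
    show "wp B (set_scalar acc (Add (scalar acc) e)) 1 (\<lambda>V' Z' R' P' xs' ys'. V' l = int j \<and>
        V'(l := int (Suc j)) = V(acc := \<Sum>i<Suc j. F i, l := int (Suc j)) \<and> Z' = Z \<and> R' = R \<and> P' = P \<and>
        xs' = xs \<and> ys' = ys) V' Z' R' P' xs' ys'"
      by (rule wp_set_scalar)
        (use c bd[of "Suc j"] j \<open>acc \<noteq> l\<close> \<open>V' l = int j\<close> eqs(2-) e' in
          \<open>auto simp: acc upd nat_mult_distrib abs_mult simp del: of_nat_Suc\<close>)
  qed (use c n en Q in auto)
qed (use c n in \<open>auto\<close>)

section \<open>Registers, remainders and integer square roots\<close>

abbreviation (input) "reg_m \<equiv> 0 :: int"
abbreviation (input) "reg_x \<equiv> 1 :: int"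
abbreviation (input) "reg_l \<equiv> 2 :: int"
abbreviation (input) "reg_acc \<equiv> 3 :: int"
abbreviation (input) "reg_c \<equiv> 4 :: int"
abbreviation (input) "reg_i \<equiv> 5 :: int"
abbreviation (input) "reg_lo \<equiv> 6 :: int"
abbreviation (input) "reg_hi \<equiv> 7 :: int"
abbreviation (input) "reg_mid \<equiv> 8 :: int"
abbreviation (input) "reg_a \<equiv> 9 :: int"
abbreviation (input) "reg_w \<equiv> 10 :: int"
abbreviation (input) "reg_W \<equiv> 11 :: int"
abbreviation (input) "reg_s \<equiv> 12 :: int"
abbreviation (input) "reg_t \<equiv> 13 :: int"
abbreviation (input) "reg_k \<equiv> 14 :: int"

definition imod :: "aexp \<Rightarrow> aexp \<Rightarrow> aexp" where
  "imod a b = Sub a (Mul (Div a b) b)"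

text \<open>The indicator of equality, as \<open>1 div (1 + x * x)\<close> is 0 unless \<open>x = 0\<close>.\<close>

definition ind :: "aexp \<Rightarrow> aexp \<Rightarrow> aexp" where
  "ind a b = Div (Const 1) (Add (Const 1) (Mul (Sub a b) (Sub a b)))"

lemma val_imod [simp]: "val M (imod a b) = val M a mod val M b"
  by (simp add: imod_def minus_div_mult_eq_mod)

lemma val_ind [simp]: "val M (ind a b) = (if val M a = val M b then 1 else 0)"
proof (cases "val M a = val M b")
  case False
  then have "(val M a - val M b) * (val M a - val M b) > 0" by (simp add: zero_less_mult_iff; linarith)
  then show ?thesis using False by (simp add: ind_def)
qed (simp add: ind_def)

lemma size_imod [simp]:
  "width (imod a b) = 2 * width a + width b"
  "cost_factor (imod a b) = 2 * cost_factor a + 2 * cost_factor b + 4 * width a + 3 * width b"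
  by (simp_all add: imod_def)

lemma size_ind [simp]:
  "width (ind a b) = 3"
  "cost_factor (ind a b) = 15 + 2 * cost_factor a + 2 * cost_factor b + 8 * width a + 8 * width b"
  by (simp_all add: ind_def)

definition isqrt_com :: com where
  "isqrt_com = Seq (set_scalar reg_lo (Const 0)) (Seq (set_scalar reg_hi (Add (scalar reg_a) (Const 1)))
     (While (Sub (Sub (scalar reg_hi) (scalar reg_lo)) (Const 1))
       (Seq (set_scalar reg_mid (Div (Add (scalar reg_lo) (scalar reg_hi)) (Const 2)))
         (Cond (Sub (Mul (scalar reg_mid) (scalar reg_mid)) (scalar reg_a)) (set_scalar reg_hi (scalar reg_mid)) (set_scalar reg_lo (scalar reg_mid))))))"

text \<open>Bisection with \<open>lo\<^sup>2 \<le> a < hi\<^sup>2\<close>. The distance is at most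
  \<open>2 ^ j\<close> when j rounds remain; it starts as \<open>a + 1\<close>, at most
  \<open>2 ^ b\<close>, and at distance 1 the lower end is the root.\<close>

lemma wp_isqrt:
  assumes A: "0 \<le> V reg_a" "V reg_a < 2 ^ b" "V reg_a < B"
    and Q: "\<And>V'. (\<And>y. y \<noteq> reg_lo \<Longrightarrow> y \<noteq> reg_hi \<Longrightarrow> y \<noteq> reg_mid \<Longrightarrow> V' y = V y) \<Longrightarrow>
      0 \<le> V' reg_lo \<Longrightarrow> (V' reg_lo)\<^sup>2 \<le> V reg_a \<Longrightarrow> V reg_a < (V' reg_lo + 1)\<^sup>2 \<Longrightarrow> Q V' Z R P xs ys"
  shows "wp B isqrt_com (4 * b + 3) Q V Z R P xs ys"
proof -
  define I where "I j V' Z' R' P' xs' ys' \<longleftrightarrow>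
    (\<forall>y. y \<noteq> reg_lo \<longrightarrow> y \<noteq> reg_hi \<longrightarrow> y \<noteq> reg_mid \<longrightarrow> V' y = V y) \<and> 0 \<le> V' reg_lo \<and> V' reg_lo < V' reg_hi \<and>
    V' reg_hi - V' reg_lo \<le> 2 ^ j \<and> V' reg_hi \<le> V reg_a + 1 \<and>
    (V' reg_lo)\<^sup>2 \<le> V reg_a \<and> V reg_a < (V' reg_hi)\<^sup>2 \<and> Z' = Z \<and> R' = R \<and> P' = P \<and> xs' = xs \<and> ys' = ys"
    for j V' Z' R' P' xs' ys'
  have "0 \<le> V reg_a * V reg_a" by simp
  then have sq: "V reg_a < (V reg_a + 1)\<^sup>2" unfolding power2_eq_square
    using A(1) by (simp add: algebra_simps del: zero_le_square; linarith)
  have "wp B isqrt_com (1 + (1 + (b * (3 + 1) + 1))) Q V Z R P xs ys"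
    unfolding isqrt_com_def
  proof (rule wp_seq, rule wp_set_scalar, goal_cases)
    case 3
    show ?case
    proof (rule wp_seq, rule wp_set_scalar, goal_cases)
      case 3
      show ?case
      proof (rule wp_while[where I = I])
        fix n V' Z' R' P' xs' ys'
        assume I: "I n V' Z' R' P' xs' ys'"
          and pos: "0 < val (mem V' Z' R' P') (Sub (Sub (scalar reg_hi) (scalar reg_lo)) (Const 1))"
        have n: "n > 0" using I pos by (cases n) (auto simp: I_def)
        then obtain n' where n': "n = Suc n'" by (cases n) auto
        define d where "d = (V' reg_lo + V' reg_hi) div 2"
        have d: "V' reg_lo < d" "d < V' reg_hi" using pos I by (auto simp: d_def I_def)
        have h: "V' reg_hi - d \<le> 2 ^ n'" "d - V' reg_lo \<le> 2 ^ n'" "0 \<le> d" "d \<le> V reg_a" "\<bar>d\<bar> \<le> B"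
          using I A d unfolding I_def n' by (auto simp: d_def)
        have "wp B (Seq (set_scalar reg_mid (Div (Add (scalar reg_lo) (scalar reg_hi)) (Const 2)))
          (Cond (Sub (Mul (scalar reg_mid) (scalar reg_mid)) (scalar reg_a)) (set_scalar reg_hi (scalar reg_mid)) (set_scalar reg_lo (scalar reg_mid))))
          (1 + (1 + 1)) (I (n - 1)) V' Z' R' P' xs' ys'"
          apply (rule wp_seq, rule wp_set_scalar)
          subgoal by simp
          subgoal using h by (simp add: d_def[symmetric])
          subgoal
            apply (rule wp_cond)
            subgoal by simp
            subgoal
              apply (rule wp_set_scalar)
              subgoal by simp
              subgoal using h by (simp add: d_def[symmetric])
              subgoal using I h d n' by (simp add: d_def[symmetric] I_def power2_eq_square)
              done
            subgoal
              apply (rule wp_set_scalar)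
              subgoal by simp
              subgoal using h by (simp add: d_def[symmetric])
              subgoal using I h d n' by (simp add: d_def[symmetric] I_def power2_eq_square)
              done
            done
          done
        then show "n > 0 \<and> wp B (Seq (set_scalar reg_mid (Div (Add (scalar reg_lo) (scalar reg_hi)) (Const 2)))
          (Cond (Sub (Mul (scalar reg_mid) (scalar reg_mid)) (scalar reg_a)) (set_scalar reg_hi (scalar reg_mid)) (set_scalar reg_lo (scalar reg_mid))))
          3 (I (n - 1)) V' Z' R' P' xs' ys'"
          using n by (simp add: numeral_3_eq_3)
      next
        fix n V' Z' R' P' xs' ys'
        assume I: "I n V' Z' R' P' xs' ys'"
          and neg: "\<not> 0 < val (mem V' Z' R' P') (Sub (Sub (scalar reg_hi) (scalar reg_lo)) (Const 1))"
        then have "V' reg_hi = V' reg_lo + 1" by (auto simp: I_def)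
        then show "Q V' Z' R' P' xs' ys'" using I Q[of V'] by (auto simp: I_def)
      next
        show "I b (V(reg_lo := val (mem V Z R P) (Const 0), reg_hi := val (mem (V(reg_lo := val (mem V Z R P) (Const 0))) Z R P)
          (Add (scalar reg_a) (Const 1)))) Z R P xs ys"
          using A sq by (simp add: I_def)
      qed simp
    qed (use A in auto)
  qed (use A in auto)
  then show ?thesis by (rule wp_weaken) auto
qed

definition sub_column :: com where
  "sub_column = for_loop reg_x (Mul (scalar reg_m) (scalar reg_m))
     (set_r (scalar reg_x) (Sub (arr_r (scalar reg_x))
       (Mul (arr_z (Add (Mul (scalar reg_c) (scalar reg_m)) (Div (scalar reg_x) (scalar reg_m))))
            (arr_z (Add (Mul (scalar reg_c) (scalar reg_m)) (imod (scalar reg_x) (scalar reg_m)))))))"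

lemma wp_sub_column:
  assumes vars: "V reg_m = int m" "V reg_c = int c" and B: "int (m * m) \<le> B"
    and bd: "\<And>j l. j < m \<Longrightarrow> l < m \<Longrightarrow> \<bar>entry m R j l - entry m Z c j * entry m Z c l\<bar> \<le> B"
    and Q: "\<And>R'. (\<And>j l. j < m \<Longrightarrow> l < m \<Longrightarrow> entry m R' j l = entry m R j l - entry m Z c j * entry m Z c l) \<Longrightarrow>
      Q (V(reg_x := int (m * m))) Z R' P xs ys"
  shows "wp B sub_column (3 * (m * m) + 2) Q V Z R P xs ys"
  unfolding sub_column_def
proof (rule wp_map_r[where F = "\<lambda>x. entry m R (x div m) (x mod m) - entry m Z c (x div m) * entry m Z c (x mod m)"])
  fix j R'
  assume j: "j < m * m" and R': "R' (int j) = R (int j)"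
  then have m: "m > 0" by (cases m) auto
  show "val (mem (V(reg_x := int j)) Z R' P) (Sub (arr_r (scalar reg_x))
       (Mul (arr_z (Add (Mul (scalar reg_c) (scalar reg_m)) (Div (scalar reg_x) (scalar reg_m))))
            (arr_z (Add (Mul (scalar reg_c) (scalar reg_m)) (imod (scalar reg_x) (scalar reg_m))))))
    = entry m R (j div m) (j mod m) - entry m Z c (j div m) * entry m Z c (j mod m)"
    using R' by (simp add: vars entry_def zdiv_int zmod_int)
next
  fix j assume j: "j < m * m"
  then have "m > 0" by (cases m) auto
  then show "\<bar>entry m R (j div m) (j mod m) - entry m Z c (j div m) * entry m Z c (j mod m)\<bar> \<le> B"
    using bd[of "j div m" "j mod m"] j by (simp add: less_mult_imp_div_less)
next
  show "Q (V(reg_x := int (m * m))) Z (fill 0 (m * m) (\<lambda>x. entry m R (x div m) (x mod m)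
      - entry m Z c (x div m) * entry m Z c (x mod m)) R) P xs ys"
    by (rule Q) (simp add: entry_fill[where F = "\<lambda>j l. entry m R j l - entry m Z c j * entry m Z c l"])
qed (use vars B in auto)

section \<open>The program\<close>


text \<open>The first loop writes the quotient of the diagonal entry as well; the next command
  overwrites it with the divisor x.\<close>

definition emit_com :: com where
  "emit_com = Seq (for_loop reg_x (scalar reg_m) (set_z (Add (Mul (scalar reg_c) (scalar reg_m)) (scalar reg_x))
       (Div (arr_r (Add (Mul (scalar reg_i) (scalar reg_m)) (scalar reg_x))) (scalar reg_lo))))
     (Seq (set_z (Add (Mul (scalar reg_c) (scalar reg_m)) (scalar reg_i)) (scalar reg_lo))
     (Seq sub_column (set_scalar reg_c (Add (scalar reg_c) (Const 1)))))"

text \<open>The bound on the new residual is required for every abstract successor, so that a caller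
  can derive it from its invariant before the new contents of the memory are known.\<close>

lemma wp_emit:
  assumes vars: "V reg_m = int m" "V reg_c = int c" "V reg_i = int i" "V reg_lo = x" and i: "i < m"
    and B: "int (m * m) \<le> B" "int m \<le> B" "int c < B" "\<bar>x\<bar> \<le> B"
    and R: "\<And>j. j < m \<Longrightarrow> \<bar>entry m R i j\<bar> \<le> B"
    and bd: "\<And>r' z' j l. emits m i x (entry m R) (entry m Z) c r' z' \<Longrightarrow> j < m \<Longrightarrow> l < m \<Longrightarrow> \<bar>r' j l\<bar> \<le> B"
    and Q: "\<And>Z' R'. emits m i x (entry m R) (entry m Z) c (entry m R') (entry m Z') \<Longrightarrow>
      Q (V(reg_x := int (m * m), reg_c := int (Suc c))) Z' R' P xs ys"
  shows "wp B emit_com (3 * (m * m) + 3 * m + 6) Q V Z R P xs ys"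
proof -
  let ?Z1 = "fill (int (c * m)) m (\<lambda>j. entry m R i j div x) Z"
  let ?Z = "?Z1(int (c * m + i) := x)"
  have low: "entry m ?Z p j = entry m Z p j" if "p < c" "j < m" for p j
    using index_less[OF that] by (simp add: entry_def fill_def del: of_nat_add of_nat_mult)
  have new: "entry m ?Z c j = (if j = i then x else entry m R i j div x)" if "j < m" for j
    using that by (simp add: entry_def fill_def)
  define r' where "r' = (\<lambda>j l. entry m R j l - entry m ?Z c j * entry m ?Z c l)"
  have em: "emits m i x (entry m R) (entry m Z) c r' (entry m ?Z)"
    using low new by (simp add: emits_def r'_def)
  have "wp B emit_com ((3 * m + 2) + (1 + ((3 * (m * m) + 2) + 1))) Q V Z R P xs ys"
    unfolding emit_com_def
  proof (rule wp_seq, rule wp_map_z[where off = "int (c * m)" and F = "\<lambda>j. entry m R i j div x"])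
    show "\<bar>entry m R i j div x\<bar> \<le> B" if "j < m" for j
      using R[OF that] abs_div_le[of "entry m R i j" x] by linarith
    show "wp B (Seq (set_z (Add (Mul (scalar reg_c) (scalar reg_m)) (scalar reg_i)) (scalar reg_lo))
        (Seq sub_column (set_scalar reg_c (Add (scalar reg_c) (Const 1))))) (1 + ((3 * (m * m) + 2) + 1)) Q
        (V(reg_x := int m)) ?Z1 R P xs ys"
    proof (rule wp_seq, rule wp_set_z, goal_cases)
      case 3
      have eq: "?Z1(val (mem (V(reg_x := int m)) ?Z1 R P) (Add (Mul (scalar reg_c) (scalar reg_m)) (scalar reg_i)) :=
        val (mem (V(reg_x := int m)) ?Z1 R P) (scalar reg_lo)) = ?Z" by (simp add: vars)
      show ?case
        unfolding eq
      proof (rule wp_seq, rule wp_sub_column[where m = m and c = c])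
        show "\<bar>entry m R j l - entry m ?Z c j * entry m ?Z c l\<bar> \<le> B" if "j < m" "l < m" for j l
          using bd[OF em that] by (simp add: r'_def)
        fix R' assume R': "\<And>j l. j < m \<Longrightarrow> l < m \<Longrightarrow> entry m R' j l = entry m R j l - entry m ?Z c j * entry m ?Z c l"
        have "emits m i x (entry m R) (entry m Z) c (entry m R') (entry m ?Z)"
          using em R' by (simp add: emits_def r'_def)
        from Q[OF this] show "wp B (set_scalar reg_c (Add (scalar reg_c) (Const 1))) 1 Q (V(reg_x := int m, reg_x := int (m * m))) ?Z R' P xs ys"
          using B by (intro wp_set_scalar) (auto simp: vars add.commute)
      qed (use vars B in auto)
    qed (use vars B in auto)
  qed (use vars B in \<open>auto simp: entry_def\<close>)
  then show ?thesis by (rule wp_weaken) auto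
qed

definition reduce_loop :: com where
  "reduce_loop = While (Sub (scalar reg_w) (Const 1))
     (Seq (set_scalar reg_a (scalar reg_w)) (Seq isqrt_com (Seq (set_scalar reg_w (scalar reg_lo)) emit_com)))"

definition square_loop :: com where
  "square_loop = While (arr_r (Add (Mul (scalar reg_i) (scalar reg_m)) (scalar reg_i)))
     (Seq (set_scalar reg_a (arr_r (Add (Mul (scalar reg_i) (scalar reg_m)) (scalar reg_i)))) (Seq isqrt_com emit_com))"

definition row_com :: com where
  "row_com = Seq (set_scalar reg_w (scalar reg_W)) (Seq reduce_loop square_loop)"

definition elim_com :: com where
  "elim_com = for_loop reg_i (scalar reg_m) row_com"

text \<open>Below \<open>greedy_bound n\<close>, at most \<open>n\<close> greedy subtractions of squares lead to 0.\<close>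

fun greedy_bound :: "nat \<Rightarrow> int" where
  "greedy_bound 0 = 1"
| "greedy_bound (Suc 0) = 2"
| "greedy_bound (Suc (Suc 0)) = 3"
| "greedy_bound (Suc (Suc (Suc 0))) = 4"
| "greedy_bound (Suc (Suc (Suc (Suc n)))) = 4 * 2 ^ 2 ^ n"

lemma power_power_Suc: "(2 :: int) ^ 2 ^ Suc n = (2 ^ 2 ^ n)\<^sup>2"
  by (simp add: power_mult[symmetric] mult.commute)

lemma sqrt_less_power:
  assumes "(x::int)\<^sup>2 \<le> w" "w < 2 ^ 2 ^ n" "1 < w"
  shows "n > 0 \<and> x < 2 ^ 2 ^ (n - 1)"
proof (cases n)
  case (Suc k)
  have "x\<^sup>2 < (2 ^ 2 ^ k)\<^sup>2" using assms power_power_Suc[of k] unfolding Suc by linarith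
  then show ?thesis using power2_less_imp_less[of x "2 ^ 2 ^ k"] Suc by simp
qed (use assms in auto)

text \<open>If N is below \<open>4 * y\<^sup>2\<close>, then x is below \<open>2 * y\<close>, and
  the remainder is at most \<open>2 * x\<close>, below \<open>4 * y\<close>. Thus the factor 4
  reproduces itself while y is replaced by its square root; the numbers below 8 are treated
  separately.\<close>

lemma greedy_step:
  fixes N x :: int
  assumes N: "N < greedy_bound n" "0 < N" and x: "0 \<le> x" "x\<^sup>2 \<le> N" "N < (x + 1)\<^sup>2"
  shows "n > 0 \<and> N - x\<^sup>2 < greedy_bound (n - 1)"
proof -
  have x1: "1 \<le> x" using x N by (cases "x = 0") auto
  then have x2: "1 \<le> x\<^sup>2" by (simp add: self_le_power order_trans[OF _ self_le_power])
  have r: "N - x\<^sup>2 \<le> 2 * x" using x(3) by (simp add: power2_eq_square algebra_simps)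
  consider "n = 0" | "n = 1" | "n = 2" | "n = 3" | "n = 4" | k where "n = Suc (Suc (Suc (Suc (Suc k))))"
  proof (cases "n < 5")
    case False
    then have "n = Suc (Suc (Suc (Suc (Suc (n - 5)))))" by simp
    then show ?thesis using that(6) by blast
  next
    case True
    then have "n = 0 \<or> n = 1 \<or> n = 2 \<or> n = 3 \<or> n = 4" by linarith
    then show ?thesis using that by blast
  qed
  then show ?thesis
  proof cases
    case 5
    then have N8: "N < 8" using N by (simp add: eval_nat_numeral)
    then have "x < 3" using x(2) power_mono[of 3 x 2] by (cases "x < 3") auto
    then have "x = 1 \<or> x = 2" using x1 by auto
    then show ?thesis using 5 N8 x by (auto simp: eval_nat_numeral)
  next
    case 6
    have "x\<^sup>2 < (2 * 2 ^ 2 ^ k)\<^sup>2" using N x(2) power_power_Suc[of k]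
      unfolding 6 greedy_bound.simps power_mult_distrib by simp
    then have "x < 2 * 2 ^ 2 ^ k" by (intro power2_less_imp_less[of x]) auto
    then show ?thesis using r unfolding 6 by simp
  qed (use N x2 in \<open>auto simp: numeral_2_eq_2 numeral_3_eq_3\<close>)
qed

section \<open>Running time and number of columns of the elimination\<close>

context elimination
begin

definition frame :: "nat \<Rightarrow> (int \<Rightarrow> int) \<Rightarrow> (int \<Rightarrow> int) \<Rightarrow> (int \<Rightarrow> int) \<Rightarrow> (int \<Rightarrow> int) \<Rightarrow> bool" where
  "frame i V Z V' Z' \<longleftrightarrow> V' reg_m = int m \<and> V' reg_i = int i \<and> V' reg_W = w1\<^sup>2 \<and> V' reg_s = V reg_s \<and>
     (\<forall>p<m. \<forall>j<m. entry m Z' p j = entry m Z p j)"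

lemma frame_emits:
  assumes "frame i V Z V' Z'" "m \<le> c" "emits m i x r (entry m Z') c r' (entry m Z'')"
    "V'' reg_m = V' reg_m" "V'' reg_i = V' reg_i" "V'' reg_W = V' reg_W" "V'' reg_s = V' reg_s"
  shows "frame i V Z V'' Z''"
  using assms by (auto simp: frame_def emits_def)

text \<open>With n rounds left, w is below \<open>2 ^ 2 ^ n\<close>; a square root halves the inner
  power, and \<open>n = 0\<close> means \<open>w \<le> 1\<close>. A round emits one column, so the
  same budget bounds the number of columns.\<close>

lemma wp_reduce_loop:
  assumes i: "i < m" and fr: "frame i Vi Zi V Z" and reg_c: "V reg_c = int c" and reg_w: "V reg_w = w1\<^sup>2"
    and inv: "row_inv i (entry m R) (entry m Z) c"
    and k: "w1\<^sup>2 < 2 ^ 2 ^ k" and b: "S < 2 ^ b"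
    and B: "2 * S + 1 < B" "int (m * m) \<le> B" "int m \<le> B" "int (c + k) < B"
    and Q: "\<And>V' Z' R' c'. frame i Vi Zi V' Z' \<Longrightarrow> V' reg_c = int c' \<Longrightarrow> c' \<le> c + k \<Longrightarrow>
      square_inv i (entry m R') (entry m Z') c' \<Longrightarrow> Q V' Z' R' P xs ys"
  shows "wp B reduce_loop (k * (4 * b + 3 * (m * m) + 3 * m + 12) + 1) Q V Z R P xs ys"
proof -
  define I where "I n V' Z' R' P' xs' ys' \<longleftrightarrow> frame i Vi Zi V' Z' \<and>
    (\<exists>c'. V' reg_c = int c' \<and> c' + n \<le> c + k \<and> phase_inv i (V' reg_w) (entry m R') (entry m Z') c') \<and>
    V' reg_w < 2 ^ 2 ^ n \<and> P' = P \<and> xs' = xs \<and> ys' = ys" for n V' Z' R' P' xs' ys'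
  have w1S: "0 \<le> w1\<^sup>2" "w1 \<le> w1\<^sup>2" using w1_ge by (auto simp: power2_eq_square)
  have "wp B reduce_loop (k * ((1 + ((4 * b + 3) + (1 + (3 * (m * m) + 3 * m + 6)))) + 1) + 1) Q V Z R P xs ys"
    unfolding reduce_loop_def
  proof (rule wp_while[where I = I])
    fix n V' Z' R' P' xs' ys'
    assume I: "I n V' Z' R' P' xs' ys'" and "0 < val (mem V' Z' R' P') (Sub (scalar reg_w) (Const 1))"
    then have w: "1 < V' reg_w" by simp
    from I have fr': "frame i Vi Zi V' Z'" and wn: "V' reg_w < 2 ^ 2 ^ n" and e: "P' = P" "xs' = xs" "ys' = ys"
      by (auto simp: I_def)
    from I obtain c' where c': "V' reg_c = int c'" "c' + n \<le> c + k"
      and ph: "phase_inv i (V' reg_w) (entry m R') (entry m Z') c'" by (auto simp: I_def)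
    have wS: "V' reg_w \<le> w1\<^sup>2" using ph w1S by (auto simp: phase_inv_def reduce_inv_def)
    have mc: "m \<le> c'" using ph by (auto simp: phase_inv_def row_inv_def reduce_inv_def unit_inv_def)
    have n: "n > 0" using wn w by (cases n) auto
    have "wp B (Seq (set_scalar reg_a (scalar reg_w)) (Seq isqrt_com (Seq (set_scalar reg_w (scalar reg_lo)) emit_com)))
      (1 + ((4 * b + 3) + (1 + (3 * (m * m) + 3 * m + 6)))) (I (n - 1)) V' Z' R' P' xs' ys'"
    proof (rule wp_seq, rule wp_set_scalar, goal_cases)
      case 2
      then show ?case using w wS S_ge w1S B by simp
    next
      case 3
      show ?case
      proof (rule wp_seq, rule wp_isqrt, goal_cases)
        case 1 show ?case using w by simp
      next
        have "V' reg_w < 2 ^ b" using wS S_ge w1S b by linarith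
        then show "(V'(reg_a := val (mem V' Z' R' P') (scalar reg_w))) reg_a < 2 ^ b" by simp
      next
        case 3 show ?case using wS S_ge w1S B by simp
      next
        case (4 V'')
        define x where "x = V'' reg_lo"
        have x: "0 \<le> x" "x\<^sup>2 \<le> V' reg_w" "V' reg_w < (x + 1)\<^sup>2" using 4(2-4) by (auto simp: x_def)
        have same: "V'' y = V' y" if "y \<noteq> reg_lo" "y \<noteq> reg_hi" "y \<noteq> reg_mid" "y \<noteq> reg_a" for y
          using 4(1)[of y] that by simp
        have "x \<le> x\<^sup>2" using x(1) by (cases "x = 0") (auto simp: power2_eq_square)
        then have xB: "\<bar>x\<bar> \<le> B" using x(1,2) wS S_ge w1S B by linarith
        have xn: "x < 2 ^ 2 ^ (n - 1)" using sqrt_less_power[OF x(2) wn w] by simp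
        show ?case
        proof (rule wp_seq, rule wp_set_scalar, goal_cases)
          case 2
          then show ?case using xB by (simp add: x_def)
        next
          case 3
          show ?case
          proof (rule wp_emit[where m = m and c = c' and i = i and x = x])
            fix r' z' j l
            assume "emits m i x (entry m R') (entry m Z') c' r' z'" and jl: "j < m" "l < m"
            from phase_step[OF ph i this(1) w x]
            show "\<bar>r' j l\<bar> \<le> B" using phase_bound[OF _ i jl] B by fastforce
          next
            fix Z'' R'' assume em: "emits m i x (entry m R') (entry m Z') c' (entry m R'') (entry m Z'')"
            let ?V = "V''(reg_w := val (mem V'' Z' R' P') (scalar reg_lo), reg_x := int (m * m), reg_c := int (Suc c'))"
            have "frame i Vi Zi ?V Z''"
              by (rule frame_emits[OF fr' mc em]) (auto simp: same)
            moreover have "phase_inv i x (entry m R'') (entry m Z'') (Suc c')" by (rule phase_step[OF ph i em w x])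
            ultimately show "I (n - 1) ?V Z'' R'' P' xs' ys'"
              using xn c' n by (auto simp: I_def e x_def[symmetric] intro!: exI[of _ "Suc c'"])
          next
            show "\<bar>entry m R' i j\<bar> \<le> B" if "j < m" for j
              using phase_bound[OF ph i i that] B by linarith
          qed (use fr' c' B i xB n in \<open>auto simp: frame_def same x_def\<close>)
        qed simp
      qed
    qed simp
    then show "n > 0 \<and> wp B (Seq (set_scalar reg_a (scalar reg_w)) (Seq isqrt_com (Seq (set_scalar reg_w (scalar reg_lo)) emit_com)))
      (1 + ((4 * b + 3) + (1 + (3 * (m * m) + 3 * m + 6)))) (I (n - 1)) V' Z' R' P' xs' ys'"
      using n by blast
  next
    fix n V' Z' R' P' xs' ys'
    assume I: "I n V' Z' R' P' xs' ys'" and neg: "\<not> 0 < val (mem V' Z' R' P') (Sub (scalar reg_w) (Const 1))"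
    then obtain c' where c': "V' reg_c = int c'" "c' + n \<le> c + k"
      and ph: "phase_inv i (V' reg_w) (entry m R') (entry m Z') c'" by (auto simp: I_def)
    show "Q V' Z' R' P' xs' ys'"
      using I c' phase_exit[OF ph i] neg Q[of V' Z' c' R'] by (auto simp: I_def)
  next
    show "I k V Z R P xs ys"
      using fr reg_c reg_w k phase_start[OF inv] by (auto simp: I_def)
  qed simp
  then show ?thesis by (rule wp_weaken) auto
qed

text \<open>The budget is now governed by \<open>greedy_bound\<close>, which starts at
  \<open>k + 4\<close> because the diagonal entry is at most S, and whose value 1 at budget 0 forces
  the entry to be at most 0.\<close>

lemma wp_square_loop:
  assumes i: "i < m" and fr: "frame i Vi Zi V Z" and reg_c: "V reg_c = int c"
    and inv: "square_inv i (entry m R) (entry m Z) c"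
    and k: "S < 4 * 2 ^ 2 ^ k" and b: "S < 2 ^ b"
    and B: "2 * S + 1 < B" "int (m * m) \<le> B" "int m \<le> B" "int (c + k + 4) < B"
    and Q: "\<And>V' Z' R' c'. frame i Vi Zi V' Z' \<Longrightarrow> V' reg_c = int c' \<Longrightarrow> c' \<le> c + k + 4 \<Longrightarrow>
      row_inv (Suc i) (entry m R') (entry m Z') c' \<Longrightarrow> Q V' Z' R' P xs ys"
  shows "wp B square_loop ((k + 4) * (4 * b + 3 * (m * m) + 3 * m + 12) + 1) Q V Z R P xs ys"
proof -
  define I where "I n V' Z' R' P' xs' ys' \<longleftrightarrow> frame i Vi Zi V' Z' \<and>
    (\<exists>c'. V' reg_c = int c' \<and> c' + n \<le> c + k + 4 \<and> square_inv i (entry m R') (entry m Z') c') \<and>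
    entry m R' i i < greedy_bound n \<and> P' = P \<and> xs' = xs \<and> ys' = ys" for n V' Z' R' P' xs' ys'
  let ?e = "arr_r (Add (Mul (scalar reg_i) (scalar reg_m)) (scalar reg_i))"
  have val: "val (mem V' Z' R' P') ?e = entry m R' i i" if "frame i Vi Zi V' Z'" for V' Z' R' P'
    using that by (simp add: frame_def entry_def)
  have "wp B square_loop ((k + 4) * ((1 + ((4 * b + 3) + (3 * (m * m) + 3 * m + 6))) + 1) + 1) Q V Z R P xs ys"
    unfolding square_loop_def
  proof (rule wp_while[where I = I])
    fix n V' Z' R' P' xs' ys'
    assume I: "I n V' Z' R' P' xs' ys'" and pos: "0 < val (mem V' Z' R' P') ?e"
    from I have fr': "frame i Vi Zi V' Z'" and wn: "entry m R' i i < greedy_bound n" and e: "P' = P" "xs' = xs" "ys' = ys"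
      by (auto simp: I_def)
    note v = val[OF fr', of R' P']
    have w: "0 < entry m R' i i" using pos v by simp
    from I obtain c' where c': "V' reg_c = int c'" "c' + n \<le> c + k + 4"
      and sq: "square_inv i (entry m R') (entry m Z') c'" by (auto simp: I_def)
    have wS: "entry m R' i i \<le> S" using sq gram_diag_le i by (auto simp: square_inv_def)
    have mc: "m \<le> c'" using sq by (auto simp: square_inv_def unit_inv_def)
    have n: "n > 0" using wn w by (cases n) auto
    have "wp B (Seq (set_scalar reg_a ?e) (Seq isqrt_com emit_com))
      (1 + ((4 * b + 3) + (3 * (m * m) + 3 * m + 6))) (I (n - 1)) V' Z' R' P' xs' ys'"
    proof (rule wp_seq, rule wp_set_scalar, goal_cases)
      case 2
      then show ?case unfolding v using w wS B by simp
    next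
      case 3
      show ?case unfolding v
      proof (rule wp_seq, rule wp_isqrt, goal_cases)
        case 1 show ?case using w by simp
      next
        case 2 show ?case using wS b by simp
      next
        case 3 show ?case using wS w B by simp
      next
        case (4 V'')
        define x where "x = V'' reg_lo"
        have x: "0 \<le> x" "x\<^sup>2 \<le> entry m R' i i" "entry m R' i i < (x + 1)\<^sup>2" using 4(2-4) by (auto simp: x_def)
        have same: "V'' y = V' y" if "y \<noteq> reg_lo" "y \<noteq> reg_hi" "y \<noteq> reg_mid" "y \<noteq> reg_a" for y
          using 4(1)[of y] that by simp
        have "x \<le> x\<^sup>2" using x(1) by (cases "x = 0") (auto simp: power2_eq_square)
        then have xB: "\<bar>x\<bar> \<le> B" using x(1,2) wS w B by linarith
        show ?case
        proof (rule wp_emit[where m = m and c = c' and i = i and x = x])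
          fix r' z' j l
          assume "emits m i x (entry m R') (entry m Z') c' r' z'" and jl: "j < m" "l < m"
          from square_step(1)[OF sq i this(1) x]
          show "\<bar>r' j l\<bar> \<le> B" using square_bound[OF _ i jl] B by fastforce
        next
          fix Z'' R'' assume em: "emits m i x (entry m R') (entry m Z') c' (entry m R'') (entry m Z'')"
          let ?V = "V''(reg_x := int (m * m), reg_c := int (Suc c'))"
          have "frame i Vi Zi ?V Z''"
            by (rule frame_emits[OF fr' mc em]) (auto simp: same)
          moreover note square_step[OF sq i em x]
          ultimately show "I (n - 1) ?V Z'' R'' P' xs' ys'"
            using c' n greedy_step[OF wn w x] by (auto simp: I_def e intro!: exI[of _ "Suc c'"])
        next
          show "\<bar>entry m R' i j\<bar> \<le> B" if "j < m" for j
            using square_bound[OF sq i i that] B by linarith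
        qed (use fr' c' B i xB n in \<open>auto simp: frame_def same x_def\<close>)
      qed
    qed simp
    then show "n > 0 \<and> wp B (Seq (set_scalar reg_a ?e) (Seq isqrt_com emit_com))
      (1 + ((4 * b + 3) + (3 * (m * m) + 3 * m + 6))) (I (n - 1)) V' Z' R' P' xs' ys'"
      using n by blast
  next
    fix n V' Z' R' P' xs' ys'
    assume I: "I n V' Z' R' P' xs' ys'" and neg: "\<not> 0 < val (mem V' Z' R' P') ?e"
    then obtain c' where c': "V' reg_c = int c'" "c' + n \<le> c + k + 4"
      and sq: "square_inv i (entry m R') (entry m Z') c'" by (auto simp: I_def)
    have "entry m R' i i \<le> 0" using neg val[of V' Z' R' P'] I by (auto simp: I_def)
    then show "Q V' Z' R' P' xs' ys'"
      using I c' square_exit[OF sq i] Q[of V' Z' c' R'] by (auto simp: I_def)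
  next
    have "entry m R i i \<le> S" using inv gram_diag_le i by (auto simp: square_inv_def)
    then have "entry m R i i < greedy_bound (k + 4)"
      using k by (simp add: eval_nat_numeral)
    then show "I (k + 4) V Z R P xs ys"
      using fr reg_c inv by (auto simp: I_def)
  qed simp
  then show ?thesis by (rule wp_weaken) auto
qed

text \<open>A row takes at most k columns for the reduction and \<open>k + 4\<close> for the
  squares.\<close>

lemma wp_elim:
  assumes vars: "V reg_m = int m" "V reg_c = int m" "V reg_W = w1\<^sup>2"
    and inv: "row_inv 0 (entry m R) (entry m Z) m"
    and k: "w1\<^sup>2 < 2 ^ 2 ^ k" "S < 4 * 2 ^ 2 ^ k" and b: "S < 2 ^ b"
    and B: "2 * S + 1 < B" "int (m * m) \<le> B" "int m \<le> B" "int (m + m * (2 * k + 4)) < B"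
    and Q: "\<And>V' Z' R' c. V' reg_m = int m \<Longrightarrow> V' reg_s = V reg_s \<Longrightarrow> V' reg_c = int c \<Longrightarrow>
      (\<forall>p<m. \<forall>j<m. entry m Z' p j = entry m Z p j) \<Longrightarrow>
      c \<le> m + m * (2 * k + 4) \<Longrightarrow> row_inv m (entry m R') (entry m Z') c \<Longrightarrow> Q V' Z' R' P xs ys"
  shows "wp B elim_com (m * ((2 * k + 4) * (4 * b + 3 * (m * m) + 3 * m + 12) + 5) + 2) Q V Z R P xs ys"
  unfolding elim_com_def
proof (rule wp_for[where n = m and k = "(2 * k + 4) * (4 * b + 3 * (m * m) + 3 * m + 12) + 3" and
    I = "\<lambda>i V' Z' R' P' xs' ys'. frame i V Z V' Z' \<and>
      (\<exists>c. V' reg_c = int c \<and> c \<le> m + i * (2 * k + 4) \<and> row_inv i (entry m R') (entry m Z') c) \<and>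
      P' = P \<and> xs' = xs \<and> ys' = ys"])
  fix i V' Z' R' P' xs' ys'
  assume i: "i < m" and "V' reg_i = int i"
    and "frame i V Z V' Z' \<and>
      (\<exists>c. V' reg_c = int c \<and> c \<le> m + i * (2 * k + 4) \<and> row_inv i (entry m R') (entry m Z') c) \<and>
      P' = P \<and> xs' = xs \<and> ys' = ys"
  then obtain c where fr: "frame i V Z V' Z'" and e: "P' = P" "xs' = xs" "ys' = ys"
    and c: "V' reg_c = int c" "c \<le> m + i * (2 * k + 4)" "row_inv i (entry m R') (entry m Z') c" by blast
  have "Suc i * (2 * k + 4) \<le> m * (2 * k + 4)" using i by (intro mult_le_mono1) simp
  then have ci: "c + k + k + 4 \<le> m + m * (2 * k + 4)" using c(2) by simp
  then have ciB: "int (c + k + k + 4) < B" using B(4) by linarith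
  have w1B: "w1\<^sup>2 \<le> B" using S_ge S_nonneg B by linarith
  have "wp B row_com (1 + ((k * (4 * b + 3 * (m * m) + 3 * m + 12) + 1) +
      ((k + 4) * (4 * b + 3 * (m * m) + 3 * m + 12) + 1)))
    (\<lambda>V' Z' R' P' xs' ys'. V' reg_i = int i \<and> (frame (Suc i) V Z (V'(reg_i := int (Suc i))) Z' \<and>
      (\<exists>c. (V'(reg_i := int (Suc i))) reg_c = int c \<and> c \<le> m + Suc i * (2 * k + 4) \<and>
        row_inv (Suc i) (entry m R') (entry m Z') c) \<and>
      P' = P \<and> xs' = xs \<and> ys' = ys)) V' Z' R' P' xs' ys'"
    unfolding row_com_def e
  proof (rule wp_seq, rule wp_set_scalar, goal_cases)
    case 3
    show ?case
    proof (rule wp_seq, rule wp_reduce_loop[where Vi = V and Zi = Z and c = c and k = k and b = b and i = i], goal_cases)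
      case (12 V1 Z1 R1 c1)
      note 1 = this
      show ?case
      proof (rule wp_square_loop[where Vi = V and Zi = Z and c = c1 and k = k and b = b and i = i], goal_cases)
        case (11 V2 Z2 R2 c2)
        then show ?case using c(2) 1(3) by (auto simp: frame_def intro!: exI[of _ c2])
      next
        case 9
        show ?case by (rule B(3))
      qed (use 1 i k b B ciB in auto)
    next
      case 10
      show ?case by (rule B(3))
    qed (use i fr c k b B ciB in \<open>auto simp: frame_def\<close>)
  qed (use fr w1B in \<open>auto simp: frame_def\<close>)
  then show "wp B row_com ((2 * k + 4) * (4 * b + 3 * (m * m) + 3 * m + 12) + 3)
    (\<lambda>V' Z' R' P' xs' ys'. V' reg_i = int i \<and> (frame (Suc i) V Z (V'(reg_i := int (Suc i))) Z' \<and>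
      (\<exists>c. (V'(reg_i := int (Suc i))) reg_c = int c \<and> c \<le> m + Suc i * (2 * k + 4) \<and>
        row_inv (Suc i) (entry m R') (entry m Z') c) \<and>
      P' = P \<and> xs' = xs \<and> ys' = ys)) V' Z' R' P' xs' ys'"
    by (rule wp_weaken) (auto simp: algebra_simps)
next
  fix V' Z' R' P' xs' ys'
  assume "V' reg_i = int m" and "frame m V Z V' Z' \<and>
      (\<exists>c. V' reg_c = int c \<and> c \<le> m + m * (2 * k + 4) \<and> row_inv m (entry m R') (entry m Z') c) \<and>
      P' = P \<and> xs' = xs \<and> ys' = ys"
  then show "Q V' Z' R' P' xs' ys'" using Q[of V'] by (auto simp: frame_def)
next
  show "int m \<le> B" by (rule B(3))
qed (use vars B inv in \<open>auto simp: frame_def\<close>)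

end

section \<open>Input, recursion, preparation of the elimination, and output\<close>

definition read_com :: com where
  "read_com = Seq (Read (Const (4 * reg_m))) (for_loop reg_x (Mul (scalar reg_m) (scalar reg_m))
     (Read (Add (Mul (Const 4) (scalar reg_x)) (Const 1))))"

text \<open>The order of the input is already the layout of Z: row p of G is column p of Z.\<close>

lemma wp_read_com:
  assumes B: "int m \<le> B" "int (m * m) \<le> B" and f: "\<And>x. x < m * m \<Longrightarrow> \<bar>f x\<bar> \<le> B"
    and Q: "Q (V(reg_m := int m, reg_x := int (m * m))) (fill 0 (m * m) f Z) R P [] ys"
  shows "wp B read_com (3 * (m * m) + 3) Q V Z R P (int m # map f [0..<m * m]) ys"
proof -
  have "wp B read_com (1 + (3 * (m * m) + 2)) Q V Z R P (int m # map f [0..<m * m]) ys"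
    unfolding read_com_def
  proof (rule wp_seq, rule wp_read_scalar, goal_cases)
    case 3
    show ?case
    proof (rule wp_for[where n = "m * m" and k = 1 and I = "\<lambda>j V' Z' R' P' xs' ys'.
        V' = V(reg_m := int m, reg_x := int j) \<and> Z' = fill 0 j f Z \<and> R' = R \<and> P' = P \<and>
        xs' = map f [j..<m * m] \<and> ys' = ys"], goal_cases)
      case (3 j V' Z' R' P' xs' ys')
      then have e: "V' = V(reg_m := int m, reg_x := int j)" "Z' = fill 0 j f Z" "R' = R" "P' = P"
        "xs' = f j # map f [Suc j..<m * m]" "ys' = ys" by (auto simp: upt_conv_Cons)
      show ?case unfolding e
        by (rule wp_read_z) (use f 3(1) in \<open>auto simp: fill_Suc fun_upd_twist\<close>)
    qed (use B Q in \<open>auto simp: fun_upd_twist\<close>)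
  qed (use B in auto)
  then show ?thesis by (rule wp_weaken) auto
qed

definition mul_com :: com where
  "mul_com = for_loop reg_x (Mul (scalar reg_m) (scalar reg_m))
     (Seq (sum_loop reg_acc reg_l (scalar reg_m)
       (Mul (arr_z (Add (Mul (Div (scalar reg_x) (scalar reg_m)) (scalar reg_m)) (scalar reg_l)))
            (arr_r (Add (Mul (scalar reg_l) (scalar reg_m)) (imod (scalar reg_x) (scalar reg_m))))))
     (set_p (scalar reg_x) (scalar reg_acc)))"

lemma wp_mul_com:
  assumes vars: "V reg_m = int m" and B: "int m \<le> B" "int (m * m) \<le> B"
    and bd: "\<And>i j t. i < m \<Longrightarrow> j < m \<Longrightarrow> t \<le> m \<Longrightarrow> \<bar>\<Sum>l<t. entry m Z i l * entry m R l j\<bar> \<le> B"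
    and Q: "\<And>V' P'. (\<And>y. y \<notin> {reg_x, reg_acc, reg_l} \<Longrightarrow> V' y = V y) \<Longrightarrow>
      (\<And>i j. i < m \<Longrightarrow> j < m \<Longrightarrow> entry m P' i j = (\<Sum>l<m. entry m Z i l * entry m R l j)) \<Longrightarrow>
      Q V' Z R P' xs ys"
  shows "wp B mul_com (m * m * (3 * m + 6) + 2) Q V Z R P xs ys"
  unfolding mul_com_def
proof (rule wp_for[where n = "m * m" and k = "3 * m + 3 + 1" and I = "\<lambda>x V' Z' R' P' xs' ys'.
    (\<forall>y. y \<notin> {reg_x, reg_acc, reg_l} \<longrightarrow> V' y = V y) \<and> Z' = Z \<and> R' = R \<and>
    P' = fill 0 x (\<lambda>x. \<Sum>l<m. entry m Z (x div m) l * entry m R l (x mod m)) P \<and>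
    xs' = xs \<and> ys' = ys"], goal_cases)
  case (3 x V' Z' R' P' xs' ys')
  let ?F = "\<lambda>x. \<Sum>l<m. entry m Z (x div m) l * entry m R l (x mod m)"
  have m: "m > 0" using 3(1) by (cases m) auto
  have x: "x div m < m" "x mod m < m" using 3(1) m by (auto simp: less_mult_imp_div_less)
  have fr: "V' y = V y" if "y \<notin> {reg_x, reg_acc, reg_l}" for y using 3 that by blast
  have reg_x: "V' reg_x = int x" by (rule 3)
  have reg_m: "V' reg_m = int m" using fr[of reg_m] vars by simp
  have e: "Z' = Z" "R' = R" "P' = fill 0 x ?F P" "xs' = xs" "ys' = ys" using 3 by auto
  show ?case unfolding e
  proof (rule wp_seq, rule wp_sum[where n = m and F = "\<lambda>l. entry m Z (x div m) l * entry m R l (x mod m)"], goal_cases)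
    case 8
    show ?case
      by (rule wp_set_p) (use reg_x fr bd[OF x, of m] in \<open>auto simp: fill_Suc\<close>)
  qed (use reg_m reg_x B bd[OF x] in \<open>auto simp: entry_def zdiv_int zmod_int\<close>)
next
  case (5 V' Z' R' P' xs' ys')
  then have e: "Z' = Z" "R' = R" "xs' = xs" "ys' = ys" by auto
  show ?case unfolding e
  proof (rule Q)
    show "entry m P' i j = (\<Sum>l<m. entry m Z i l * entry m R l j)" if "i < m" "j < m" for i j
      using entry_fill[OF that, of "\<lambda>i j. \<Sum>l<m. entry m Z i l * entry m R l j" P] 5 by simp
  qed (use 5 in auto)
qed (use vars B in auto)

abbreviation (input) "diag \<equiv> ind (Div (scalar reg_x) (scalar reg_m)) (imod (scalar reg_x) (scalar reg_m))"

lemma val_diag: "V reg_x = int x \<Longrightarrow> V reg_m = int m \<Longrightarrow>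
    val (mem V Z R P) diag = (if x div m = x mod m then 1 else 0)"
  by (auto simp: zdiv_int[symmetric] zmod_int[symmetric])

definition update_com :: com where
  "update_com = for_loop reg_x (Mul (scalar reg_m) (scalar reg_m)) (set_r (scalar reg_x)
     (Sub (Mul (Add (scalar reg_k) (Const 1)) (arr_p (scalar reg_x))) (Mul diag (scalar reg_t))))"

lemma wp_update_com:
  assumes vars: "V reg_m = int m" "V reg_k = int k" "V reg_t = t" and B: "int (m * m) \<le> B"
    and bd: "\<And>i j. i < m \<Longrightarrow> j < m \<Longrightarrow> \<bar>int (Suc k) * entry m P i j - (if i = j then t else 0)\<bar> \<le> B"
    and Q: "\<And>R'. (\<And>i j. i < m \<Longrightarrow> j < m \<Longrightarrow>
        entry m R' i j = int (Suc k) * entry m P i j - (if i = j then t else 0)) \<Longrightarrow>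
      Q (V(reg_x := int (m * m))) Z R' P xs ys"
  shows "wp B update_com (3 * (m * m) + 2) Q V Z R P xs ys"
  unfolding update_com_def
proof (rule wp_map_r[where F = "\<lambda>x. int (Suc k) * entry m P (x div m) (x mod m)
    - (if x div m = x mod m then t else 0)"], goal_cases)
  case (5 x R')
  then show ?case using vars
    by (simp add: val_diag[where x = x and m = m] entry_def add.commute del: val_ind)
next
  case (6 x)
  then have "m > 0" by (cases m) auto
  then show ?case using bd[of "x div m" "x mod m"] 6 by (simp add: less_mult_imp_div_less)
next
  case 7
  show ?case
    by (rule Q) (rule entry_fill[where F = "\<lambda>i j. int (Suc k) * entry m P i j - (if i = j then t else 0)"])
qed (use vars B in auto)

definition fad_com :: com where
  "fad_com = Seq (for_loop reg_x (Mul (scalar reg_m) (scalar reg_m)) (set_r (scalar reg_x) diag))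
     (Seq (set_scalar reg_t (Const 1)) (for_loop reg_k (scalar reg_m)
       (Seq mul_com (Seq (sum_loop reg_t reg_l (scalar reg_m) (arr_p (Add (Mul (scalar reg_l) (scalar reg_m)) (scalar reg_l)))) update_com))))"

lemma abs_sum_le:
  fixes f :: "nat \<Rightarrow> int"
  assumes "\<And>l. l < t \<Longrightarrow> \<bar>f l\<bar> \<le> b" "t \<le> m" "0 \<le> b"
  shows "\<bar>\<Sum>l<t. f l\<bar> \<le> int m * b"
proof -
  have "\<bar>\<Sum>l<t. f l\<bar> \<le> (\<Sum>l<t. \<bar>f l\<bar>)" by (rule sum_abs)
  also have "\<dots> \<le> (\<Sum>l<t. b)" using assms by (intro sum_mono) auto
  also have "\<dots> \<le> int m * b" using assms by (simp add: mult_right_mono)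
  finally show ?thesis .
qed

text \<open>Round k leaves \<open>fad_trace m g k\<close> in \<open>reg_t\<close>, so the last round
  leaves the required scalar; for \<open>m = 0\<close> the initial 1 remains. Both terms of the
  recursion are at most \<open>m * (m * (A * X))\<close>, since \<open>Suc k \<le> m\<close>, whence
  the factor 2 in the bound.\<close>

lemma wp_fad_com:
  assumes vars: "V reg_m = int m" and Z: "\<And>i j. i < m \<Longrightarrow> j < m \<Longrightarrow> entry m Z i j = g i j"
    and A: "\<And>i j. i < m \<Longrightarrow> j < m \<Longrightarrow> \<bar>g i j\<bar> \<le> A" "0 \<le> A"
    and X: "\<And>k i j. k < m \<Longrightarrow> i < m \<Longrightarrow> j < m \<Longrightarrow> \<bar>fad m g k i j\<bar> \<le> X" "0 \<le> X"
    and B: "int m \<le> B" "int (m * m) \<le> B" "1 \<le> B" "2 * (int m * (int m * (A * X))) \<le> B"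
    and Q: "\<And>V' R' P'. V' reg_m = int m \<Longrightarrow>
      V' reg_t = (if m = 0 then 1 else fad_trace m g (m - 1)) \<Longrightarrow> Q V' Z R' P' xs ys"
  shows "wp B fad_com (m * (m * m * (3 * m + 9) + 3 * m + 9) + 3 * (m * m) + 5) Q V Z R P xs ys"
proof -
  let ?Y = "int m * (A * X)"
  have AX: "0 \<le> A * X" "0 \<le> ?Y" "0 \<le> int m * ?Y" using A X by simp_all
  have "wp B fad_com ((3 * (m * m) + 2) + (1 + (m * (((m * m * (3 * m + 6) + 2) + ((3 * m + 3) + (3 * (m * m) + 2))) + 2) + 2))) Q V Z R P xs ys"
    unfolding fad_com_def
  proof (rule wp_seq, rule wp_map_r[where F = "\<lambda>x. if x div m = x mod m then 1 else 0"], goal_cases)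
    case (5 x R')
    then show ?case by (intro val_diag) (auto simp: vars)
  next
    case 7
    let ?R = "fill 0 (m * m) (\<lambda>x. if x div m = x mod m then 1 else 0) R"
    have R: "entry m ?R i j = fad m g 0 i j" if "i < m" "j < m" for i j
      using entry_fill[OF that, of "\<lambda>i j. if i = j then 1 else 0"] by simp
    show ?case
    proof (rule wp_seq, rule wp_set_scalar, goal_cases)
      case 3
      show ?case
      proof (rule wp_for[where n = m and k = "(m * m * (3 * m + 6) + 2) + ((3 * m + 3) + (3 * (m * m) + 2))"
            and I = "\<lambda>k V' Z' R' P' xs' ys'. V' reg_m = int m \<and>
          V' reg_t = (if k = 0 then 1 else fad_trace m g (k - 1)) \<and> Z' = Z \<and>
          (\<forall>i<m. \<forall>j<m. entry m R' i j = fad m g k i j) \<and> xs' = xs \<and> ys' = ys"], goal_cases)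
        case (3 k V' Z' R' P' xs' ys')
        then have e: "Z' = Z" "xs' = xs" "ys' = ys" and reg_k: "V' reg_k = int k" and reg_m: "V' reg_m = int m"
          and R': "\<And>i j. i < m \<Longrightarrow> j < m \<Longrightarrow> entry m R' i j = fad m g k i j" and k: "k < m" by auto
        define pr where "pr = (\<lambda>i j. \<Sum>l<m. g i l * fad m g k l j)"
        have pr: "\<bar>\<Sum>l<t. g i l * fad m g k l j\<bar> \<le> ?Y" if "i < m" "j < m" "t \<le> m" for i j t
          using that A X k AX by (intro abs_sum_le) (auto simp: abs_mult intro!: mult_mono)
        have tr: "\<bar>\<Sum>i<t. pr i i\<bar> \<le> int m * ?Y" if "t \<le> m" for t
          using that pr AX by (intro abs_sum_le) (auto simp: pr_def)
        have "1 * ?Y \<le> int m * ?Y" using k AX by (intro mult_right_mono) auto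
        then have YB: "?Y \<le> B" "int m * ?Y \<le> B" using B(4) AX by linarith+
        show ?case unfolding e
        proof (rule wp_seq, rule wp_mul_com[where m = m], goal_cases)
          case (4 i j t)
          have "(\<Sum>l<t. entry m Z i l * entry m R' l j) = (\<Sum>l<t. g i l * fad m g k l j)"
            using 4 by (intro sum.cong) (auto simp: Z R')
          then show ?case using pr[OF 4] YB by simp
        next
          case (5 V1 P1)
          have V1: "V1 reg_m = int m" "V1 reg_k = int k" using 5(1)[of reg_m] 5(1)[of reg_k] reg_m reg_k by auto
          have P1: "entry m P1 i j = pr i j" if "i < m" "j < m" for i j
            using 5(2)[OF that] that unfolding pr_def
            by simp (intro sum.cong, auto simp: Z R')
          show ?case
          proof (rule wp_seq, rule wp_sum[where n = m and F = "\<lambda>i. pr i i"], goal_cases)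
            case (6 j a)
            then show ?case using V1 P1[of j j] by (simp add: entry_def)
          next
            case (7 j)
            then show ?case using tr[of j] YB by linarith
          next
            case 8
            show ?case
            proof (rule wp_update_com[where m = m and k = k and t = "\<Sum>i<m. pr i i"], goal_cases)
              case (5 i j)
              have "\<bar>int (Suc k) * pr i j\<bar> \<le> int m * ?Y"
                unfolding abs_mult using k pr[OF 5, of m] by (intro mult_mono) (auto simp: pr_def)
              then show ?case using tr[of m] P1[OF 5] B(4) by auto
            next
              case (6 R2)
              have "entry m R2 i j = fad m g (Suc k) i j" if "i < m" "j < m" for i j
                using 6[OF that] P1[OF that] by (simp add: pr_def)
              then show ?case using V1 by (auto simp: fad_trace_def pr_def)
            qed (use V1 B in auto)
          qed (use V1 B in auto)
        qed (use reg_m B in auto)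
      next
        case (5 V' Z' R' P' xs' ys')
        then show ?case using Q[of V' R' P'] by auto
      qed (use vars B R in auto)
    qed (use B in auto)
  qed (use vars B in auto)
  then show ?thesis by (rule wp_weaken) (auto simp: algebra_simps)
qed

text \<open>The last loop runs over \<open>reg_c\<close>, so \<open>sub_column\<close> subtracts the
  columns of \<open>G\<^sup>T\<close> one after the other, and \<open>reg_c\<close> ends at m, the
  index of the first column to be appended.\<close>

definition prep_com :: com where
  "prep_com = Seq (sum_loop reg_acc reg_x (Mul (scalar reg_m) (scalar reg_m)) (Mul (arr_z (scalar reg_x)) (arr_z (scalar reg_x))))
    (Seq (set_scalar reg_w (Add (scalar reg_acc) (Mul (Add (Mul (Const 20) (scalar reg_m)) (Const 1)) (Add (Mul (Const 20) (scalar reg_m)) (Const 1)))))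
    (Seq (set_scalar reg_W (Mul (scalar reg_w) (scalar reg_w)))
    (Seq (set_scalar reg_s (Mul (Mul (Const 2) (Mul (scalar reg_t) (scalar reg_t))) (scalar reg_W)))
    (Seq (for_loop reg_x (Mul (scalar reg_m) (scalar reg_m)) (set_r (scalar reg_x) (Mul diag (Mul (Const 2) (scalar reg_s)))))
      (for_loop reg_c (scalar reg_m) sub_column)))))"

lemma sum_div_mod:
  fixes f :: "nat \<Rightarrow> nat \<Rightarrow> 'a::comm_monoid_add"
  assumes "m > 0"
  shows "(\<Sum>x<n * m. f (x div m) (x mod m)) = (\<Sum>p<n. \<Sum>q<m. f p q)"
proof -
  have "(\<Sum>q=p * m..<p * m + m. f (q div m) (q mod m)) = (\<Sum>q<m. f p q)" for p
  proof -
    have "(\<Sum>q=p * m..<p * m + m. f (q div m) (q mod m)) = (\<Sum>q=0..<m. f ((q + p * m) div m) ((q + p * m) mod m))"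
      using sum.shift_bounds_nat_ivl[of "\<lambda>q. f (q div m) (q mod m)" 0 "p * m" m] by (simp add: add.commute)
    then show ?thesis using assms by (simp add: atLeast0LessThan)
  qed
  then show ?thesis using sum.nat_group[of "\<lambda>x. f (x div m) (x mod m)" m n] by simp
qed

lemma abs_mult_le_squares: "\<bar>a * b\<bar> \<le> a * a + b * b" for a b :: int
proof -
  have "0 \<le> (\<bar>a\<bar> - \<bar>b\<bar>)\<^sup>2" by simp
  then have "2 * (\<bar>a\<bar> * \<bar>b\<bar>) \<le> a * a + b * b" by (simp add: power2_eq_square algebra_simps flip: abs_mult)
  moreover have "0 \<le> \<bar>a\<bar> * \<bar>b\<bar>" by simp
  ultimately show ?thesis unfolding abs_mult by linarith
qed

text \<open>In each summand \<open>\<bar>x * y\<bar> \<le> x * x + y * y\<close>, and for distinct j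
  and l both squares occur in the sum over q. Partial sums are included because the program passes
  through them.\<close>

lemma gram_entry_le:
  fixes z :: "nat \<Rightarrow> nat \<Rightarrow> int"
  assumes "j < m" "l < m" "t \<le> n"
  shows "\<bar>\<Sum>p<t. z p j * z p l\<bar> \<le> (\<Sum>p<n. \<Sum>q<m. z p q * z p q)"
proof -
  have 1: "\<bar>z p j * z p l\<bar> \<le> (\<Sum>q<m. z p q * z p q)" for p
  proof (cases "j = l")
    case True
    then show ?thesis using assms member_le_sum[of j "{..<m}" "\<lambda>q. z p q * z p q"] by simp
  next
    case False
    then have "z p j * z p j + z p l * z p l = (\<Sum>q\<in>{j, l}. z p q * z p q)" by simp
    also have "\<dots> \<le> (\<Sum>q<m. z p q * z p q)" using assms by (intro sum_mono2) auto
    finally show ?thesis using abs_mult_le_squares[of "z p j" "z p l"] by linarith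
  qed
  have "\<bar>\<Sum>p<t. z p j * z p l\<bar> \<le> (\<Sum>p<t. \<bar>z p j * z p l\<bar>)" by (rule sum_abs)
  also have "\<dots> \<le> (\<Sum>p<t. \<Sum>q<m. z p q * z p q)" using 1 by (intro sum_mono) auto
  also have "\<dots> \<le> (\<Sum>p<n. \<Sum>q<m. z p q * z p q)" using assms by (intro sum_mono2) (auto intro!: sum_nonneg)
  finally show ?thesis .
qed

lemma wp_prep_com:
  assumes vars: "V reg_m = int m" "V reg_t = d" and Z: "\<And>i j. i < m \<Longrightarrow> j < m \<Longrightarrow> entry m Z i j = g i j"
    and e0: "e0 = (\<Sum>p<m. \<Sum>q<m. g p q * g p q)"
    and w1: "w1 = e0 + (20 * int m + 1)\<^sup>2" and s: "s = 2 * d\<^sup>2 * w1\<^sup>2"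
    and B: "int m \<le> B" "int (m * m) \<le> B" "e0 + w1 + w1\<^sup>2 + 2 * s \<le> B"
    and Q: "\<And>V' R'. V' reg_m = int m \<Longrightarrow> V' reg_c = int m \<Longrightarrow> V' reg_W = w1\<^sup>2 \<Longrightarrow> V' reg_s = s \<Longrightarrow>
      (\<And>j l. j < m \<Longrightarrow> l < m \<Longrightarrow> entry m R' j l = (if j = l then 2 * s else 0) - (\<Sum>p<m. g p j * g p l)) \<Longrightarrow>
      Q V' Z R' P xs ys"
  shows "wp B prep_com (6 * (m * m) + m * (3 * (m * m) + 4) + 10) Q V Z R P xs ys"
proof -
  have nn: "0 \<le> e0" "0 \<le> w1" "0 \<le> w1\<^sup>2" "0 \<le> s" by (auto simp: e0 w1 s intro!: sum_nonneg add_nonneg_nonneg)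
  let ?F = "\<lambda>x. entry m Z (x div m) (x mod m) * entry m Z (x div m) (x mod m)"
  have sumF: "(\<Sum>x<m * m. ?F x) = e0"
  proof (cases "m = 0")
    case False
    then have "(\<Sum>x<m * m. ?F x) = (\<Sum>p<m. \<Sum>q<m. entry m Z p q * entry m Z p q)"
      using sum_div_mod[of m "\<lambda>i j. entry m Z i j * entry m Z i j" m] by simp
    also have "\<dots> = e0" unfolding e0 using Z by (intro sum.cong) auto
    finally show ?thesis .
  qed (simp add: e0)
  have pF: "\<bar>\<Sum>x<t. ?F x\<bar> \<le> e0" if "t \<le> m * m" for t
  proof -
    have "(\<Sum>x<t. ?F x) \<le> (\<Sum>x<m * m. ?F x)" using that by (intro sum_mono2) auto
    moreover have "0 \<le> (\<Sum>x<t. ?F x)" by (intro sum_nonneg) auto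
    ultimately show ?thesis using sumF by simp
  qed
  have "wp B prep_com ((3 * (m * m) + 3) + (1 + (1 + (1 + ((3 * (m * m) + 2) + (m * ((3 * (m * m) + 2) + 2) + 2)))))) Q V Z R P xs ys"
    unfolding prep_com_def
  proof (rule wp_seq, rule wp_sum[where n = "m * m" and F = ?F], goal_cases)
    case (7 t)
    then show ?case using pF[of t] nn B by linarith
  next
    case 8
    define V1 where "V1 = V(reg_acc := \<Sum>x<m * m. ?F x, reg_x := int (m * m), reg_w := w1)"
    define V2 where "V2 = V1(reg_W := w1\<^sup>2)"
    define V3 where "V3 = V2(reg_s := s)"
    have w1': "val (mem (V(reg_acc := \<Sum>x<m * m. ?F x, reg_x := int (m * m))) Z R P)
      (Add (scalar reg_acc) (Mul (Add (Mul (Const 20) (scalar reg_m)) (Const 1)) (Add (Mul (Const 20) (scalar reg_m)) (Const 1)))) = w1"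
      using sumF by (simp add: vars w1 power2_eq_square)
    show ?case
    proof (rule wp_seq, rule wp_set_scalar, goal_cases)
      case 2
      show ?case unfolding w1' using nn B by linarith
    next
      case 3
      show ?case unfolding w1' V1_def[symmetric]
      proof (rule wp_seq, rule wp_set_scalar, goal_cases)
        case 2
        then show ?case using nn B by (simp add: V1_def power2_eq_square)
      next
        case 3
        have v2: "V1(reg_W := val (mem V1 Z R P) (Mul (scalar reg_w) (scalar reg_w))) = V2"
          by (simp add: V2_def V1_def power2_eq_square)
        show ?case unfolding v2
        proof (rule wp_seq, rule wp_set_scalar, goal_cases)
          case 2
          have "val (mem V2 Z R P) (Mul (Mul (Const 2) (Mul (scalar reg_t) (scalar reg_t))) (scalar reg_W)) = s"
            by (simp add: V2_def V1_def vars s power2_eq_square)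
          then show ?case using nn B by linarith
        next
          case 3
          have v3: "V2(reg_s := val (mem V2 Z R P) (Mul (Mul (Const 2) (Mul (scalar reg_t) (scalar reg_t))) (scalar reg_W))) = V3"
            by (simp add: V3_def V2_def V1_def vars s power2_eq_square)
          have V3: "V3 reg_m = int m" "V3 reg_s = s" "V3 reg_W = w1\<^sup>2" by (simp_all add: V3_def V2_def V1_def vars)
          show ?case unfolding v3
          proof (rule wp_seq, rule wp_map_r[where F = "\<lambda>x. if x div m = x mod m then 2 * s else 0"], goal_cases)
            case (5 x R')
            then show ?case using V3 by (simp add: val_diag[where x = x and m = m] del: val_ind)
          next
            case 7
            let ?R = "fill 0 (m * m) (\<lambda>x. if x div m = x mod m then 2 * s else 0) R"
            have R: "entry m ?R i j = (if i = j then 2 * s else 0)" if "i < m" "j < m" for i j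
              using entry_fill[OF that, of "\<lambda>i j. if i = j then 2 * s else 0"] by simp
            show ?case
            proof (rule wp_for[where n = m and k = "3 * (m * m) + 2" and I = "\<lambda>c V' Z' R' P' xs' ys'.
                V' reg_m = int m \<and> V' reg_s = s \<and> V' reg_W = w1\<^sup>2 \<and> Z' = Z \<and> P' = P \<and> xs' = xs \<and> ys' = ys \<and>
                (\<forall>j<m. \<forall>l<m. entry m R' j l = (if j = l then 2 * s else 0) - (\<Sum>p<c. g p j * g p l))"], goal_cases)
              case (3 c V' Z' R' P' xs' ys')
              then have e: "Z' = Z" "P' = P" "xs' = xs" "ys' = ys"
                and R': "\<And>j l. j < m \<Longrightarrow> l < m \<Longrightarrow> entry m R' j l = (if j = l then 2 * s else 0) - (\<Sum>p<c. g p j * g p l)"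
                by auto
              have new: "entry m R' j l - entry m Z c j * entry m Z c l
                = (if j = l then 2 * s else 0) - (\<Sum>p<Suc c. g p j * g p l)" if "j < m" "l < m" for j l
                using R'[OF that] that 3(1) by (simp add: Z)
              show ?case unfolding e
              proof (rule wp_sub_column[where m = m and c = c], goal_cases)
                case (4 j l)
                have "\<bar>\<Sum>p<Suc c. g p j * g p l\<bar> \<le> e0"
                  unfolding e0 using 3(1) by (intro gram_entry_le[OF 4]) simp
                moreover have "\<bar>(if b then 2 * s else 0) - x\<bar> \<le> B" if "\<bar>x\<bar> \<le> e0" for x b
                  using that nn B(3) by (cases b; simp only: if_True if_False; linarith)
                ultimately show ?case unfolding new[OF 4] by blast
              next
                case (5 R'')
                then show ?case using 3 new by auto
              qed (use 3 B in auto)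
            next
              case (5 V' Z' R' P' xs' ys')
              then have e: "Z' = Z" "P' = P" "xs' = xs" "ys' = ys" by auto
              show ?case unfolding e by (rule Q) (use 5 in auto)
            qed (use V3 B R in auto)
          next
            case 6
            have "2 * s \<le> B" using nn B by linarith
            then show ?case using nn(4) by auto
          qed (use V3 B in auto)
        qed simp
      qed simp
    qed simp
  qed (use vars B in \<open>auto simp: entry_def\<close>)
  then show ?thesis by (rule wp_weaken) (auto simp: algebra_simps)
qed

definition out_com :: com where
  "out_com = Seq (Write (scalar reg_c)) (Seq (Write (scalar reg_s)) (for_loop reg_x (Mul (scalar reg_c) (scalar reg_c))
     (Seq (sum_loop reg_acc reg_l (scalar reg_m)
       (Mul (arr_z (Add (Mul (Div (scalar reg_x) (scalar reg_c)) (scalar reg_m)) (scalar reg_l)))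
            (arr_z (Add (Mul (imod (scalar reg_x) (scalar reg_c)) (scalar reg_m)) (scalar reg_l)))))
     (Seq (Write (Sub (Mul (ind (Div (scalar reg_x) (scalar reg_c)) (imod (scalar reg_x) (scalar reg_c))) (scalar reg_s)) (scalar reg_acc)))
       (Write (scalar reg_s))))))"

lemma wp_out_com:
  assumes vars: "V reg_m = int m" "V reg_c = int c" "V reg_s = s"
    and B: "int m \<le> B" "int (c * c) \<le> B"
    and bd: "\<And>p q t. p < c \<Longrightarrow> q < c \<Longrightarrow> t \<le> m \<Longrightarrow> \<bar>\<Sum>r<t. entry m Z p r * entry m Z q r\<bar> \<le> B"
    and Q: "\<And>V'. Q V' Z R P xs (ys @ [int c, s] @ concat (map (\<lambda>x. [(if x div c = x mod c then s else 0)
        - (\<Sum>r<m. entry m Z (x div c) r * entry m Z (x mod c) r), s]) [0..<c * c]))"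
  shows "wp B out_com (c * c * (3 * m + 7) + 4) Q V Z R P xs ys"
proof -
  let ?f = "\<lambda>x. (if x div c = x mod c then s else 0) - (\<Sum>r<m. entry m Z (x div c) r * entry m Z (x mod c) r)"
  have "wp B out_com (1 + (1 + (c * c * (((3 * m + 3) + (1 + 1)) + 2) + 2))) Q V Z R P xs ys"
    unfolding out_com_def
  proof (rule wp_seq, rule wp_write, goal_cases)
    case 2
    show ?case
    proof (rule wp_seq, rule wp_write, goal_cases)
      case 2
      show ?case
      proof (rule wp_for[where n = "c * c" and k = "(3 * m + 3) + (1 + 1)" and I = "\<lambda>x V' Z' R' P' xs' ys'.
          V' reg_m = int m \<and> V' reg_c = int c \<and> V' reg_s = s \<and> Z' = Z \<and> R' = R \<and> P' = P \<and> xs' = xs \<and>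
          ys' = ys @ [int c, s] @ concat (map (\<lambda>x. [?f x, s]) [0..<x])"], goal_cases)
        case (3 x V' Z' R' P' xs' ys')
        then have c: "c > 0" by (cases c) auto
        have x: "x div c < c" "x mod c < c" using 3(1) c by (auto simp: less_mult_imp_div_less)
        from 3 have e: "Z' = Z" "R' = R" "P' = P" "xs' = xs"
          "ys' = ys @ [int c, s] @ concat (map (\<lambda>x. [?f x, s]) [0..<x])" by auto
        have v: "V' reg_m = int m" "V' reg_c = int c" "V' reg_s = s" "V' reg_x = int x" using 3 by auto
        show ?case unfolding e
        proof (rule wp_seq, rule wp_sum[where n = m and F = "\<lambda>r. entry m Z (x div c) r * entry m Z (x mod c) r"], goal_cases)
          case 8
          show ?case
            by (rule wp_seq, rule wp_write, simp, rule wp_write)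
              (use v in \<open>auto simp: zdiv_int[symmetric] zmod_int[symmetric]\<close>)
        qed (use v B bd[OF x] in \<open>auto simp: entry_def zdiv_int zmod_int\<close>)
      next
        case (5 V' Z' R' P' xs' ys')
        then have e: "Z' = Z" "R' = R" "P' = P" "xs' = xs"
          "ys' = ys @ [int c, s] @ concat (map (\<lambda>x. [?f x, s]) [0..<c * c])" by auto
        show ?case unfolding e by (rule Q)
      qed (use vars B in auto)
    qed simp
  qed simp
  then show ?thesis by (rule wp_weaken) auto
qed

section \<open>Size bounds\<close>


text \<open>If Y bounds the k-th matrix, the entries of its product with a are at most
  \<open>m * A * Y\<close>. The multiplier \<open>Suc k \<le> m\<close> and the sum of the m
  diagonal entries each give another factor m, so every round costs a factor of at most
  \<open>2 * m * m * A\<close>.\<close>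

lemma fad_bound:
  assumes A: "\<And>i j. i < m \<Longrightarrow> j < m \<Longrightarrow> \<bar>a i j\<bar> \<le> A" and m: "0 < m" and k: "k \<le> m" and "i < m" "j < m"
  shows "\<bar>fad m a k i j\<bar> \<le> (2 * int m * int m * A) ^ k"
  using k assms(4,5)
proof (induction k arbitrary: i j)
  case (Suc k)
  define Y where "Y = (2 * int m * int m * A) ^ k"
  have A0: "0 \<le> A" using A[OF m m] by linarith
  then have Y0: "0 \<le> Y" by (simp add: Y_def)
  have term_le: "\<bar>\<Sum>l<m. a i l * fad m a k l j\<bar> \<le> int m * (A * Y)" if "i < m" "j < m" for i j
    using Suc that A A0 Y0 unfolding Y_def
    by (intro abs_sum_le) (auto simp: abs_mult intro!: mult_mono)
  have AY: "0 \<le> int m * (A * Y)" using A0 Y0 by simp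
  have trace_le: "\<bar>\<Sum>i<m. \<Sum>l<m. a i l * fad m a k l i\<bar> \<le> int m * (int m * (A * Y))"
    by (rule abs_sum_le[OF _ le_refl AY]) (rule term_le)
  have "\<bar>int (Suc k) * (\<Sum>l<m. a i l * fad m a k l j)\<bar> \<le> int m * (int m * (A * Y))"
    unfolding abs_mult using term_le[OF Suc.prems(2,3)] Suc.prems by (intro mult_mono) auto
  then have "\<bar>fad m a (Suc k) i j\<bar> \<le> int m * (int m * (A * Y)) + int m * (int m * (A * Y))"
    using trace_le mult_nonneg_nonneg[OF of_nat_0_le_iff AY, of m] unfolding fad.simps
    by (simp only: split: if_split) linarith
  also have "\<dots> = (2 * int m * int m * A) ^ Suc k" by (simp add: Y_def)
  finally show ?case .
qed simp

lemma concat_map_upt: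
  "concat (map (\<lambda>i. map (\<lambda>j. f i j) [0..<m]) [0..<n]) = map (\<lambda>x. f (x div m) (x mod m)) [0..<n * m]"
proof (cases "m = 0")
  case False
  show ?thesis
  proof (induction n)
    case (Suc n)
    have "[n * m..<n * m + m] = map (\<lambda>j. n * m + j) [0..<m]" by (simp add: map_add_upt add.commute)
    then have "map (\<lambda>x. f (x div m) (x mod m)) [n * m..<n * m + m] = map (\<lambda>j. f n j) [0..<m]"
      using False by (simp add: o_def)
    then show ?case using Suc upt_add_eq_append[of 0 "n * m" m] by (simp add: add.commute)
  qed simp
qed simp

lemma enc_mat_eq:
  assumes "G \<in> carrier_mat m m"
  shows "enc_mat G = int m # map (\<lambda>x. G $$ (x div m, x mod m)) [0..<m * m]"
proof -
  have "map list_of_vec (rows G) = map (\<lambda>i. map (\<lambda>j. G $$ (i, j)) [0..<m]) [0..<m]"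
    using assms by (auto simp: rows_def list_of_vec_map intro!: map_cong)
  then show ?thesis using assms concat_map_upt[of "\<lambda>i j. G $$ (i, j)" m m] by (simp add: enc_mat_def)
qed

lemma enc_mat_size:
  assumes "G \<in> carrier_mat m m"
  shows "(\<Sum>a\<leftarrow>enc_mat G. int_size a) = int_size (int m) + mat_size G"
proof (cases "m = 0")
  case False
  have "(\<Sum>x\<leftarrow>[0..<m * m]. int_size (G $$ (x div m, x mod m))) = mat_size G"
    using assms sum_div_mod[of m "\<lambda>i j. int_size (G $$ (i, j))" m] False
    by (simp add: mat_size_def interv_sum_list_conv_sum_set_nat atLeast0LessThan)
  then show ?thesis by (simp add: enc_mat_eq[OF assms] o_def)
qed (use assms in \<open>simp add: enc_mat_eq[OF assms] mat_size_def\<close>)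

definition main_com :: com where
  "main_com = Seq read_com (Seq fad_com (Seq prep_com (Seq elim_com out_com)))"

lemma pow2_mult:
  fixes a c :: int
  assumes "\<bar>a\<bar> \<le> 2 ^ x" "\<bar>c\<bar> \<le> 2 ^ y"
  shows "\<bar>a * c\<bar> \<le> 2 ^ (x + y)"
  unfolding abs_mult power_add using assms by (intro mult_mono) auto

lemma pow2_weaken: "a \<le> (2::int) ^ x \<Longrightarrow> x \<le> y \<Longrightarrow> a \<le> 2 ^ y"
  by (meson order_trans one_le_numeral power_increasing)

lemma pow2_double: "a \<le> (2::int) ^ x \<Longrightarrow> 2 * a \<le> 2 ^ Suc x"
  by simp

lemma pow2_quadruple: "4 * (2::int) ^ x = 2 ^ (x + 2)"
  by (simp add: power_add)

locale lattice_input =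
  fixes m :: nat and G :: "int mat"
  assumes G: "G \<in> carrier_mat m m" and rank: "real_rank G = m"
begin

definition g :: "nat \<Rightarrow> nat \<Rightarrow> int" where "g i j = G $$ (i, j)"
text \<open>By \<open>enc_mat_size\<close> this is the size of the encoded input, the argument of
  the polynomial time bound.\<close>

definition N :: nat where "N = int_size (int m) + mat_size G"
definition d :: int where "d = (if m = 0 then 1 else fad_trace m g (m - 1))"
definition e0 :: int where "e0 = (\<Sum>p<m. \<Sum>q<m. g p q * g p q)"
definition w1 :: int where "w1 = e0 + (20 * int m + 1)\<^sup>2"
text \<open>A multiple of d, positive whatever the sign of d, and with
  \<open>2 * s \<ge> 4 * w1\<^sup>2\<close> because d is a nonzero integer.\<close>

definition s :: int where "s = 2 * d\<^sup>2 * w1\<^sup>2"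
text \<open>Bounds the bit-length of \<open>2 * s\<close> in terms of N alone; \<open>s_pow\<close>
  gives the exponent 45 for s.\<close>

definition b :: nat where "b = 48 * (N * N) + 1"
text \<open>The least choice keeps \<open>2 ^ k\<close> below \<open>2 * b\<close>, so that k is
  logarithmic in N; the bound on n depends on this.\<close>

definition k :: nat where "k = (LEAST k. b \<le> 2 ^ k)"
text \<open>Generous for everything held in memory: in multiples of \<open>N * N\<close>, the
  residual matrix needs an exponent of about 48, the output sums likewise 48, and the counter of the
  output loop 20.\<close>

definition B :: int where "B = 2 ^ (100 * (N * N))"

lemma injective:
  assumes "\<And>i. i < m \<Longrightarrow> (\<Sum>l<m. g i l * x l) = 0" "i < m"
  shows "x i = 0"
proof -
  let ?A = "map_mat real_of_int G"
  let ?v = "vec m (\<lambda>l. real_of_int (x l))"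
  have A: "?A \<in> carrier_mat m m" using G by simp
  have "vec_space.rank m ?A = m" using rank G by (simp add: real_rank_def)
  then have "det ?A \<noteq> 0" unfolding vec_space.det_rank_iff[OF A] .
  moreover have "?A *\<^sub>v ?v = 0\<^sub>v m"
  proof (rule eq_vecI)
    fix j assume j: "j < dim_vec (0\<^sub>v m :: real vec)"
    then have "(?A *\<^sub>v ?v) $ j = real_of_int (\<Sum>l<m. g j l * x l)"
      using G by (simp add: scalar_prod_def g_def atLeast0LessThan)
    moreover have "(\<Sum>l<m. g j l * x l) = 0" using assms(1) j by simp
    ultimately show "(?A *\<^sub>v ?v) $ j = 0\<^sub>v m $ j" using j by (simp del: of_int_sum of_int_mult)
  qed (use G in auto)
  ultimately have "?v = 0\<^sub>v m"
    using det_0_iff_vec_prod_zero_field[OF A] vec_carrier[of m "\<lambda>l. real_of_int (x l)"] by metis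
  then have "?v $ i = (0\<^sub>v m :: real vec) $ i" by simp
  then show ?thesis using assms(2) by simp
qed

lemma d_nonzero: "d \<noteq> 0"
proof (cases "m = 0")
  case False
  have "fad_trace m g (m - 1) \<noteq> 0"
    by (rule fad_trace_nonzero) (use False in \<open>auto intro: injective\<close>)
  then show ?thesis using False by (simp add: d_def)
next
  case True
  then show ?thesis unfolding d_def by simp
qed

section \<open>Exponents of the numbers that occur\<close>

lemma entry_pos: "1 \<le> int_size a"
  by (simp add: int_size_def)

lemma entry_size: "i < m \<Longrightarrow> j < m \<Longrightarrow> int_size (g i j) \<le> mat_size G"
proof -
  assume "i < m" "j < m"
  then have "int_size (g i j) \<le> (\<Sum>j<m. int_size (G $$ (i, j)))"
    unfolding g_def by (intro member_le_sum) auto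
  also have "\<dots> \<le> (\<Sum>i<m. \<Sum>j<m. int_size (G $$ (i, j)))"
    using \<open>i < m\<close> by (intro member_le_sum[of i "{..<m}" "\<lambda>i. \<Sum>j<m. int_size (G $$ (i, j))"]) auto
  finally show ?thesis using G by (simp add: mat_size_def)
qed

lemma m_sq_le: "m * m \<le> mat_size G"
proof -
  have "(\<Sum>i<m. \<Sum>j<m. 1) \<le> (\<Sum>i<m. \<Sum>j<m. int_size (G $$ (i, j)))"
    by (intro sum_mono entry_pos)
  then show ?thesis using G by (simp add: mat_size_def)
qed

lemma N_facts: "1 \<le> N" "m \<le> N" "m * m \<le> N" "N \<le> N * N" "1 \<le> N * N"
proof -
  show 1: "1 \<le> N" using entry_pos[of "int m"] by (simp add: N_def)
  show 2: "m * m \<le> N" using m_sq_le by (simp add: N_def)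
  show "m \<le> N" by (rule order_trans[OF le_square 2])
  show 3: "N \<le> N * N" by (rule le_square)
  show "1 \<le> N * N" by (rule order_trans[OF 1 3])
qed

lemma N_pow: "int N \<le> 2 ^ N"
proof -
  have "int N < int (2 ^ N)" using less_exp[of N] by (subst of_nat_less_iff)
  then show ?thesis by simp
qed

lemma m_pow: "\<bar>int m\<bar> \<le> 2 ^ N"
  using N_pow N_facts by linarith

lemma g_pow: "i < m \<Longrightarrow> j < m \<Longrightarrow> \<bar>g i j\<bar> \<le> 2 ^ N"
proof -
  assume "i < m" "j < m"
  then have "int_size (g i j) - 1 \<le> N" using entry_size[of i j] by (simp add: N_def)
  then have "(2::int) ^ (int_size (g i j) - 1) \<le> 2 ^ N" by (intro power_increasing) auto
  then show "\<bar>g i j\<bar> \<le> 2 ^ N" using abs_less_int_size[of "g i j"] by linarith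
qed

lemma fad_pow:
  assumes "0 < m" "t \<le> m" "i < m" "j < m"
  shows "\<bar>fad m g t i j\<bar> \<le> 2 ^ (4 * (N * N))"
proof -
  have "\<bar>2 * int m * int m * 2 ^ N\<bar> \<le> 2 ^ (1 + N + N + N)"
    by (intro pow2_mult m_pow) auto
  then have "(2 * int m * int m * 2 ^ N) ^ t \<le> (2 ^ (1 + N + N + N)) ^ t"
    by (intro power_mono) auto
  also have "\<dots> = 2 ^ ((1 + N + N + N) * t)" by (rule power_mult[symmetric])
  finally have pow: "(2 * int m * int m * 2 ^ N) ^ t \<le> 2 ^ ((1 + N + N + N) * t)" .
  have "(1 + N + N + N) * t \<le> (4 * N) * N"
    using N_facts assms(2) by (intro mult_le_mono) auto
  then have "(2 * int m * int m * 2 ^ N) ^ t \<le> 2 ^ (4 * (N * N))"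
    by (intro pow2_weaken[OF pow]) (simp only: mult.assoc)
  moreover have "\<bar>fad m g t i j\<bar> \<le> (2 * int m * int m * 2 ^ N) ^ t"
    by (rule fad_bound) (use g_pow assms in auto)
  ultimately show ?thesis by linarith
qed

lemma fad_product_pow: "int m * (int m * (2 ^ N * 2 ^ (4 * (N * N)))) \<le> 2 ^ (7 * (N * N))"
proof -
  have 1: "\<bar>int m * (int m * (2 ^ N * 2 ^ (4 * (N * N))))\<bar> \<le> 2 ^ (N + (N + (N + 4 * (N * N))))"
    by (intro pow2_mult m_pow) auto
  have "N + (N + (N + 4 * (N * N))) \<le> 7 * (N * N)" using N_facts by linarith
  with abs_le_D1[OF 1] show ?thesis by (rule pow2_weaken)
qed

lemma d_pow: "\<bar>d\<bar> \<le> 2 ^ (7 * (N * N))"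
proof (cases "m = 0")
  case False
  let ?X = "2 ^ N * 2 ^ (4 * (N * N)) :: int"
  have "\<bar>\<Sum>l<m. g i l * fad m g (m - 1) l i\<bar> \<le> int m * ?X" if "i < m" for i
    using that g_pow fad_pow False by (intro abs_sum_le) (auto simp: abs_mult intro!: mult_mono)
  then have "\<bar>fad_trace m g (m - 1)\<bar> \<le> int m * (int m * ?X)"
    unfolding fad_trace_def by (rule abs_sum_le) auto
  then show ?thesis using fad_product_pow False by (simp add: d_def)
next
  case True
  then show ?thesis unfolding d_def by simp
qed

lemma e0_nonneg: "0 \<le> e0"
  by (auto simp: e0_def intro!: sum_nonneg)

lemma e0_pow: "e0 \<le> 2 ^ (4 * N)"
proof -
  have "\<bar>g p q * g p q\<bar> \<le> 2 ^ N * 2 ^ N" if "p < m" "q < m" for p q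
    unfolding abs_mult using that g_pow by (intro mult_mono) auto
  then have "\<bar>\<Sum>q<m. g p q * g p q\<bar> \<le> int m * (2 ^ N * 2 ^ N)" if "p < m" for p
    using that by (intro abs_sum_le) auto
  then have "\<bar>e0\<bar> \<le> int m * (int m * (2 ^ N * 2 ^ N))"
    unfolding e0_def by (rule abs_sum_le) auto
  moreover have "\<bar>int m * (int m * (2 ^ N * 2 ^ N))\<bar> \<le> 2 ^ (N + (N + (N + N)))"
    by (intro pow2_mult m_pow) auto
  moreover have "N + (N + (N + N)) = 4 * N" by simp
  ultimately show ?thesis by fastforce
qed

lemma w1_pow: "w1 \<le> 2 ^ (15 * (N * N))" "1 \<le> w1"
proof -
  have "\<bar>20 * int m + 1\<bar> \<le> 2 ^ (5 + N)"
  proof -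
    have "(1::int) \<le> 2 ^ N" by simp
    then have "\<bar>20 * int m + 1\<bar> \<le> 32 * 2 ^ N" using m_pow by linarith
    then show ?thesis by (simp add: power_add)
  qed
  from pow2_mult[OF this this] have sq: "(20 * int m + 1)\<^sup>2 \<le> 2 ^ (5 + N + (5 + N))"
    by (simp add: power2_eq_square)
  have "(2::int) ^ (5 + N + (5 + N)) \<le> 2 ^ (10 + 4 * N)" "(2::int) ^ (4 * N) \<le> 2 ^ (10 + 4 * N)"
    by (intro power_increasing; simp)+
  then have "w1 \<le> 2 ^ (10 + 4 * N) + 2 ^ (10 + 4 * N)" using sq e0_pow unfolding w1_def by linarith
  also have "\<dots> = 2 ^ (11 + 4 * N)" by (simp add: power_add)
  also have "\<dots> \<le> 2 ^ (15 * (N * N))" by (rule power_increasing) (use N_facts in linarith, simp)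
  finally show "w1 \<le> 2 ^ (15 * (N * N))" .
  have "20 * int m + 1 \<le> (20 * int m + 1)\<^sup>2" by (rule self_le_power) simp_all
  then have "1 \<le> (20 * int m + 1)\<^sup>2" by (rule order_trans[rotated]) simp
  then show "1 \<le> w1" using e0_nonneg unfolding w1_def by linarith
qed

lemma w1_sq_pow: "w1\<^sup>2 \<le> 2 ^ (30 * (N * N))"
  using pow2_mult[of w1 "15 * (N * N)" w1 "15 * (N * N)"] w1_pow by (simp add: power2_eq_square)

lemma s_pow: "s \<le> 2 ^ (45 * (N * N))" "0 < s"
proof -
  have 1: "\<bar>2 * (d * d) * w1\<^sup>2\<bar> \<le> 2 ^ (1 + (7 * (N * N) + 7 * (N * N)) + 30 * (N * N))"
    by (intro pow2_mult d_pow) (use w1_sq_pow in auto)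
  have "1 + (7 * (N * N) + 7 * (N * N)) + 30 * (N * N) \<le> 45 * (N * N)"
    using N_facts by linarith
  with abs_le_D1[OF 1] show "s \<le> 2 ^ (45 * (N * N))"
    unfolding s_def power2_eq_square[of d] by (rule pow2_weaken)
  show "0 < s" using d_nonzero w1_pow by (simp add: s_def)
qed

sublocale elimination m e0 w1 "2 * s" "\<lambda>j l. \<Sum>p<m. g p j * g p l"
proof
  show "\<bar>\<Sum>p<m. g p j * g p l\<bar> \<le> e0" if "j < m" "l < m" for j l
    unfolding e0_def by (rule gram_entry_le[where z = g, OF that le_refl])
  show "4 * w1\<^sup>2 \<le> 2 * s"
  proof -
    have "0 < d\<^sup>2" using d_nonzero by simp
    then have 1: "1 \<le> d\<^sup>2" by linarith
    have "1 * w1\<^sup>2 \<le> d\<^sup>2 * w1\<^sup>2" using d_nonzero by (intro mult_right_mono 1) simp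
    then show ?thesis by (simp add: s_def)
  qed
  show "0 \<le> e0" by (rule e0_nonneg)
  show "w1 = e0 + (20 * int m + 1)\<^sup>2" by (rule w1_def)
qed

lemma b_pow: "2 * s < 2 ^ b"
proof -
  have "2 * s \<le> 2 ^ Suc (45 * (N * N))" by (rule pow2_double[OF s_pow(1)])
  also have "\<dots> < 2 ^ b" unfolding b_def by (rule power_strict_increasing) (use N_facts in linarith, simp)
  finally show ?thesis .
qed

lemma k_facts: "b \<le> 2 ^ k" "k \<le> b" "2 ^ k \<le> 2 * b"
proof -
  have ex: "b \<le> 2 ^ b" using less_exp[of b] by (rule less_imp_le)
  show "b \<le> 2 ^ k" unfolding k_def by (rule LeastI[where P = "\<lambda>k. b \<le> 2 ^ k", OF ex])
  show "k \<le> b" unfolding k_def by (rule Least_le[where P = "\<lambda>k. b \<le> 2 ^ k", OF ex])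
  show "2 ^ k \<le> 2 * b"
  proof (cases k)
    case (Suc k')
    then have "k' < (LEAST k. b \<le> 2 ^ k)" unfolding k_def by linarith
    from not_less_Least[OF this] have "2 ^ k' \<le> b" by linarith
    then show ?thesis unfolding Suc power_Suc by linarith
  next
    case 0
    then show ?thesis unfolding b_def by simp
  qed
qed

lemma k_pow: "2 * s < 2 ^ 2 ^ k" "w1\<^sup>2 < 2 ^ 2 ^ k"
proof -
  have "(2::int) ^ b \<le> 2 ^ 2 ^ k" by (rule power_increasing[OF k_facts(1)]) simp
  with b_pow show "2 * s < 2 ^ 2 ^ k" by (rule order_less_le_trans)
  moreover have "w1\<^sup>2 \<le> 2 * s" using S_ge zero_le_power2[of w1] by linarith
  ultimately show "w1\<^sup>2 < 2 ^ 2 ^ k" by (rule order_le_less_trans[rotated])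
qed

definition nmax :: nat where "nmax = m + m * (2 * k + 4)"

text \<open>A crude estimate, for the running time and the memory bound; the logarithmic bound on
  the dimension is \<open>nmax_bound\<close>.\<close>

lemma nmax_le: "nmax \<le> 103 * (N * (N * N))"
proof -
  have "nmax = m * (2 * k + 5)" by (simp add: nmax_def algebra_simps)
  also have "\<dots> \<le> N * (103 * (N * N))"
  proof (rule mult_le_mono[OF N_facts(2)])
    show "2 * k + 5 \<le> 103 * (N * N)" using k_facts(2) N_facts(5) unfolding b_def by linarith
  qed
  finally show ?thesis by simp
qed

lemma nmax_pow: "int nmax \<le> 2 ^ (10 * (N * N))"
proof -
  have "int nmax \<le> 103 * (int N * (int N * int N))"
    using nmax_le by (metis of_nat_le_iff of_nat_mult of_nat_numeral)
  also have "\<dots> \<le> 2 ^ 7 * (2 ^ N * (2 ^ N * 2 ^ N))" using N_pow by (intro mult_mono) auto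
  also have "\<dots> = 2 ^ (7 + (N + (N + N)))" by (simp only: power_add)
  also have "\<dots> \<le> 2 ^ (10 * (N * N))" by (rule power_increasing) (use N_facts in linarith, simp)
  finally show ?thesis .
qed

lemma le_B: "a \<le> 2 ^ e \<Longrightarrow> e \<le> 100 * (N * N) \<Longrightarrow> a \<le> B"
  unfolding B_def by (rule pow2_weaken)

lemma less_B: "a \<le> 2 ^ e \<Longrightarrow> e < 100 * (N * N) \<Longrightarrow> a < B"
  unfolding B_def by (rule order_le_less_trans[OF _ power_strict_increasing]) auto

lemma B_facts:
  "int m \<le> B" "int (m * m) \<le> B" "1 \<le> B" "i < m \<Longrightarrow> j < m \<Longrightarrow> \<bar>g i j\<bar> \<le> B"
  "2 * (int m * (int m * (2 ^ N * 2 ^ (4 * (N * N))))) \<le> B"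
  "e0 + w1 + w1\<^sup>2 + 2 * s \<le> B" "2 * (2 * s) + 1 < B" "int nmax < B"
  "n \<le> nmax \<Longrightarrow> int (n * n) \<le> B" "int m * (4 * s) \<le> B"
proof -
  have N100: "N \<le> 100 * (N * N)" using N_facts by linarith
  have "int m \<le> 2 ^ N" using m_pow by linarith
  from le_B[OF this N100] show "int m \<le> B" .
  have "int (m * m) \<le> int N" using N_facts(3) by (simp only: of_nat_le_iff)
  then have "int (m * m) \<le> 2 ^ N" using N_pow by linarith
  from le_B[OF this N100] show "int (m * m) \<le> B" .
  show "1 \<le> B" by (simp add: B_def)
  show "\<bar>g i j\<bar> \<le> B" if "i < m" "j < m" by (rule le_B[OF g_pow[OF that] N100])
  have "2 * (int m * (int m * (2 ^ N * 2 ^ (4 * (N * N))))) \<le> 2 ^ Suc (7 * (N * N))"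
    by (rule pow2_double[OF fad_product_pow])
  then show "2 * (int m * (int m * (2 ^ N * 2 ^ (4 * (N * N))))) \<le> B"
    by (rule le_B) (use N_facts in linarith)
  have inc: "(2::int) ^ e \<le> 2 ^ (46 * (N * N))" if "e \<le> 46 * (N * N)" for e
    by (rule power_increasing[OF that]) simp
  have "e0 \<le> 2 ^ (46 * (N * N))"
    by (rule order_trans[OF e0_pow inc]) (use N_facts in linarith)
  moreover have "w1 \<le> 2 ^ (46 * (N * N))"
    by (rule order_trans[OF w1_pow(1) inc]) simp
  moreover have "w1\<^sup>2 \<le> 2 ^ (46 * (N * N))"
    by (rule order_trans[OF w1_sq_pow inc]) simp
  moreover have s46: "2 * s \<le> 2 ^ (46 * (N * N))"
  proof (rule order_trans[OF _ inc])
    show "2 * s \<le> 2 ^ Suc (45 * (N * N))" by (rule pow2_double[OF s_pow(1)])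
  qed (use N_facts in linarith)
  ultimately have "e0 + w1 + w1\<^sup>2 + 2 * s \<le> 4 * 2 ^ (46 * (N * N))" by linarith
  then have "e0 + w1 + w1\<^sup>2 + 2 * s \<le> 2 ^ (46 * (N * N) + 2)" by (simp only: pow2_quadruple)
  then show "e0 + w1 + w1\<^sup>2 + 2 * s \<le> B" by (rule le_B) (use N_facts in linarith)
  have "2 * (2 * s) + 1 \<le> 4 * 2 ^ (46 * (N * N))" using s46 s_pow(2) by linarith
  then have "2 * (2 * s) + 1 \<le> 2 ^ (46 * (N * N) + 2)" by (simp only: pow2_quadruple)
  then show "2 * (2 * s) + 1 < B" by (rule less_B) (use N_facts in linarith)
  show "int nmax < B" by (rule less_B[OF nmax_pow]) (use N_facts in linarith)
  show "int (n * n) \<le> B" if "n \<le> nmax"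
  proof -
    have "\<bar>int n\<bar> \<le> 2 ^ (10 * (N * N))" using that nmax_pow by linarith
    from pow2_mult[OF this this] have "int (n * n) \<le> 2 ^ (10 * (N * N) + 10 * (N * N))" by simp
    then show ?thesis by (rule le_B) (use N_facts in linarith)
  qed
  have "4 * s \<le> 2 ^ Suc (46 * (N * N))" using pow2_double[OF s46] by linarith
  then have "\<bar>int m * (4 * s)\<bar> \<le> 2 ^ (N + (Suc (46 * (N * N))))"
    using s_pow(2) by (intro pow2_mult m_pow) linarith
  then have "int m * (4 * s) \<le> 2 ^ (N + (Suc (46 * (N * N))))" by linarith
  then show "int m * (4 * s) \<le> B" by (rule le_B) (use N_facts in linarith)
qed

lemma scaled: "\<exists>X. \<forall>i<m. \<forall>j<m. (\<Sum>l<m. G $$ (i, l) * X l j) = (if i = j then s else 0)"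
proof (intro exI allI impI)
  fix i j assume ij: "i < m" "j < m"
  \<comment> \<open>By \<open>fad_inverse\<close>, G times \<open>m * fad m g (m - 1)\<close> is
    \<open>d I\<close>; multiplying by the cofactor \<open>?c\<close> of d in s gives
    \<open>s I\<close>.\<close>
  let ?c = "2 * d * w1\<^sup>2"
  have "(\<Sum>l<m. G $$ (i, l) * (int m * fad m g (m - 1) l j * ?c))
    = (int m * (\<Sum>l<m. g i l * fad m g (m - 1) l j)) * ?c"
    unfolding sum_distrib_left sum_distrib_right g_def by (intro sum.cong) (auto simp: mult_ac)
  also have "\<dots> = (if i = j then s else 0)"
    using fad_inverse[OF ij, of g] ij by (auto simp: d_def s_def power2_eq_square)
  finally show "(\<Sum>l<m. G $$ (i, l) * (int m * fad m g (m - 1) l j * ?c)) = (if i = j then s else 0)" .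
qed

lemma projection_data_final:
  assumes inv: "row_inv m r z c" and z: "\<forall>p<m. \<forall>j<m. z p j = g p j"
  shows "projection_data m c s G z"
proof
  show "m \<le> c" using inv by (simp add: row_inv_def unit_inv_def)
  show "\<exists>p<c. m \<le> p \<and> z p a = 1 \<and> (\<forall>b<a. z p b = 0)" if "a < m" for a
    using inv that by (simp add: row_inv_def unit_inv_def)
  show "(\<Sum>p<c. z p j * z p l) = (if j = l then 2 * s else 0)" if "j < m" "l < m" for j l
    by (rule row_final[OF inv that])
qed (use G s_pow scaled z in \<open>auto simp: g_def\<close>)

lemma row_inv_start:
  assumes "\<And>j l. j < m \<Longrightarrow> l < m \<Longrightarrow> r j l = (if j = l then 2 * s else 0) - (\<Sum>p<m. g p j * g p l)"
    and "\<And>p j. p < m \<Longrightarrow> j < m \<Longrightarrow> z p j = g p j"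
  shows "row_inv 0 r z m"
proof -
  have "(\<Sum>p<m. z p j * z p l) = (\<Sum>p<m. g p j * g p l)" if "j < m" "l < m" for j l
    using assms(2) that by (intro sum.cong) auto
  then show ?thesis using assms(1)
    by (auto simp: row_inv_def gram_inv_def zero_inv_def unit_inv_def near_def)
qed

definition steps :: nat where
  "steps = (3 * (m * m) + 3) + ((m * (m * m * (3 * m + 9) + 3 * m + 9) + 3 * (m * m) + 5) +
     ((6 * (m * m) + m * (3 * (m * m) + 4) + 10) +
     ((m * ((2 * k + 4) * (4 * b + 3 * (m * m) + 3 * m + 12) + 5) + 2) + (nmax * nmax * (3 * m + 7) + 4))))"

definition good_output :: "int list \<Rightarrow> bool" where
  "good_output ys \<longleftrightarrow> (\<exists>n z. n \<le> nmax \<and> projection_data m n s G z \<and>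
     ys = int n # s # concat (map (\<lambda>x. [projection_data.num m s z (x div n) (x mod n), s]) [0..<n * n]))"

lemma wp_main:
  "wp B main_com steps (\<lambda>_ _ _ _ _ ys. good_output ys) (\<lambda>_. 0) (\<lambda>_. 0) (\<lambda>_. 0) (\<lambda>_. 0) (enc_mat G) []"
  unfolding main_com_def steps_def enc_mat_eq[OF G]
proof (rule wp_seq, rule wp_read_com, goal_cases)
  case (3 x)
  then have "m > 0" by (cases m) auto
  then show ?case using B_facts(4)[of "x div m" "x mod m"] 3 by (simp add: g_def less_mult_imp_div_less)
next
  case 4
  let ?Z = "fill 0 (m * m) (\<lambda>x. G $$ (x div m, x mod m)) (\<lambda>_. 0)"
  have Z: "entry m ?Z i j = g i j" if "i < m" "j < m" for i j
    using entry_fill[OF that, of "\<lambda>i j. G $$ (i, j)"] by (simp add: g_def)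
  show ?case
  proof (rule wp_seq, rule wp_fad_com[where g = g and A = "2 ^ N" and X = "2 ^ (4 * (N * N))"], goal_cases)
    case (2 i j)
    then show ?case by (rule Z)
  next
    case (3 i j)
    then show ?case by (rule g_pow)
  next
    case (5 t i j)
    then show ?case by (intro fad_pow) auto
  next
    case 10
    show ?case by (rule B_facts(5))
  next
    case (11 V1 R1 P1)
    show ?case
    proof (rule wp_seq, rule wp_prep_com[where g = g and d = d and ?e0.0 = e0 and ?w1.0 = w1 and s = s], goal_cases)
      case (3 i j)
      then show ?case by (rule Z)
    next
      case 4
      show ?case by (rule e0_def)
    next
      case 5
      show ?case by (rule w1_def)
    next
      case 6
      show ?case by (rule s_def)
    next
      case 9
      show ?case by (rule B_facts(6))
    next
      case (10 V2 R2)
      have inv: "row_inv 0 (entry m R2) (entry m ?Z) m" by (rule row_inv_start) (use 10 Z in auto)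
      show ?case
      proof (rule wp_seq, rule wp_elim[OF _ _ _ inv, where k = k and b = b], goal_cases)
        case 5
        show ?case by (rule order_less_le_trans[OF k_pow(1)]) simp
      next
        case (11 V3 Z3 R3 n)
        then have n: "n \<le> nmax" by (simp add: nmax_def)
        have pd: "projection_data m n s G (entry m Z3)"
          using 11 Z by (intro projection_data_final) auto
        \<comment> \<open>The diagonal of \<open>Z Z\<^sup>T\<close> is \<open>2 * s\<close> and
          consists of sums of squares, which bounds every single entry.\<close>
        have col: "entry m Z3 p r * entry m Z3 p r \<le> 2 * s" if "p < n" "r < m" for p r
        proof -
          have "entry m Z3 p r * entry m Z3 p r \<le> (\<Sum>p<n. entry m Z3 p r * entry m Z3 p r)"
            using that by (intro member_le_sum) auto
          then show ?thesis using row_final[OF 11(6) that(2) that(2)] by simp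
        qed
        have "wp B out_com (n * n * (3 * m + 7) + 4) (\<lambda>_ _ _ _ _ ys. good_output ys) V3 Z3 R3 P1 [] []"
        proof (rule wp_out_com[where m = m and c = n and s = s], goal_cases)
          case (6 p q t)
          have "\<bar>\<Sum>r<t. entry m Z3 p r * entry m Z3 q r\<bar> \<le> int m * (4 * s)"
          proof (rule abs_sum_le)
            show "\<bar>entry m Z3 p r * entry m Z3 q r\<bar> \<le> 4 * s" if "r < t" for r
              using abs_mult_le_squares[of "entry m Z3 p r" "entry m Z3 q r"] col[of p r] col[of q r] 6 that
              by linarith
          qed (use 6 s_pow in auto)
          then show ?case using B_facts(10) by linarith
        next
          case (7 V4)
          have "projection_data.num m s (entry m Z3) p q
            = (if p = q then s else 0) - (\<Sum>r<m. entry m Z3 p r * entry m Z3 q r)" for p q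
            by (rule projection_data.num_def[OF pd])
          then show ?case unfolding good_output_def
            using n pd by (intro exI[of _ n] exI[of _ "entry m Z3"]) simp
        qed (use 11 10 B_facts(1) B_facts(9)[OF n] in auto)
        then show ?case
          by (rule wp_weaken) (use n in \<open>auto intro!: mult_le_mono\<close>)
      qed (use 10 k_pow b_pow B_facts(1,2,7,8) in \<open>auto simp: nmax_def\<close>)
    qed (use 11 B_facts(1,2) in \<open>auto simp: d_def\<close>)
  qed (use B_facts(1,2,3) in auto)
qed (use B_facts(1,2) in auto)

end

section \<open>Polynomial running time and the bound on the dimension\<close>

context lattice_input
begin

lemma int_size_B: "int_size B \<le> 102 * (N * N)"
proof -
  have "int_size B \<le> Suc (Suc (100 * (N * N)))"
    unfolding int_size_le_iff by (simp add: B_def)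
  then show ?thesis using N_facts by linarith
qed

lemma steps_le: "steps \<le> 214 * (103 * N ^ 3) ^ 4"
proof -
  define Y where "Y = 103 * (N * (N * N))"
  have NN: "N * N \<le> N * (N * N)" using mult_le_mono1[OF N_facts(1), of "N * N"] by simp
  have Y: "m \<le> Y" "b \<le> Y" "k \<le> Y" "nmax \<le> Y" "1 \<le> Y"
    using N_facts NN k_facts(2) nmax_le unfolding Y_def b_def by linarith+
  have "steps \<le> (3 * (Y * Y) + 3) + ((Y * (Y * Y * (3 * Y + 9) + 3 * Y + 9) + 3 * (Y * Y) + 5) +
     ((6 * (Y * Y) + Y * (3 * (Y * Y) + 4) + 10) +
     ((Y * ((2 * Y + 4) * (4 * Y + 3 * (Y * Y) + 3 * Y + 12) + 5) + 2) + (Y * Y * (3 * Y + 7) + 4))))"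
    unfolding steps_def by (intro add_mono mult_le_mono Y le_refl)
  \<comment> \<open>Lower powers of Y are replaced by the fourth; 214 is the sum of the coefficients
    9, 41, 74, 66 and 24.\<close>
  also have "\<dots> \<le> 214 * (Y * (Y * (Y * Y)))"
  proof -
    have 2: "Y \<le> Y * Y" by (rule le_square)
    have 3: "Y * Y \<le> Y * (Y * Y)" using mult_le_mono2[OF 2] .
    have 4: "Y * (Y * Y) \<le> Y * (Y * (Y * Y))" using mult_le_mono2[OF 3] .
    have "(3 * (Y * Y) + 3) + ((Y * (Y * Y * (3 * Y + 9) + 3 * Y + 9) + 3 * (Y * Y) + 5) +
     ((6 * (Y * Y) + Y * (3 * (Y * Y) + 4) + 10) +
     ((Y * ((2 * Y + 4) * (4 * Y + 3 * (Y * Y) + 3 * Y + 12) + 5) + 2) + (Y * Y * (3 * Y + 7) + 4))))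
     = 9 * (Y * (Y * (Y * Y))) + 41 * (Y * (Y * Y)) + 74 * (Y * Y) + 66 * Y + 24"
      by (simp add: algebra_simps)
    then show ?thesis using 2 3 4 Y(5) by linarith
  qed
  also have "Y * (Y * (Y * Y)) = (103 * N ^ 3) ^ 4"
    by (simp add: Y_def power3_eq_cube power4_eq_xxxx mult.assoc)
  finally show ?thesis .
qed

lemma time_bound: "steps * (10000 * int_size B) \<le> 214 * 103 ^ 4 * 1020000 * N ^ 14"
proof -
  have "steps * (10000 * int_size B) \<le> (214 * (103 * N ^ 3) ^ 4) * (10000 * (102 * (N * N)))"
    by (intro mult_le_mono steps_le int_size_B le_refl)
  also have "\<dots> = 214 * 103 ^ 4 * 1020000 * (N ^ 12 * (N * N))"
    by (simp add: power_mult_distrib power_mult[symmetric])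
  also have "N ^ 12 * (N * N) = N ^ 14"
    unfolding power2_eq_square[symmetric] power_add[symmetric] by simp
  finally show ?thesis .
qed

lemma execution:
  "\<exists>ys t. computes_in_time main_com (enc_mat G) ys t \<and> good_output ys \<and>
     t \<le> 214 * 103 ^ 4 * 1020000 * N ^ 14"
proof -
  have mem: "mem (\<lambda>_. 0) (\<lambda>_. 0) (\<lambda>_. 0) (\<lambda>_. 0) = (\<lambda>_. 0)" by (auto simp: mem_def Let_def)
  have "bounded_by B (\<lambda>_. 0)" using B_facts(3) by (simp add: bounded_by_def)
  then have "\<exists>t V Z R P xs ys. exec main_com (\<lambda>_. 0, enc_mat G, []) t (mem V Z R P, xs, ys) \<and>
      t \<le> steps * (10000 * int_size B) \<and> all_bounded B V Z R P \<and> good_output ys"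
    using wp_main unfolding wp_def mem by simp
  then obtain t M xs ys where "exec main_com (\<lambda>_. 0, enc_mat G, []) t (M, xs, ys)"
    "t \<le> steps * (10000 * int_size B)" "good_output ys" by blast
  then show ?thesis
    unfolding computes_in_time_def using time_bound by (intro exI[of _ ys] exI[of _ t]) auto
qed

text \<open>For \<open>m = 1\<close> the term \<open>m * ln m\<close> vanishes, so the bound on n
  needs \<open>ln (mat_size G)\<close> to be positive. If the first row were 0,
  \<open>fad_inverse\<close> would give \<open>d = 0\<close>; a nonzero entry takes two
  bits.\<close>

lemma mat_size_ge_2:
  assumes "0 < m"
  shows "2 \<le> mat_size G"
proof -
  have "\<exists>l<m. g 0 l \<noteq> 0"
  proof (rule ccontr)
    assume "\<not> (\<exists>l<m. g 0 l \<noteq> 0)"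
    then have row: "g 0 l = 0" if "l < m" for l using that by blast
    have "fad_trace m g (m - 1) * (if 0 = (0::nat) then 1 else 0) = 0"
      using fad_inverse[OF assms assms, of g] row by simp
    then show False using d_nonzero assms by (simp add: d_def)
  qed
  then obtain l where l: "l < m" "g 0 l \<noteq> 0" by blast
  have "\<not> int_size (g 0 l) \<le> Suc 0" unfolding int_size_le_iff using l(2) by simp
  then show ?thesis using entry_size[OF assms l(1)] by linarith
qed

text \<open>Since N is at most three times the size M of G, \<open>2 ^ k \<le> 2 * b\<close> is at
  most \<open>2 ^ 10 * M\<^sup>2\<close>. With \<open>ln 2 \<ge> 1 / 2\<close> this gives
  \<open>k \<le> 10 + 4 * ln M\<close>.\<close>

lemma nmax_bound: "real nmax \<le> 58 * (real m * ln (real m) + real m * ln (real (mat_size G)))"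
proof (cases "m = 0")
  case False
  then have m: "0 < m" by simp
  let ?M = "mat_size G"
  have M: "2 \<le> ?M" by (rule mat_size_ge_2[OF m])
  have "int_size (int m) \<le> m + 2" using int_size_const[of "int m"] by simp
  then have N: "N \<le> 3 * ?M" using m_sq_le le_square[of m] M unfolding N_def by linarith
  note k_facts(3)
  also have "2 * b \<le> 98 * (N * N)"
  proof -
    have "2 * (48 * x + 1) \<le> 98 * x" if "1 \<le> x" for x :: nat using that by simp
    then show ?thesis using N_facts(5) unfolding b_def .
  qed
  also have "\<dots> \<le> 98 * ((3 * ?M) * (3 * ?M))" by (intro mult_le_mono N le_refl)
  also have "\<dots> \<le> 2 ^ 10 * ?M ^ 2" by (simp add: power2_eq_square)
  finally have "real (2 ^ k) \<le> real (2 ^ 10 * ?M ^ 2)" by (simp only: of_nat_le_iff)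
  then have "ln (2 ^ k) \<le> ln (2 ^ 10 * real ?M ^ 2)" using M by (subst ln_le_cancel_iff) auto
  moreover have "ln (2 ^ 10 * real ?M ^ 2) = ln (2 ^ 10) + ln (real ?M ^ 2)"
    using M by (simp add: ln_mult)
  moreover have "ln ((2::real) ^ 10) = 10 * ln 2" "ln (real ?M ^ 2) = 2 * ln (real ?M)"
      "ln ((2::real) ^ k) = real k * ln 2"
    using ln_realpow[of "2::real" 10] ln_realpow[of "real ?M" 2] ln_realpow[of "2::real" k] M by auto
  ultimately have k2: "real k * ln 2 \<le> 10 * ln 2 + 2 * ln (real ?M)"
    by linarith
  have l2: "1 / 2 \<le> ln (2::real)" using ln_le_minus_one[of "1 / 2 :: real"] by (simp add: ln_div)
  have lM: "1 / 2 \<le> ln (real ?M)"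
    using order_trans[OF l2, of "ln (real ?M)"] M by simp
  have "real k \<le> 10 + 4 * ln (real ?M)"
  proof (rule ccontr)
    assume "\<not> real k \<le> 10 + 4 * ln (real ?M)"
    then have "4 * ln (real ?M) * ln 2 < (real k - 10) * ln 2" using l2 by (intro mult_strict_right_mono) auto
    moreover have "4 * ln (real ?M) * (1 / 2) \<le> 4 * ln (real ?M) * ln 2"
      using l2 lM by (intro mult_left_mono) auto
    ultimately show False using k2 by (simp add: algebra_simps)
  qed
  \<comment> \<open>The left-hand side is at most \<open>25 + 8 * ln M\<close>, and
    \<open>ln M \<ge> 1 / 2\<close> turns 25 into \<open>50 * ln M\<close>; this is the constant
    58.\<close>
  then have "2 * real k + 5 \<le> 58 * ln (real ?M)" using lM by linarith
  then have "real m * (2 * real k + 5) \<le> real m * (58 * ln (real ?M))" by (intro mult_left_mono) auto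
  moreover have "real nmax = real m * (2 * real k + 5)" by (simp add: nmax_def algebra_simps)
  moreover have "0 \<le> real m * ln (real m)" using m by simp
  ultimately show ?thesis by (simp add: algebra_simps)
next
  case True
  then show ?thesis unfolding nmax_def by simp
qed

lemma decode:
  assumes "good_output ys"
  shows "\<exists>n vs. is_code (n, s, vs) ys \<and> m \<le> n \<and> length vs = n \<and> n \<le> nmax \<and>
    orthonormal_basis n (map (map_vec real_of_rat) vs) \<and>
    int_lattice G = (\<lambda>w. real_of_int s \<cdot>\<^sub>v vec_first w m) ` int_span n (map (map_vec real_of_rat) vs)"
proof -
  from assms obtain n z where n: "n \<le> nmax" and pd: "projection_data m n s G z"
    and ys: "ys = int n # s # concat (map (\<lambda>x. [projection_data.num m s z (x div n) (x mod n), s]) [0..<n * n])"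
    unfolding good_output_def by blast
  interpret pd: projection_data m n s G z by (rule pd)
  let ?fs = "map (\<lambda>x. (pd.num (x div n) (x mod n), s)) [0..<n * n]"
  have "concat (map list_of_vec pd.basis_vecs)
      = map (\<lambda>x. of_int (pd.num (x div n) (x mod n)) / of_int s) [0..<n * n]"
    using concat_map_upt[of "\<lambda>p q. of_int (pd.num p q) / of_int s :: rat" n n]
    by (simp add: pd.basis_vecs_def o_def)
  then have "list_all2 is_fraction (concat (map list_of_vec pd.basis_vecs)) ?fs"
    using pd.s by (simp add: list_all2_map1 list_all2_map2 list_all2_same is_fraction_def)
  moreover have "ys = int n # s # concat (map (\<lambda>(p, q). [p, q]) ?fs)" by (simp add: ys o_def)
  ultimately have "is_code (n, s, pd.basis_vecs) ys" by (auto simp: is_code_def)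
  moreover have "length pd.basis_vecs = n" by (simp add: pd.basis_vecs_def)
  ultimately show ?thesis using n pd.m_le_n pd.orthonormal pd.lattice_eq
    by (intro exI[of _ n] exI[of _ pd.basis_vecs] conjI)
qed

end

theorem theorem1p2:
  shows "\<exists>(f :: int mat \<Rightarrow> nat \<times> int \<times> rat vec list) (C :: real).
    polytime_computable_on {G. square_mat G \<and> real_rank G = dim_row G} enc_mat is_code f \<and>
    (\<forall>(m :: nat) (G :: int mat). G \<in> carrier_mat m m \<and> real_rank G = m \<longrightarrow>
      (case f G of (n, s, vs) \<Rightarrow>
        m \<le> n \<and> s > 0 \<and> length vs = n \<and>
        orthonormal_basis n (map (map_vec real_of_rat) vs) \<and>
        int_lattice G = (\<lambda>w. real_of_int s \<cdot>\<^sub>v vec_first w m) ` int_span n (map (map_vec real_of_rat) vs) \<and>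
        real n \<le> C * (real m * ln (real m) + real m * ln (real (mat_size G)))))"
proof -
  define good where "good m G r \<longleftrightarrow> (case r of (n, s, vs) \<Rightarrow>
        m \<le> n \<and> s > 0 \<and> length vs = n \<and>
        orthonormal_basis n (map (map_vec real_of_rat) vs) \<and>
        int_lattice G = (\<lambda>w. real_of_int s \<cdot>\<^sub>v vec_first w m) ` int_span n (map (map_vec real_of_rat) vs) \<and>
        real n \<le> 58 * (real m * ln (real m) + real m * ln (real (mat_size G))))"
    for m :: nat and G :: "int mat" and r :: "nat \<times> int \<times> rat vec list"
  define p :: "nat poly" where "p = monom (214 * 103 ^ 4 * 1020000) 14"
  define A where "A = {G :: int mat. square_mat G \<and> real_rank G = dim_row G}"
  \<comment> \<open>The result r is coupled with the run whose output encodes it, so that one choice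
    of r for each G serves both the computability and the mathematical properties.\<close>
  define ok where "ok G r \<longleftrightarrow> good (dim_row G) G r \<and>
      (\<exists>ys t. computes_in_time main_com (enc_mat G) ys t \<and> is_code r ys \<and>
        t \<le> poly p (\<Sum>a\<leftarrow>enc_mat G. int_size a))" for G r
  have ex: "\<exists>r. ok G r" if "G \<in> A" for G
  proof -
    have "G \<in> carrier_mat (dim_row G) (dim_row G)" "real_rank G = dim_row G"
      using that by (auto simp: A_def)
    then interpret lattice_input "dim_row G" G by (rule lattice_input.intro)
    obtain ys t where run: "computes_in_time main_com (enc_mat G) ys t" "good_output ys"
      "t \<le> 214 * 103 ^ 4 * 1020000 * N ^ 14"
      using execution by blast
    obtain n vs where dec: "is_code (n, s, vs) ys" "dim_row G \<le> n" "length vs = n" "n \<le> nmax"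
      "orthonormal_basis n (map (map_vec real_of_rat) vs)"
      "int_lattice G = (\<lambda>w. real_of_int s \<cdot>\<^sub>v vec_first w (dim_row G)) ` int_span n (map (map_vec real_of_rat) vs)"
      using decode[OF run(2)] by blast
    have "real n \<le> real nmax" using dec(4) by simp
    then have "real n \<le> 58 * (real (dim_row G) * ln (real (dim_row G)) + real (dim_row G) * ln (real (mat_size G)))"
      using nmax_bound by (rule order_trans)
    then have "good (dim_row G) G (n, s, vs)"
      unfolding good_def prod.case using dec(2,3,5,6) s_pow(2) by (intro conjI)
    moreover have "t \<le> poly p (\<Sum>a\<leftarrow>enc_mat G. int_size a)"
      using run(3) unfolding enc_mat_size[OF G] p_def poly_monom N_def .
    ultimately show ?thesis unfolding ok_def using run(1) dec(1) by blast
  qed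
  have "\<exists>f. \<forall>G\<in>A. ok G (f G)"
    by (rule bchoice) (use ex in blast)
  then obtain f where f: "\<And>G. G \<in> A \<Longrightarrow> ok G (f G)"
    by blast
  have "\<exists>ys t. computes_in_time main_com (enc_mat G) ys t \<and> is_code (f G) ys \<and>
      t \<le> poly p (\<Sum>a\<leftarrow>enc_mat G. int_size a)" if "G \<in> A" for G
    using f[OF that] unfolding ok_def by (rule conjunct2)
  then have poly: "polytime_computable_on A enc_mat is_code f"
    unfolding polytime_computable_on_def by (intro exI[of _ main_com] exI[of _ p] ballI)
  have fG: "good m G (f G)" if "G \<in> carrier_mat m m \<and> real_rank G = m" for m G
  proof -
    have "G \<in> A" and m: "dim_row G = m" using that by (auto simp: A_def)
    from f[OF this(1)] have "good (dim_row G) G (f G)" unfolding ok_def by (rule conjunct1)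
    then show ?thesis unfolding m .
  qed
  show ?thesis
  proof (rule exI[of _ f], rule exI[of _ 58], rule conjI, goal_cases)
    case 1
    show ?case using poly unfolding A_def .
  next
    case 2
    show ?case by (intro allI impI) (rule fG[unfolded good_def])
  qed
qed

end
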